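(* Let $f:M\to M$ be a geometrically finite one-dimensional mapping. Then its scaling function $|s_f|:\Sigma_f^{*}\to\mathbb{R}$ is discontinuous.
   Context: $M$ is an oriented connected compact one-dimensional $C^2$ Riemannian manifold (an interval or a circle); $|I|$ is the length of an interval $I\subset M$, and derivatives and expressions such as $|x-c|$ are taken with respect to the length element and the orientation. Geometrically finite mappings. Let $f:M\to M$ be $C^1$. A critical point is a point $c$ with $f'(c)=0$. It is a power law critical point if there is $\gamma\ge 1$ such that $f'(x)/|x-c|^{\gamma-1}$ has nonzero finite limits as $x\to c+$ and as $x\to c-$. Assume $f$ has only power law critical points, $CP=\{c_1,\dots,c_d\}$, with exponents $\gamma_1,\dots,\gamma_d$. It is assumed throughout that $f$ maps the boundary of $M$ (if nonempty) into itself and that the one-sided derivatives of $f$ at boundary points are nonzero. Let $\eta_0$ be the set of intervals of $M\setminus CP$. $f$ is called $C^{1+\alpha}$ ($0<\alpha\le 1$) if ( * ) the restrictions of $f$ to the intervals of $\eta_0$ are $C^1$ with $\alpha$-Hölder continuous derivatives, and ( ** ) each $c_i$ has a neighborhood $U_i$ in $M$ such that $f'(x)/|x-c_i|^{\gamma_i-1}$ is $\alpha$-Hölder continuous on $\{x\in U_i: x<c_i\}$ and on $\{x\in U_i:x>c_i\}$. $f$ is $C^{1+\alpha}$-geometrically finite if: (smooth condition) $f$ is $C^{1+\alpha}$; (finite condition) $\bigcup_{i\ge 0}f^{\circ i}(CP)$ is nonempty and finite; (no cycle condition) no critical point is periodic; (exponential decay condition) there are $K>0$, $0<\mu<1$ with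 $\lambda_n\le K\mu^n$ for all $n$, where $\lambda_n$ is the maximal length of the intervals in $\eta_n$ (defined below). $f$ is geometrically finite if it is $C^{1+\alpha}$-geometrically finite for some $0<\alpha\le1$. Its first partition $\eta_1=\{I_0,\dots,I_m\}$ is always the set of closures of the intervals of $M\setminus\bigcup_{n\ge0}f^{\circ n}(CP)$; this is a Markov partition (the $I_i$ are closed intervals with pairwise disjoint interiors covering $M$, $f|I_i$ is injective and continuous, and each $f(I_i)$ is a union of intervals of $\eta_1$). Symbolic notation. Let $g_i$ be the inverse of $f|I_i$ and let $r_i$ be the symbol $+i$ if $g_i$ preserves orientation and $-i$ if $g_i$ reverses it. A sequence $w=r_{i_0}\cdots r_{i_n}$ is suitable (of length $n+1$) if $I_{i_k}\subset f(I_{i_{k-1}})$ for $k=1,\dots,n$. Put $g_w=g_{i_0}\circ\cdots\circ g_{i_n}$ and $I_w=g_w(f(I_{i_n}))$. $\eta_n$ is the set of intervals $I_w$ over suitable sequences $w$ of length $n$. $sign(I_w)=1$ if the number of minus signs in $w$ is even, $-1$ if it is odd. The dual space $\Sigma_f^{*}$ is the set of left-infinite sequences $a^{*}=\cdots r_{i_2}r_{i_1}r_{i_0}$ all of whose finite blocks $r_{i_n}\cdots r_{i_0}$ are suitable, with the topology generated by the cylinders obtained by fixing finitely many rightmost symbols. For $a^{*}\in\Sigma_f^{*}$ and $n\ge1$ let $w_n=r_{i_n}\cdots r_{i_1}r_{i_0}=v_{n-1}r_{i_0}$ with $v_{n-1}=r_{i_n}\cdots r_{i_1}$; the signed scale at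 $w_n$ is $$s(w_n)=\frac{sign(I_{w_n})\,|I_{w_n}|}{sign(I_{v_{n-1}})\,|I_{v_{n-1}}|}.$$ The signed scaling function is $s_f(a^{*})=\lim_{n\to\infty}s(w_n)$ (for geometrically finite $f$ this limit exists at every $a^{*}\in\Sigma_f^{*}$), and the scaling function is its absolute value $|s_f|$. *)

theory Defs
  imports "HOL-Analysis.Analysis"
begin

text \<open>
  An oriented connected compact one-dimensional Riemannian manifold (an interval or a circle) is
  given by a unit-speed, orientation-preserving parametrization \<open>par\<close>: of an interval by
  \<open>{0..len}\<close>, of a circle by the real line, two parameters giving the same point iff they differ by
  an integer multiple of \<open>len\<close>.  The ambient type is an arbitrary Hausdorff space; as \<open>par\<close> is
  continuous, the subspace topology of \<open>pts M\<close> is the topology of the manifold, so that library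
  notions such as \<open>components\<close> and \<open>closure\<close> apply to its subsets.
\<close>

record 'a manifold1 =
  par :: "real \<Rightarrow> 'a"
  len :: real
  is_circle :: bool

definition dom1 :: "'a manifold1 \<Rightarrow> real set" where
  "dom1 M = (if is_circle M then UNIV else {0..len M})"

definition pts :: "'a manifold1 \<Rightarrow> 'a set" where
  "pts M = par M ` dom1 M"

definition bdry :: "'a manifold1 \<Rightarrow> 'a set" where
  "bdry M = (if is_circle M then {} else {par M 0, par M (len M)})"

definition riemannian_manifold1 :: "'a::t2_space manifold1 \<Rightarrow> bool" where
  "riemannian_manifold1 M \<longleftrightarrow>
     len M > 0 \<and>
     continuous_on (dom1 M) (par M) \<and>
     (\<forall>s\<in>dom1 M. \<forall>t\<in>dom1 M.
        par M s = par M t \<longleftrightarrow>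
          (if is_circle M then (\<exists>k::int. t = s + of_int k * len M) else s = t))"

text \<open>Also for a circle: one period of parameters is used, up to a null set.\<close>

definition arc_length :: "'a manifold1 \<Rightarrow> 'a set \<Rightarrow> real" where
  "arc_length M A = measure lborel {t \<in> {0..len M}. par M t \<in> A}"

text \<open>
  \<open>F\<close> expresses \<open>f\<close> in arc-length parameters.  On a circle it is only determined up to multiples of
  the length, pointwise; differentiability at \<open>t\<close> makes it a continuous local lift near \<open>t\<close>.  At an
  endpoint of an interval the derivative is the one-sided one.
\<close>

definition has_deriv1 :: "'a manifold1 \<Rightarrow> ('a \<Rightarrow> 'a) \<Rightarrow> real \<Rightarrow> 'a \<Rightarrow> bool" where
  "has_deriv1 M f D x \<longleftrightarrow>
     (\<exists>t F. t \<in> dom1 M \<and> par M t = x \<and>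
        (\<forall>s\<in>dom1 M. F s \<in> dom1 M \<and> f (par M s) = par M (F s)) \<and>
        (F has_real_derivative D) (at t within dom1 M))"

definition deriv1 :: "'a manifold1 \<Rightarrow> ('a \<Rightarrow> 'a) \<Rightarrow> 'a \<Rightarrow> real" where
  "deriv1 M f x = (THE D. has_deriv1 M f D x)"

definition C1_self_map :: "'a::t2_space manifold1 \<Rightarrow> ('a \<Rightarrow> 'a) \<Rightarrow> bool" where
  "C1_self_map M f \<longleftrightarrow>
     f ` pts M \<subseteq> pts M \<and>
     (\<forall>x\<in>pts M. \<exists>D. has_deriv1 M f D x) \<and>
     continuous_on (pts M) (deriv1 M f)"

definition critical_points :: "'a manifold1 \<Rightarrow> ('a \<Rightarrow> 'a) \<Rightarrow> 'a set" where
  "critical_points M f = {c \<in> pts M. deriv1 M f c = 0}"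

text \<open>The quotient \<open>f'(x) / |x - c|\<^sup>\<gamma>\<^sup>-\<^sup>1\<close> for \<open>c = par M t\<close>, \<open>x = par M s\<close> and \<open>s\<close> near \<open>t\<close>.\<close>

definition power_quotient ::
    "'a manifold1 \<Rightarrow> ('a \<Rightarrow> 'a) \<Rightarrow> real \<Rightarrow> real \<Rightarrow> real \<Rightarrow> real" where
  "power_quotient M f \<gamma> t s = deriv1 M f (par M s) / \<bar>s - t\<bar> powr (\<gamma> - 1)"

definition power_law_critical ::
    "'a manifold1 \<Rightarrow> ('a \<Rightarrow> 'a) \<Rightarrow> real \<Rightarrow> 'a \<Rightarrow> bool" where
  "power_law_critical M f \<gamma> c \<longleftrightarrow>
     c \<in> critical_points M f \<and> \<gamma> \<ge> 1 \<and>
     (\<exists>t\<in>dom1 M. par M t = c \<and>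
        (\<exists>A. A \<noteq> 0 \<and> (power_quotient M f \<gamma> t \<longlongrightarrow> A) (at t within {s \<in> dom1 M. s > t})) \<and>
        (\<exists>B. B \<noteq> 0 \<and> (power_quotient M f \<gamma> t \<longlongrightarrow> B) (at t within {s \<in> dom1 M. s < t})))"

definition holder_on :: "real \<Rightarrow> (real \<Rightarrow> real) \<Rightarrow> real set \<Rightarrow> bool" where
  "holder_on \<alpha> h T \<longleftrightarrow> (\<exists>K. \<forall>x\<in>T. \<forall>y\<in>T. \<bar>h x - h y\<bar> \<le> K * \<bar>x - y\<bar> powr \<alpha>)"

definition eta0 :: "'a::t2_space manifold1 \<Rightarrow> ('a \<Rightarrow> 'a) \<Rightarrow> 'a set set" where
  "eta0 M f = components (pts M - critical_points M f)"

text \<open>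
  Includes the standing assumptions: power law critical points only, the boundary is mapped into
  itself, and the one-sided derivatives at boundary points are nonzero.
\<close>

definition C1_alpha :: "'a::t2_space manifold1 \<Rightarrow> real \<Rightarrow> ('a \<Rightarrow> 'a) \<Rightarrow> bool" where
  "C1_alpha M \<alpha> f \<longleftrightarrow>
     C1_self_map M f \<and>
     f ` bdry M \<subseteq> bdry M \<and> (\<forall>x\<in>bdry M. deriv1 M f x \<noteq> 0) \<and>
     (\<forall>C\<in>eta0 M f. \<forall>T. T \<subseteq> dom1 M \<and> is_interval T \<and> par M ` T = C \<longrightarrow>
        holder_on \<alpha> (\<lambda>s. deriv1 M f (par M s)) T) \<and>
     (\<forall>c\<in>critical_points M f. \<exists>\<gamma>. power_law_critical M f \<gamma> c \<and>
        (\<exists>t\<in>dom1 M. par M t = c \<and>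
           (\<exists>\<epsilon>>0. holder_on \<alpha> (power_quotient M f \<gamma> t) {s \<in> dom1 M. t - \<epsilon> < s \<and> s < t} \<and>
                  holder_on \<alpha> (power_quotient M f \<gamma> t) {s \<in> dom1 M. t < s \<and> s < t + \<epsilon>})))"

definition post_critical :: "'a manifold1 \<Rightarrow> ('a \<Rightarrow> 'a) \<Rightarrow> 'a set" where
  "post_critical M f = (\<Union>i. (f ^^ i) ` critical_points M f)"

definition open_pieces :: "'a::t2_space manifold1 \<Rightarrow> ('a \<Rightarrow> 'a) \<Rightarrow> 'a set set" where
  "open_pieces M f = components (pts M - post_critical M f)"

definition first_partition :: "'a::t2_space manifold1 \<Rightarrow> ('a \<Rightarrow> 'a) \<Rightarrow> 'a set set" where
  "first_partition M f = closure ` open_pieces M f"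

text \<open>
  The intervals of the first partition are their own indices: \<open>Plus I\<^sub>i\<close>, \<open>Minus I\<^sub>i\<close> stand for
  \<open>+i\<close>, \<open>-i\<close>.
\<close>

datatype 'a signed = is_Plus: Plus (ivl: 'a) | is_Minus: Minus (ivl: 'a)

definition branch_inverse :: "('a \<Rightarrow> 'a) \<Rightarrow> 'a set \<Rightarrow> 'a \<Rightarrow> 'a" where
  "branch_inverse f I = inv_into I f"

definition preserves_orientation ::
    "'a manifold1 \<Rightarrow> ('a \<Rightarrow> 'a) \<Rightarrow> 'a set \<Rightarrow> bool" where
  "preserves_orientation M h A \<longleftrightarrow>
     (\<exists>T H. T \<subseteq> dom1 M \<and> is_interval T \<and> par M ` T = A \<and>
        continuous_on T H \<and> strict_mono_on T H \<and>
        (\<forall>t\<in>T. H t \<in> dom1 M \<and> h (par M t) = par M (H t)))"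

definition symbol_of :: "'a manifold1 \<Rightarrow> ('a \<Rightarrow> 'a) \<Rightarrow> 'a set \<Rightarrow> 'a set signed" where
  "symbol_of M f I =
     (if preserves_orientation M (branch_inverse f I) (f ` I) then Plus I else Minus I)"

definition symbols :: "'a::t2_space manifold1 \<Rightarrow> ('a \<Rightarrow> 'a) \<Rightarrow> 'a set signed set" where
  "symbols M f = symbol_of M f ` first_partition M f"

definition suitable ::
    "'a::t2_space manifold1 \<Rightarrow> ('a \<Rightarrow> 'a) \<Rightarrow> 'a set signed list \<Rightarrow> bool" where
  "suitable M f w \<longleftrightarrow>
     w \<noteq> [] \<and> set w \<subseteq> symbols M f \<and>
     (\<forall>k. Suc k < length w \<longrightarrow> ivl (w ! Suc k) \<subseteq> f ` ivl (w ! k))"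

definition word_inverse :: "('a \<Rightarrow> 'a) \<Rightarrow> 'a set signed list \<Rightarrow> 'a \<Rightarrow> 'a" where
  "word_inverse f w = foldr (\<lambda>r h. branch_inverse f (ivl r) \<circ> h) w id"

definition word_interval :: "('a \<Rightarrow> 'a) \<Rightarrow> 'a set signed list \<Rightarrow> 'a set" where
  "word_interval f w = word_inverse f w ` (f ` ivl (last w))"

definition word_sign :: "'a set signed list \<Rightarrow> real" where
  "word_sign w = (if even (length (filter is_Minus w)) then 1 else -1)"

fun eta :: "'a::t2_space manifold1 \<Rightarrow> ('a \<Rightarrow> 'a) \<Rightarrow> nat \<Rightarrow> 'a set set" where
  "eta M f 0 = eta0 M f"
| "eta M f (Suc n) = word_interval f ` {w. suitable M f w \<and> length w = Suc n}"

definition max_length :: "'a::t2_space manifold1 \<Rightarrow> ('a \<Rightarrow> 'a) \<Rightarrow> nat \<Rightarrow> real" where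
  "max_length M f n = Max (arc_length M ` eta M f n)"

text \<open>
  The first partition has to be a Markov partition for the inverse branches to exist.  Everything
  in this requirement follows from the other conditions, except that on a circle an interval might
  be wrapped around more than once; so injectivity is part of the definition.  It is
  required on the open intervals only, which allows an interval to be mapped once around the
  circle with both endpoints going to the same point \<open>p\<close>.  Then \<open>branch_inverse\<close> selects one of the
  two endpoints as the preimage of \<open>p\<close>, which affects \<open>word_interval\<close> only in finitely many points
  and lengths not at all.
\<close>

definition C1_alpha_geometrically_finite ::
    "'a::t2_space manifold1 \<Rightarrow> real \<Rightarrow> ('a \<Rightarrow> 'a) \<Rightarrow> bool" where
  "C1_alpha_geometrically_finite M \<alpha> f \<longleftrightarrow>
     C1_alpha M \<alpha> f \<and>
     post_critical M f \<noteq> {} \<and> finite (post_critical M f) \<and>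
     (\<forall>c\<in>critical_points M f. \<forall>n\<ge>1. (f ^^ n) c \<noteq> c) \<and>
     (\<forall>C\<in>open_pieces M f. inj_on f C) \<and>
     (\<exists>K>0. \<exists>\<mu>. 0 < \<mu> \<and> \<mu> < 1 \<and> (\<forall>n. max_length M f n \<le> K * \<mu> ^ n))"

definition geometrically_finite :: "'a::t2_space manifold1 \<Rightarrow> ('a \<Rightarrow> 'a) \<Rightarrow> bool" where
  "geometrically_finite M f \<longleftrightarrow>
     (\<exists>\<alpha>. 0 < \<alpha> \<and> \<alpha> \<le> 1 \<and> C1_alpha_geometrically_finite M \<alpha> f)"

text \<open>
  A left-infinite sequence is a function on \<open>nat\<close>, position \<open>k\<close> counted from the right end; blocks
  are lists in left-to-right order, so \<open>dual_block a m n\<close> is \<open>r\<^bsub>i_n\<^esub> \<dots> r\<^bsub>i_m\<^esub>\<close>.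
\<close>

definition dual_block :: "(nat \<Rightarrow> 's) \<Rightarrow> nat \<Rightarrow> nat \<Rightarrow> 's list" where
  "dual_block a m n = rev (map a [m..<Suc n])"

definition dual_space ::
    "'a::t2_space manifold1 \<Rightarrow> ('a \<Rightarrow> 'a) \<Rightarrow> (nat \<Rightarrow> 'a set signed) set" where
  "dual_space M f = {a. \<forall>n. suitable M f (dual_block a 0 n)}"

definition dual_topology ::
    "'a::t2_space manifold1 \<Rightarrow> ('a \<Rightarrow> 'a) \<Rightarrow> (nat \<Rightarrow> 'a set signed) topology" where
  "dual_topology M f =
     topology_generated_by
       {{b \<in> dual_space M f. \<forall>k<n. b k = a k} | a n. a \<in> dual_space M f}"

definition signed_scale ::
    "'a manifold1 \<Rightarrow> ('a \<Rightarrow> 'a) \<Rightarrow> (nat \<Rightarrow> 'a set signed) \<Rightarrow> nat \<Rightarrow> real" where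
  "signed_scale M f a n =
     (let w = dual_block a 0 n; v = dual_block a 1 n in
        (word_sign w * arc_length M (word_interval f w)) /
        (word_sign v * arc_length M (word_interval f v)))"

definition signed_scaling_function ::
    "'a manifold1 \<Rightarrow> ('a \<Rightarrow> 'a) \<Rightarrow> (nat \<Rightarrow> 'a set signed) \<Rightarrow> real" where
  "signed_scaling_function M f a = lim (signed_scale M f a)"

definition scaling_function ::
    "'a manifold1 \<Rightarrow> ('a \<Rightarrow> 'a) \<Rightarrow> (nat \<Rightarrow> 'a set signed) \<Rightarrow> real" where
  "scaling_function M f a = \<bar>signed_scaling_function M f a\<bar>"

end

theory Submission
  imports Defs
begin

text \<open>
  A critical point multiplies the logarithms of scales by its exponent, and this destroys
  continuity.

  Consider a critical point \<open>c\<close> that has an infinite past, and a two-sided itinerary through \<open>c\<close>.  The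
  forward orbit of \<open>c\<close> runs through endpoints of the first partition and is eventually periodic, as
  there are only finitely many of them.  So the intervals of the words that start at the time of \<open>c\<close>
  are one-sided neighbourhoods of \<open>c\<close>, and the earlier ones are neighbourhoods of points of its
  backward orbit (\<open>ell_step\<close>).  The map is asymptotically linear at noncritical points and
  asymptotically a power with exponent greater than one at critical points
  (\<open>displacement_power_law\<close>).  Hence the logarithm of the scale at a long word that starts before \<open>c\<close>
  is, in the limit, that of the scale at the same word started after \<open>c\<close>, divided by some
  \<open>\<Gamma> > 1\<close> (\<open>log_ratio_steps\<close>).

  The left-infinite sequences obtained by cutting the itinerary at later and later times converge,
  along residue classes, to sequences that repeat the periodic future.  If the scaling function were
  continuous at those, then the logarithms of the scales before and after \<open>c\<close> would have to agree in
  the limit, that is, to tend to zero.  But scales that tend to one contradict the exponential decay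
  of the lengths (\<open>scaling_function_discontinuous\<close>).

  It remains to see that the limits exist and that the comparison is uniform up to the infinite past.
  The past can be chosen eventually periodic as well.  The intervals of a periodic itinerary shrink to
  a periodic orbit, which contains no critical point; near it the Hoelder condition gives geometrically
  small distortion (\<open>periodic_distortion\<close>, \<open>log_ratio_limit\<close>).

  A critical point with an infinite past exists because the eventual image of \<open>M\<close> contains a
  critical point (\<open>eventual_image_critical\<close>): otherwise the map would permute the intervals of the
  first partition inside the eventual image, and they would not shrink.

  All estimates are done in arc-length parameters, for a lift \<open>\<Phi>\<close> of the map (\<open>lift_exists\<close>).
\<close>

section \<open>Parametrized manifolds\<close>

locale manifold_1d =
  fixes M :: "'a::t2_space manifold1"
  assumes riemannian: "riemannian_manifold1 M"
begin

text \<open>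
  The translations of the parameter that do not change the point.  For an interval only the identity
  is left, so that intervals and circles can be treated together.
\<close>

definition deck :: "real set" where
  "deck = (if is_circle M then range (\<lambda>k::int. of_int k * len M) else {0})"

lemma len_pos: "len M > 0"
  using riemannian by (simp add: riemannian_manifold1_def)

lemma par_continuous: "continuous_on (dom1 M) (par M)"
  using riemannian by (simp add: riemannian_manifold1_def)

lemma par_eq_iff: "s \<in> dom1 M \<Longrightarrow> t \<in> dom1 M \<Longrightarrow> par M s = par M t \<longleftrightarrow> t - s \<in> deck"
  using riemannian by (auto simp: riemannian_manifold1_def deck_def algebra_simps)

lemma deck_zero [simp]: "0 \<in> deck"
  by (auto simp: deck_def image_iff intro: exI[of _ "0::int"])

lemma len_deck: "is_circle M \<Longrightarrow> len M \<in> deck"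
  by (auto simp: deck_def image_iff intro: exI[of _ "1::int"])

lemma deck_minus: "d \<in> deck \<Longrightarrow> - d \<in> deck"
  by (auto simp: deck_def image_iff) (metis minus_mult_left of_int_minus)

lemma deck_add: "d \<in> deck \<Longrightarrow> e \<in> deck \<Longrightarrow> d + e \<in> deck"
  by (auto simp: deck_def image_iff) (metis distrib_right of_int_add)

lemma deck_diff: "d \<in> deck \<Longrightarrow> e \<in> deck \<Longrightarrow> d - e \<in> deck"
  using deck_add[of d "- e"] deck_minus[of e] by simp

lemma deck_small: "d \<in> deck \<Longrightarrow> \<bar>d\<bar> < len M \<Longrightarrow> d = 0"
proof (cases "is_circle M")
  case True
  assume "d \<in> deck" and small: "\<bar>d\<bar> < len M"
  then obtain k :: int where k: "d = of_int k * len M"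
    using True by (auto simp: deck_def)
  then have "\<bar>of_int k :: real\<bar> * len M < 1 * len M"
    using small len_pos by (simp add: abs_mult)
  then have "\<bar>of_int k :: real\<bar> < 1"
    using len_pos mult_less_cancel_right_pos by blast
  then have "k = 0" by linarith
  then show "d = 0" using k by simp
qed (simp add: deck_def)

lemma dom1_shift: "s \<in> dom1 M \<Longrightarrow> d \<in> deck \<Longrightarrow> s + d \<in> dom1 M"
  by (auto simp: dom1_def deck_def split: if_splits)

lemma par_shift: "s \<in> dom1 M \<Longrightarrow> d \<in> deck \<Longrightarrow> par M (s + d) = par M s"
  using par_eq_iff[of s "s + d"] dom1_shift by auto

lemma dom1_convex: "convex (dom1 M)"
  by (auto simp: dom1_def)

lemma dom1_mem: "a \<in> dom1 M \<Longrightarrow> b \<in> dom1 M \<Longrightarrow> a \<le> x \<Longrightarrow> x \<le> b \<Longrightarrow> x \<in> dom1 M"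
  by (auto simp: dom1_def)

lemma dom1_Icc: "a \<in> dom1 M \<Longrightarrow> b \<in> dom1 M \<Longrightarrow> {a..b} \<subseteq> dom1 M"
  by (auto simp: dom1_def)

lemma fundamental_dom: "{0..len M} \<subseteq> dom1 M"
  by (auto simp: dom1_def)

lemma circle_reduce:
  assumes "is_circle M"
  shows "\<exists>d\<in>deck. 0 \<le> s + d \<and> s + d < len M"
proof
  let ?k = "\<lfloor>s / len M\<rfloor>"
  show "- (of_int ?k * len M) \<in> deck"
    using assms deck_minus by (auto simp: deck_def)
  have "of_int ?k * len M \<le> s"
    by (metis len_pos of_int_floor_le pos_le_divide_eq)
  moreover have "s < (of_int ?k + 1) * len M"
    by (metis len_pos floor_correct pos_divide_less_eq of_int_1 of_int_add)
  ultimately show "0 \<le> s + - (of_int ?k * len M) \<and> s + - (of_int ?k * len M) < len M"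
    by (simp add: algebra_simps)
qed

lemma reduce:
  assumes "s \<in> dom1 M"
  shows "\<exists>d\<in>deck. s + d \<in> {0..len M}"
proof (cases "is_circle M")
  case True
  then show ?thesis using circle_reduce[of s] by force
next
  case False
  then show ?thesis using assms by (intro bexI[of _ 0]) (auto simp: dom1_def)
qed

lemma par_in_pts: "s \<in> dom1 M \<Longrightarrow> par M s \<in> pts M"
  by (simp add: pts_def)

lemma pts_fundamental: "pts M = par M ` {0..len M}"
proof
  show "pts M \<subseteq> par M ` {0..len M}"
    using reduce par_shift unfolding pts_def by (smt (verit, best) image_iff subsetI)
  show "par M ` {0..len M} \<subseteq> pts M"
    using fundamental_dom by (auto simp: pts_def)
qed

lemma finite_deck_bounded: "finite (deck \<inter> {x..y})"
proof (cases "is_circle M")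
  case True
  have "deck \<inter> {x..y} \<subseteq> (\<lambda>k::int. of_int k * len M) ` {\<lfloor>x / len M\<rfloor>..\<lceil>y / len M\<rceil>}"
  proof
    fix d assume "d \<in> deck \<inter> {x..y}"
    then obtain k :: int where k: "d = of_int k * len M" and "x \<le> d" "d \<le> y"
      using True by (auto simp: deck_def)
    then have "x / len M \<le> of_int k" "of_int k \<le> y / len M"
      using len_pos by (auto simp: field_simps)
    then have "k \<in> {\<lfloor>x / len M\<rfloor>..\<lceil>y / len M\<rceil>}"
      by (simp add: floor_le_iff le_ceiling_iff)
    then show "d \<in> (\<lambda>k::int. of_int k * len M) ` {\<lfloor>x / len M\<rfloor>..\<lceil>y / len M\<rceil>}"
      using k by blast
  qed
  then show ?thesis using finite_subset by blast
qed (simp add: deck_def)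

lemma finite_vimage_bounded:
  assumes "finite P"
  shows "finite {t \<in> dom1 M. x \<le> t \<and> t \<le> y \<and> par M t \<in> P}"
proof -
  have fib: "finite {t \<in> dom1 M. x \<le> t \<and> t \<le> y \<and> par M t = p}" for p
  proof (cases "\<exists>s\<in>dom1 M. par M s = p")
    case True
    then obtain s where s: "s \<in> dom1 M" "par M s = p" by blast
    have "{t \<in> dom1 M. x \<le> t \<and> t \<le> y \<and> par M t = p} \<subseteq> (\<lambda>d. s + d) ` (deck \<inter> {x - s..y - s})"
    proof
      fix t assume "t \<in> {t \<in> dom1 M. x \<le> t \<and> t \<le> y \<and> par M t = p}"
      then have "t - s \<in> deck \<inter> {x - s..y - s}" using par_eq_iff[of s t] s by auto
      then show "t \<in> (\<lambda>d. s + d) ` (deck \<inter> {x - s..y - s})"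
        by (intro image_eqI[of _ _ "t - s"]) auto
    qed
    then show ?thesis using finite_deck_bounded finite_subset by blast
  next
    case False
    then have "{t \<in> dom1 M. x \<le> t \<and> t \<le> y \<and> par M t = p} = {}" by blast
    then show ?thesis by (metis finite.emptyI)
  qed
  have "{t \<in> dom1 M. x \<le> t \<and> t \<le> y \<and> par M t \<in> P} =
      (\<Union>p\<in>P. {t \<in> dom1 M. x \<le> t \<and> t \<le> y \<and> par M t = p})" by auto
  then show ?thesis using fib assms by auto
qed

lemma saturation_open:
  assumes "openin (top_of_set (dom1 M)) U"
  shows "openin (top_of_set (dom1 M)) {t \<in> dom1 M. par M t \<in> par M ` U}"
proof -
  have U: "U \<subseteq> dom1 M" using assms openin_imp_subset by blast
  obtain V where V: "open V" "U = dom1 M \<inter> V" using assms openin_open by metis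
  have "{t \<in> dom1 M. par M t \<in> par M ` U} = dom1 M \<inter> (\<Union>d\<in>deck. (\<lambda>x. d + x) ` V)"
  proof (intro equalityI subsetI)
    fix t assume "t \<in> {t \<in> dom1 M. par M t \<in> par M ` U}"
    then obtain u where u: "t \<in> dom1 M" "u \<in> U" "par M t = par M u" by auto
    then have "t - u \<in> deck" using U par_eq_iff[of u t] by auto
    moreover have "t = (t - u) + u" by simp
    ultimately show "t \<in> dom1 M \<inter> (\<Union>d\<in>deck. (\<lambda>x. d + x) ` V)" using u V by blast
  next
    fix t assume "t \<in> dom1 M \<inter> (\<Union>d\<in>deck. (\<lambda>x. d + x) ` V)"
    then obtain d u where du: "t \<in> dom1 M" "d \<in> deck" "u \<in> V" "t = d + u" by auto
    then have "u = t + (- d)" by simp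
    then have "u \<in> dom1 M" "par M u = par M t"
      using dom1_shift[of t "- d"] par_shift[of t "- d"] deck_minus du by auto
    moreover have "u \<in> U" using du V calculation by blast
    ultimately show "t \<in> {t \<in> dom1 M. par M t \<in> par M ` U}"
      using du(1) by (metis (mono_tags, lifting) image_eqI mem_Collect_eq)
  qed
  moreover have "open (\<Union>d\<in>deck. (\<lambda>x. d + x) ` V)"
    using V open_translation by blast
  ultimately show ?thesis by (simp add: openin_open_Int)
qed

text \<open>
  The parametrization is the quotient map by a group of translations, hence open: the complement of
  the image of an open set is the image of a compact part of the fundamental domain.
\<close>

lemma par_open_map:
  assumes "openin (top_of_set (dom1 M)) U"
  shows "openin (top_of_set (pts M)) (par M ` U)"
proof -
  let ?W = "{t \<in> dom1 M. par M t \<in> par M ` U}"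
  have U: "U \<subseteq> dom1 M" using assms openin_imp_subset by blast
  obtain V where V: "open V" "?W = dom1 M \<inter> V"
    using saturation_open[OF assms] openin_open by metis
  have "{0..len M} - ?W = {0..len M} - V" using V(2) fundamental_dom by blast
  then have "compact ({0..len M} - ?W)" using V(1) compact_diff by (metis compact_Icc)
  then have "compact (par M ` ({0..len M} - ?W))"
    by (intro compact_continuous_image continuous_on_subset[OF par_continuous])
       (use fundamental_dom in auto)
  then have "closed (par M ` ({0..len M} - ?W))" using compact_imp_closed by blast
  moreover have "par M ` U = pts M \<inter> - par M ` ({0..len M} - ?W)"
  proof -
    have "par M ` U \<subseteq> pts M" using U by (auto simp: pts_def)
    moreover have "par M ` U \<inter> par M ` ({0..len M} - ?W) = {}"
      using fundamental_dom by auto (metis (no_types, opaque_lifting) atLeastAtMost_iff imageI subsetD)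
    moreover have "pts M \<subseteq> par M ` U \<union> par M ` ({0..len M} - ?W)"
      unfolding pts_fundamental by blast
    ultimately show ?thesis by blast
  qed
  ultimately show ?thesis using openin_open_Int[of "- par M ` ({0..len M} - ?W)" "pts M"]
    by (simp add: open_Compl)
qed

lemma par_open_map_subset:
  assumes "openin (top_of_set (dom1 M)) T" "openin (top_of_set T) U"
  shows "openin (top_of_set (par M ` T)) (par M ` U)"
proof -
  have "openin (top_of_set (dom1 M)) U" using assms openin_trans by blast
  then have "openin (top_of_set (pts M)) (par M ` U)" by (rule par_open_map)
  moreover have "par M ` U \<subseteq> par M ` T" using assms(2) openin_imp_subset by blast
  moreover have "par M ` T \<subseteq> pts M"
    using openin_imp_subset[OF assms(1)] by (auto simp: pts_def)
  ultimately show ?thesis by (meson openin_subset_trans)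
qed

lemma pts_connected: "connected (pts M)"
  unfolding pts_def
  by (intro connected_continuous_image par_continuous convex_connected dom1_convex)

definition gaps :: "'a set \<Rightarrow> real set" where
  "gaps P = {t \<in> dom1 M. par M t \<notin> P}"

lemma gaps_shift: "t \<in> gaps P \<Longrightarrow> d \<in> deck \<Longrightarrow> t + d \<in> gaps P"
  by (simp add: gaps_def dom1_shift par_shift)

lemma gaps_open:
  assumes "finite P"
  shows "openin (top_of_set (dom1 M)) (gaps P)"
proof -
  have "closedin (top_of_set (dom1 M)) (dom1 M \<inter> par M -` P)"
    using assms finite_imp_closed par_continuous continuous_closedin_preimage by blast
  moreover have "gaps P = dom1 M - (dom1 M \<inter> par M -` P)" by (auto simp: gaps_def)
  ultimately show ?thesis by (metis openin_diff openin_subtopology_self)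
qed

lemma gap_component_open:
  assumes "finite P" "T \<in> components (gaps P)"
  shows "openin (top_of_set (dom1 M)) T"
proof -
  have "locally connected (dom1 M)" using dom1_convex convex_imp_locally_connected by blast
  then have "locally connected (gaps P)"
    using gaps_open[OF assms(1)] locally_open_subset by blast
  then have "openin (top_of_set (gaps P)) T"
    using assms(2) openin_components_locally_connected by blast
  then show ?thesis using gaps_open[OF assms(1)] openin_trans by blast
qed

lemma gap_component_shift:
  assumes "T \<in> components (gaps P)" "T' \<in> components (gaps P)" "s \<in> T" "s + d \<in> T'" "d \<in> deck"
  shows "(\<lambda>x. x + d) ` T = T'"
proof -
  have sub: "(\<lambda>x. x + d) ` S \<subseteq> S'"
    if "S \<in> components (gaps P)" "S' \<in> components (gaps P)" "s \<in> S" "s + d \<in> S'" "d \<in> deck" for S S' s d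
  proof (rule components_maximal[OF that(2)])
    have "connected S" using that in_components_connected by blast
    then show "connected ((\<lambda>x. x + d) ` S)"
      by (intro connected_continuous_image continuous_intros)
    show "(\<lambda>x. x + d) ` S \<subseteq> gaps P"
      using that in_components_subset gaps_shift by blast
    show "S' \<inter> (\<lambda>x. x + d) ` S \<noteq> {}" using that by blast
  qed
  have "(\<lambda>x. x + d) ` T \<subseteq> T'" using sub assms by blast
  moreover have "(\<lambda>x. x + - d) ` T' \<subseteq> T"
    by (rule sub[of _ _ "s + d"]) (use assms deck_minus in auto)
  then have "T' \<subseteq> (\<lambda>x. x + d) ` T" by (force simp: image_iff)
  ultimately show ?thesis by blast
qed

text \<open>
  Two such images are equal or disjoint, because a translation that maps one point of a component
  into another component maps the whole component onto it.  As the images are open, each of them is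
  also closed in the complement of \<open>P\<close>.
\<close>

lemma gap_image_component:
  assumes P: "finite P" and T: "T \<in> components (gaps P)"
  shows "par M ` T \<in> components (pts M - P)"
proof -
  let ?C = "par M ` T"
  have Tsub: "T \<subseteq> gaps P" "T \<noteq> {}" "connected T"
    using T in_components_subset in_components_nonempty in_components_connected by blast+
  then have Csub: "?C \<subseteq> pts M - P" by (auto simp: gaps_def pts_def)
  have Ccon: "connected ?C"
    using Tsub by (intro connected_continuous_image continuous_on_subset[OF par_continuous])
      (auto simp: gaps_def)
  have opens: "openin (top_of_set (pts M - P)) (par M ` S)" if "S \<in> components (gaps P)" for S
  proof -
    have "openin (top_of_set (pts M)) (par M ` S)"
      using gap_component_open[OF P that] par_open_map by blast
    moreover have "par M ` S \<subseteq> pts M - P"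
      using that in_components_subset[OF that] by (auto simp: gaps_def pts_def)
    ultimately show ?thesis by (meson Diff_subset openin_subset_trans)
  qed
  let ?R = "\<Union> {par M ` S | S. S \<in> components (gaps P) \<and> par M ` S \<inter> ?C = {}}"
  have Rop: "openin (top_of_set (pts M - P)) ?R"
    using opens by (intro openin_Union) auto
  have cover: "pts M - P \<subseteq> ?C \<union> ?R"
  proof
    fix x assume "x \<in> pts M - P"
    then obtain t where t: "t \<in> gaps P" "x = par M t" by (auto simp: pts_def gaps_def)
    then obtain S where S: "S \<in> components (gaps P)" "t \<in> S" by (metis Union_components UnionE)
    show "x \<in> ?C \<union> ?R"
    proof (cases "par M ` S \<inter> ?C = {}")
      case True
      then show ?thesis using S t by blast
    next
      case False
      then obtain s u where su: "s \<in> S" "u \<in> T" "par M s = par M u" by auto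
      have "s \<in> dom1 M" "u \<in> dom1 M"
        using su S(1) Tsub(1) in_components_subset[OF S(1)] by (auto simp: gaps_def)
      then have d: "s - u \<in> deck" using su(3) par_eq_iff[of u s] by auto
      then have "(\<lambda>x. x + (s - u)) ` T = S"
        using gap_component_shift[OF T S(1) su(2), of "s - u"] su(1) by simp
      then obtain v where "v \<in> T" "t = v + (s - u)" using S(2) by blast
      then have "x = par M v" using t par_shift[of v "s - u"] d Tsub(1) by (auto simp: gaps_def)
      then show ?thesis using \<open>v \<in> T\<close> by blast
    qed
  qed
  show ?thesis
    unfolding in_components_maximal
  proof (intro conjI allI impI)
    show "?C \<noteq> {}" "?C \<subseteq> pts M - P" "connected ?C" using Tsub Csub Ccon by auto
    fix D assume D: "D \<noteq> {} \<and> ?C \<subseteq> D \<and> D \<subseteq> pts M - P \<and> connected D"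
    show "D = ?C"
    proof (rule ccontr)
      assume ne: "D \<noteq> ?C"
      obtain U where U: "open U" "?C = (pts M - P) \<inter> U" using opens[OF T] unfolding openin_open by blast
      obtain V where V: "open V" "?R = (pts M - P) \<inter> V" using Rop unfolding openin_open by blast
      have disj: "?C \<inter> ?R = {}" by blast
      have "D \<subseteq> U \<union> V" "U \<inter> V \<inter> D = {}" using cover disj D U(2) V(2) by auto
      moreover have "U \<inter> D \<noteq> {}" using D Tsub(2) U(2) by auto
      moreover have "V \<inter> D \<noteq> {}"
      proof -
        have "\<not> D \<subseteq> ?C" using ne D by auto
        then obtain y where y: "y \<in> D" "y \<notin> ?C" by auto
        then have "y \<in> pts M - P" using D by blast
        then have "y \<in> ?R" using subsetD[OF cover] y(2) by blast
        then show ?thesis using V(2) y by auto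
      qed
      moreover have "connected D" using D by simp
      ultimately show False using connectedD[of D U V] U(1) V(1) by blast
    qed
  qed
qed

lemma components_pts:
  assumes P: "finite P"
  shows "components (pts M - P) = (\<lambda>T. par M ` T) ` components (gaps P)"
proof (intro equalityI subsetI)
  fix C assume C: "C \<in> components (pts M - P)"
  then obtain x where x: "x \<in> C" "x \<in> pts M - P"
    using in_components_nonempty in_components_subset by blast
  then obtain t where t: "t \<in> gaps P" "x = par M t" by (auto simp: pts_def gaps_def)
  then obtain S where S: "S \<in> components (gaps P)" "t \<in> S" by (metis Union_components UnionE)
  have "par M ` S = C"
    using components_eq[OF gap_image_component[OF P S(1)] C] x t S by blast
  then show "C \<in> (\<lambda>T. par M ` T) ` components (gaps P)" using S by blast
qed (use gap_image_component[OF P] in blast)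

end

context manifold_1d
begin

section \<open>Lifting a map to the parameters\<close>

definition lifts :: "('a \<Rightarrow> 'a) \<Rightarrow> (real \<Rightarrow> real) \<Rightarrow> bool" where
  "lifts f g \<longleftrightarrow> (\<forall>s\<in>dom1 M. g s \<in> dom1 M \<and> f (par M s) = par M (g s))"

lemma deck_phase:
  assumes "y - x \<in> deck"
  shows "\<exists>k::int. 2 * pi * y / len M = 2 * pi * x / len M + 2 * pi * of_int k"
proof (cases "is_circle M")
  case True
  then obtain k :: int where "y - x = of_int k * len M" using assms by (auto simp: deck_def)
  then have "y = x + of_int k * len M" by simp
  then have "2 * pi * y / len M = 2 * pi * x / len M + 2 * pi * of_int k"
    using len_pos by (simp add: field_simps)
  then show ?thesis by blast
next
  case False
  then show ?thesis using assms by (intro exI[of _ 0]) (simp add: deck_def)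
qed

text \<open>
  Different lifts of a map differ by multiples of the length that may vary from point to point, so
  that only the phase on the unit circle is well defined.  Its cosine is the tool for transferring
  differentiability from one lift to another.
\<close>

lemma cos_phase:
  assumes "y - x \<in> deck"
  shows "cos (2 * pi * y / len M - a) = cos (2 * pi * x / len M - a)"
proof -
  obtain k :: int where k: "2 * pi * y / len M = 2 * pi * x / len M + 2 * pi * of_int k"
    using deck_phase[OF assms] by blast
  have "cos (2 * pi * y / len M - a) = cos ((2 * pi * x / len M - a) + 2 * pi * of_int k)"
    unfolding k by (simp add: algebra_simps)
  then show ?thesis by (simp add: cos_add sin_int_2pin cos_int_2pin del: mult.assoc)
qed

lemma lifts_deck:
  assumes "lifts f g" "lifts f h" "s \<in> dom1 M"
  shows "h s - g s \<in> deck"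
  using assms par_eq_iff[of "g s" "h s"] by (auto simp: lifts_def)

lemma dom1_nontrivial: "t \<in> dom1 M \<Longrightarrow> at t within dom1 M \<noteq> bot"
proof -
  assume "t \<in> dom1 M"
  moreover have "dom1 M \<noteq> {x}" for x
  proof
    assume "dom1 M = {x}"
    moreover have "0 \<in> dom1 M" "len M \<in> dom1 M" using len_pos by (auto simp: dom1_def)
    ultimately show False using len_pos by auto
  qed
  ultimately have "t islimpt dom1 M"
    using connected_imp_perfect[OF convex_connected[OF dom1_convex]] by blast
  then show ?thesis using trivial_limit_within by blast
qed

lemma real_derivative_unique_dom1:
  assumes "(h has_real_derivative a) (at t within dom1 M)" "(h has_real_derivative b) (at t within dom1 M)"
    "t \<in> dom1 M"
  shows "a = b"
  using vector_derivative_unique_within[OF dom1_nontrivial[OF assms(3)]] assms(1,2)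
  unfolding has_real_derivative_iff_has_vector_derivative by blast

text \<open>
  Two lifts give the same function after composition with the shifted cosine of the phase.
  Differentiating it at a suitable shift isolates the derivatives of the lifts.
\<close>

lemma lift_derivative_unique:
  assumes F: "lifts f F" "(F has_real_derivative a) (at t within dom1 M)"
    and G: "lifts f G" "(G has_real_derivative b) (at t within dom1 M)" and t: "t \<in> dom1 M"
  shows "a = b"
proof -
  define c where "c = 2 * pi / len M"
  have c: "c \<noteq> 0" using len_pos by (simp add: c_def)
  have eq: "cos (c * F s - x) = cos (c * G s - x)" if "s \<in> dom1 M" for s x
    using cos_phase[OF lifts_deck[OF G(1) F(1) that], of x] by (simp add: c_def)
  have *: "- sin (c * F t - x) * (c * a) = - sin (c * G t - x) * (c * b)" for x
  proof (rule real_derivative_unique_dom1[OF _ _ t])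
    show "((\<lambda>s. cos (c * F s - x)) has_real_derivative - sin (c * F t - x) * (c * a)) (at t within dom1 M)"
      by (auto intro!: derivative_eq_intros F)
    have "((\<lambda>s. cos (c * G s - x)) has_real_derivative - sin (c * G t - x) * (c * b)) (at t within dom1 M)"
      by (auto intro!: derivative_eq_intros G)
    then show "((\<lambda>s. cos (c * F s - x)) has_real_derivative - sin (c * G t - x) * (c * b)) (at t within dom1 M)"
      using eq t unfolding has_field_derivative_def
      by (elim has_derivative_transform[rotated -1]) auto
  qed
  \<comment> \<open>this offset makes the sine on the left-hand side equal to \<open>-1\<close>\<close>
  have 1: "c * a = - sin (c * G t - (c * F t + pi / 2)) * (c * b)"
    using *[of "c * F t + pi / 2"] by simp
  have "- sin (c * G t - (c * F t + pi / 2)) = cos (c * G t - c * F t)"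
    by (simp add: sin_diff cos_diff sin_add cos_add algebra_simps)
  also have "\<dots> = cos (c * F t - c * F t)" using eq[OF t, of "c * F t"] by simp
  finally show ?thesis using 1 c by simp
qed

lemma lift_shift:
  assumes "has_deriv1 M f a (par M t)" "t \<in> dom1 M"
  shows "\<exists>F. lifts f F \<and> (F has_real_derivative a) (at t within dom1 M)"
proof -
  obtain u F where u: "u \<in> dom1 M" "par M u = par M t" "lifts f F"
    "(F has_real_derivative a) (at u within dom1 M)"
    using assms(1) by (auto simp: has_deriv1_def lifts_def)
  define d where "d = u - t"
  have d: "d \<in> deck" using par_eq_iff[of t u] u assms by (simp add: d_def)
  have "(\<lambda>x. x + d) ` dom1 M = dom1 M"
  proof (intro equalityI subsetI)
    fix x assume "x \<in> dom1 M"
    then show "x \<in> (\<lambda>x. x + d) ` dom1 M"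
      using dom1_shift[of x "- d"] deck_minus[OF d] by (intro image_eqI[of _ _ "x + - d"]) auto
  qed (use dom1_shift d in auto)
  then have "(F has_real_derivative a) (at (t + d) within (\<lambda>x. x + d) ` dom1 M)"
    using u by (simp add: d_def)
  moreover have "((\<lambda>x. x + d) has_real_derivative 1) (at t within dom1 M)"
    by (auto intro!: derivative_eq_intros)
  ultimately have "(F \<circ> (\<lambda>x. x + d) has_real_derivative a * 1) (at t within dom1 M)"
    by (rule DERIV_image_chain)
  then have "((\<lambda>x. F (x + d)) has_real_derivative a) (at t within dom1 M)"
    by (simp add: o_def)
  moreover have "lifts f (\<lambda>x. F (x + d))"
    using u(3) d dom1_shift par_shift unfolding lifts_def by metis
  ultimately show ?thesis by auto
qed

lemma deriv1_eq:
  assumes "has_deriv1 M f a x" "x \<in> pts M"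
  shows "deriv1 M f x = a"
proof -
  obtain t where t: "t \<in> dom1 M" "x = par M t" using assms(2) by (auto simp: pts_def)
  show ?thesis unfolding deriv1_def
  proof (rule the_equality)
    show "b = a" if b: "has_deriv1 M f b x" for b
    proof -
      obtain F where F: "lifts f F" "(F has_real_derivative a) (at t within dom1 M)"
        using lift_shift[of f a t] assms t by blast
      obtain G where G: "lifts f G" "(G has_real_derivative b) (at t within dom1 M)"
        using lift_shift[of f b t] b t by blast
      show ?thesis using lift_derivative_unique[OF G F t(1)] .
    qed
  qed fact
qed

lemma local_lift:
  assumes "C1_self_map M f" "t \<in> dom1 M"
  shows "\<exists>F. lifts f F \<and> (F has_real_derivative deriv1 M f (par M t)) (at t within dom1 M)"
proof -
  obtain a where a: "has_deriv1 M f a (par M t)"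
    using assms par_in_pts unfolding C1_self_map_def by blast
  then have "deriv1 M f (par M t) = a" using deriv1_eq par_in_pts assms(2) by blast
  then show ?thesis using lift_shift[OF a assms(2)] by simp
qed

lemma deriv1_par_continuous:
  assumes "C1_self_map M f"
  shows "continuous_on (dom1 M) (\<lambda>s. deriv1 M f (par M s))"
proof -
  have "continuous_on (par M ` dom1 M) (deriv1 M f)"
    using assms by (simp add: C1_self_map_def pts_def)
  then show ?thesis using continuous_on_compose[OF par_continuous] by (simp add: o_def)
qed

text \<open>
  On a circle the lift is a primitive of the derivative: it differs from the local lifts by a
  function whose derivative vanishes, so that the phase of the difference is constant.
\<close>

lemma lift_exists:
  assumes f: "C1_self_map M f"
  shows "\<exists>F. lifts f F \<and>
    (\<forall>t\<in>dom1 M. (F has_real_derivative deriv1 M f (par M t)) (at t within dom1 M))"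
proof (cases "is_circle M")
  case True
  then have dom: "dom1 M = UNIV" by (simp add: dom1_def)
  have "isCont (\<lambda>s. deriv1 M f (par M s)) x" for x
    using deriv1_par_continuous[OF f] dom by (simp add: continuous_on_eq_continuous_at)
  then obtain P where P: "(P has_real_derivative deriv1 M f (par M x)) (at x)" for x
    using einterval_antiderivative[of "-\<infinity>" "\<infinity>" "\<lambda>s. deriv1 M f (par M s)"]
    by (auto simp: has_real_derivative_iff_has_vector_derivative)
  obtain g where g: "lifts f g" using local_lift[OF f, of 0] dom by auto
  define c where "c = 2 * pi / len M"
  have c: "c \<noteq> 0" using len_pos by (simp add: c_def)
  define F where "F x = P x - P 0 + g 0" for x
  have F: "(F has_real_derivative deriv1 M f (par M x)) (at x)" for x
    unfolding F_def by (auto intro!: derivative_eq_intros P)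
  have "((\<lambda>s. cos (c * g s - c * F s)) has_real_derivative 0) (at t)" for t
  proof -
    obtain G where G: "lifts f G" "(G has_real_derivative deriv1 M f (par M t)) (at t)"
      using local_lift[OF f, of t] dom by auto
    have "cos (c * g s - c * F s) = cos (c * G s - c * F s)" for s
      using cos_phase[OF lifts_deck[OF G(1) g], of s "c * F s"] dom by (simp add: c_def)
    moreover have "((\<lambda>s. cos (c * G s - c * F s)) has_real_derivative 0) (at t)"
      by (rule derivative_eq_intros G F refl | simp)+
    ultimately show ?thesis by presburger
  qed
  then have "cos (c * g s - c * F s) = cos (c * g 0 - c * F 0)" for s
    using DERIV_isconst_all by blast
  then have "cos (c * g s - c * F s) = 1" for s by (simp add: F_def)
  then have "\<exists>k::int. c * g s - c * F s = of_int k * (2 * pi)" for s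
    by (metis cos_one_2pi_int mult.assoc)
  then have "F s - g s \<in> deck" for s
  proof -
    obtain k :: int where "c * g s - c * F s = of_int k * (2 * pi)"
      using \<open>\<exists>k::int. c * g s - c * F s = of_int k * (2 * pi)\<close> by blast
    then have "2 * pi * (g s - F s) = 2 * pi * (of_int k * len M)"
      using len_pos by (simp add: c_def field_simps)
    then have "F s - g s = of_int (- k) * len M" by simp
    then show ?thesis using True unfolding deck_def by (metis rangeI)
  qed
  then have "lifts f F"
    using g dom par_shift[of "g s" "F s - g s" for s] by (auto simp: lifts_def)
  then show ?thesis using F dom by auto
next
  case False
  obtain F where F: "lifts f F"
    using local_lift[OF f, of 0] fundamental_dom len_pos by force
  have "(F has_real_derivative deriv1 M f (par M t)) (at t within dom1 M)" if t: "t \<in> dom1 M" for t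
  proof -
    obtain G where G: "lifts f G" "(G has_real_derivative deriv1 M f (par M t)) (at t within dom1 M)"
      using local_lift[OF f t] by auto
    have "F s = G s" if "s \<in> dom1 M" for s
      using lifts_deck[OF F G(1) that] False by (simp add: deck_def)
    then show ?thesis using G(2) t unfolding has_field_derivative_def
      by (elim has_derivative_transform[rotated -1]) auto
  qed
  then show ?thesis using F by blast
qed

end

section \<open>Geometrically finite maps in arc-length parameters\<close>

lemma ln_lipschitz:
  fixes a b :: real
  assumes "\<delta> > 0" "a \<ge> \<delta>" "b \<ge> \<delta>"
  shows "\<bar>ln a - ln b\<bar> \<le> \<bar>a - b\<bar> / \<delta>"
proof -
  have *: "ln a - ln b \<le> \<bar>a - b\<bar> / \<delta>" if "a \<ge> \<delta>" "b \<ge> \<delta>" for a b :: real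
  proof -
    have "ln a - ln b \<le> (a - b) / b" using assms that by (intro ln_diff_le) auto
    also have "\<dots> \<le> \<bar>a - b\<bar> / b" using assms that by (intro divide_right_mono) auto
    also have "\<dots> \<le> \<bar>a - b\<bar> / \<delta>" using assms that by (intro divide_left_mono) auto
    finally show ?thesis .
  qed
  show ?thesis using *[of a b] *[of b a] assms by (simp add: abs_minus_commute abs_le_iff)
qed

text \<open>
  The constants \<open>\<alpha>\<close>, \<open>K\<close>, \<open>\<mu>\<close> are witnesses of geometric finiteness, and \<open>\<Phi>\<close> is a differentiable lift
  of the map to the parameters.
\<close>

locale geometrically_finite_map = manifold_1d M
  for M :: "'a::t2_space manifold1" +
  fixes f :: "'a \<Rightarrow> 'a" and \<alpha> K \<mu> :: real and \<Phi> :: "real \<Rightarrow> real"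
  assumes alpha_pos: "0 < \<alpha>"
    and C1_alpha: "C1_alpha M \<alpha> f"
    and post_nonempty: "post_critical M f \<noteq> {}"
    and post_finite: "finite (post_critical M f)"
    and no_cycle: "c \<in> critical_points M f \<Longrightarrow> n \<ge> 1 \<Longrightarrow> (f ^^ n) c \<noteq> c"
    and inj_pieces: "C \<in> open_pieces M f \<Longrightarrow> inj_on f C"
    and K_pos: "0 < K" and mu_pos: "0 < \<mu>" and mu_less_1: "\<mu> < 1"
    and decay: "max_length M f n \<le> K * \<mu> ^ n"
    and Phi_lifts: "lifts f \<Phi>"
    and Phi_deriv: "t \<in> dom1 M \<Longrightarrow> (\<Phi> has_real_derivative deriv1 M f (par M t)) (at t within dom1 M)"
begin

definition D :: "real \<Rightarrow> real" where
  "D s = deriv1 M f (par M s)"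

lemma C1: "C1_self_map M f"
  using C1_alpha by (simp add: C1_alpha_def)

lemma Phi_dom: "s \<in> dom1 M \<Longrightarrow> \<Phi> s \<in> dom1 M"
  and f_par: "s \<in> dom1 M \<Longrightarrow> f (par M s) = par M (\<Phi> s)"
  using Phi_lifts by (auto simp: lifts_def)

lemma D_continuous: "continuous_on (dom1 M) D"
  unfolding D_def by (rule deriv1_par_continuous[OF C1])

lemma D_shift: "s \<in> dom1 M \<Longrightarrow> d \<in> deck \<Longrightarrow> D (s + d) = D s"
  by (simp add: D_def par_shift)

lemma Phi_continuous: "continuous_on (dom1 M) \<Phi>"
  by (rule DERIV_continuous_on[OF Phi_deriv])

lemma critical_iff: "s \<in> dom1 M \<Longrightarrow> par M s \<in> critical_points M f \<longleftrightarrow> D s = 0"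
  by (simp add: critical_points_def D_def par_in_pts)

lemma critical_sub_post: "critical_points M f \<subseteq> post_critical M f"
  unfolding post_critical_def by (rule order_trans[OF _ UN_upper[of 0]]) auto

lemma critical_finite: "finite (critical_points M f)"
  using critical_sub_post post_finite finite_subset by blast

lemma critical_exists: "critical_points M f \<noteq> {}"
  using post_nonempty by (auto simp: post_critical_def)

lemma f_pts: "x \<in> pts M \<Longrightarrow> f x \<in> pts M"
  using C1 by (auto simp: C1_self_map_def)

lemma post_sub_pts: "post_critical M f \<subseteq> pts M"
proof -
  have "(f ^^ i) c \<in> pts M" if "c \<in> pts M" for c i
    using that by (induction i) (auto simp: f_pts)
  then show ?thesis by (auto simp: post_critical_def critical_points_def)
qed

lemma f_post:
  assumes "x \<in> post_critical M f"
  shows "f x \<in> post_critical M f"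
proof -
  obtain i c where "c \<in> critical_points M f" "x = (f ^^ i) c"
    using assms by (auto simp: post_critical_def)
  then have "f x \<in> (f ^^ Suc i) ` critical_points M f" by simp
  then show ?thesis unfolding post_critical_def by blast
qed

lemma Phi_mvt:
  assumes "s \<in> dom1 M" "t \<in> dom1 M" "s < t"
  shows "\<exists>\<xi>\<in>{s<..<t}. \<Phi> t - \<Phi> s = D \<xi> * (t - s)"
proof -
  have sub: "{s..t} \<subseteq> dom1 M" using dom1_Icc assms by blast
  have "(\<Phi> has_derivative (\<lambda>h. D x * h)) (at x within {s..t})" if "s \<le> x" "x \<le> t" for x
  proof -
    have "(\<Phi> has_derivative (\<lambda>h. D x * h)) (at x within dom1 M)"
      using Phi_deriv[of x] sub that unfolding D_def has_field_derivative_def by auto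
    then show ?thesis using sub by (rule has_derivative_subset)
  qed
  then show ?thesis using mvt_simple[of s t \<Phi> "\<lambda>x h. D x * h"] assms by auto
qed

lemma Phi_inj_on:
  assumes "is_interval T" "T \<subseteq> dom1 M" "\<And>s. s \<in> T \<Longrightarrow> D s \<noteq> 0"
  shows "inj_on \<Phi> T"
proof (rule linorder_inj_onI')
  fix s t assume st: "s \<in> T" "t \<in> T" "s < t"
  then obtain \<xi> where xi: "\<xi> \<in> {s<..<t}" "\<Phi> t - \<Phi> s = D \<xi> * (t - s)"
    using Phi_mvt assms(2) by blast
  then have "\<xi> \<in> T" using assms(1) st mem_is_interval_1_I[of T s t \<xi>] by auto
  then show "\<Phi> s \<noteq> \<Phi> t" using xi assms(3)[of \<xi>] st by auto
qed

lemma Phi_monotone: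
  assumes "a \<in> dom1 M" "b \<in> dom1 M" "\<And>s. a < s \<Longrightarrow> s < b \<Longrightarrow> D s \<noteq> 0"
  shows "\<exists>\<sigma>\<in>{1,-1::real}. \<forall>s t. a \<le> s \<and> s < t \<and> t \<le> b \<longrightarrow> \<sigma> * (\<Phi> t - \<Phi> s) > 0"
proof -
  have sub: "{a<..<b} \<subseteq> dom1 M" using dom1_Icc[OF assms(1,2)] by auto
  then have con: "connected (D ` {a<..<b})"
    by (intro connected_continuous_image continuous_on_subset[OF D_continuous]) auto
  have "0 \<notin> D ` {a<..<b}" using assms(3) by force
  then have "(\<forall>s\<in>{a<..<b}. D s > 0) \<or> (\<forall>s\<in>{a<..<b}. D s < 0)"
    using con connected_contains_Icc[OF con] by (smt (verit) atLeastAtMost_iff image_eqI subsetD)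
  then have "\<exists>\<sigma>\<in>{1,-1::real}. \<forall>s. a < s \<and> s < b \<longrightarrow> \<sigma> * D s > 0"
  proof
    assume "\<forall>s\<in>{a<..<b}. D s > 0"
    then show ?thesis by (intro bexI[of _ 1]) auto
  next
    assume "\<forall>s\<in>{a<..<b}. D s < 0"
    then show ?thesis by (intro bexI[of _ "-1"]) auto
  qed
  then obtain \<sigma> where s: "\<sigma> \<in> {1,-1::real}" "\<And>s. a < s \<Longrightarrow> s < b \<Longrightarrow> \<sigma> * D s > 0"
    by blast
  have "\<sigma> * (\<Phi> t - \<Phi> s) > 0" if st: "a \<le> s" "s < t" "t \<le> b" for s t
  proof -
    have "s \<in> dom1 M" "t \<in> dom1 M" using dom1_mem[OF assms(1,2)] st by auto
    then obtain \<xi> where xi: "\<xi> \<in> {s<..<t}" "\<Phi> t - \<Phi> s = D \<xi> * (t - s)"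
      using Phi_mvt st by blast
    then have "\<sigma> * D \<xi> * (t - s) > 0" using s(2)[of \<xi>] st by auto
    then show ?thesis using xi by (simp add: mult.assoc)
  qed
  then show ?thesis using s(1) by blast
qed

text \<open>
  By the mean value theorem a difference quotient is the derivative at an intermediate point, which the
  Hoelder condition compares with the derivative at one end.
\<close>

lemma distortion:
  assumes xy: "x \<in> dom1 M" "y \<in> dom1 M" and nc: "\<And>s. s \<in> {x..y} \<Longrightarrow> D s \<noteq> 0"
  shows "\<exists>C\<ge>0. \<forall>t\<in>{x..y}. \<forall>z\<in>{x..y}. t \<noteq> z \<longrightarrow>
    \<bar>ln (\<bar>\<Phi> z - \<Phi> t\<bar> / \<bar>z - t\<bar>) - ln \<bar>D t\<bar>\<bar> \<le> C * \<bar>z - t\<bar> powr \<alpha>"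
proof (cases "x \<le> y")
  case True
  have sub: "{x..y} \<subseteq> dom1 M" using dom1_Icc xy by blast
  have "{x..y} \<subseteq> gaps (critical_points M f)"
    using sub nc critical_iff by (auto simp: gaps_def)
  then obtain T where T: "T \<in> components (gaps (critical_points M f))" "{x..y} \<subseteq> T"
    using exists_component_superset[of "{x..y}" "gaps (critical_points M f)"] True by force
  have "par M ` T \<in> eta0 M f"
    using T(1) components_pts[OF critical_finite] by (simp add: eta0_def)
  moreover have "is_interval T"
    using T(1) in_components_connected is_interval_connected_1 by blast
  moreover have "T \<subseteq> dom1 M"
    using in_components_subset[OF T(1)] by (auto simp: gaps_def)
  ultimately have "holder_on \<alpha> D T"
    using C1_alpha unfolding C1_alpha_def D_def by blast
  then obtain H where H: "\<And>s t. s \<in> T \<Longrightarrow> t \<in> T \<Longrightarrow> \<bar>D s - D t\<bar> \<le> H * \<bar>s - t\<bar> powr \<alpha>"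
    unfolding holder_on_def by blast
  have "continuous_on {x..y} (\<lambda>s. \<bar>D s\<bar>)"
    by (intro continuous_intros continuous_on_subset[OF D_continuous sub])
  then obtain m where m: "m \<in> {x..y}" "\<And>s. s \<in> {x..y} \<Longrightarrow> \<bar>D m\<bar> \<le> \<bar>D s\<bar>"
    using continuous_attains_inf[of "{x..y}" "\<lambda>s. \<bar>D s\<bar>"] True by auto
  define \<delta> where "\<delta> = \<bar>D m\<bar>"
  have delta: "\<delta> > 0" using nc m by (simp add: \<delta>_def)
  show ?thesis
  proof (intro exI[of _ "\<bar>H\<bar> / \<delta>"] conjI ballI impI)
    show "0 \<le> \<bar>H\<bar> / \<delta>" using delta by simp
    fix t z assume tz: "t \<in> {x..y}" "z \<in> {x..y}" "t \<noteq> z"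
    have "\<exists>\<xi>. min t z < \<xi> \<and> \<xi> < max t z \<and> \<bar>\<Phi> z - \<Phi> t\<bar> = \<bar>D \<xi>\<bar> * \<bar>z - t\<bar>"
    proof (cases "t < z")
      case True
      then obtain \<xi> where "\<xi> \<in> {t<..<z}" "\<Phi> z - \<Phi> t = D \<xi> * (z - t)"
        using Phi_mvt[of t z] sub tz by blast
      then show ?thesis using True by (intro exI[of _ \<xi>]) (simp add: abs_mult)
    next
      case False
      then have "z < t" using tz by simp
      then obtain \<xi> where "\<xi> \<in> {z<..<t}" "\<Phi> t - \<Phi> z = D \<xi> * (t - z)"
        using Phi_mvt[of z t] sub tz by blast
      then have "\<bar>\<Phi> t - \<Phi> z\<bar> = \<bar>D \<xi>\<bar> * \<bar>t - z\<bar>" "z < \<xi>" "\<xi> < t" by (simp_all add: abs_mult)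
      then show ?thesis using False tz by (intro exI[of _ \<xi>]) (simp add: abs_minus_commute)
    qed
    then obtain \<xi> where xi: "min t z < \<xi>" "\<xi> < max t z" "\<bar>\<Phi> z - \<Phi> t\<bar> = \<bar>D \<xi>\<bar> * \<bar>z - t\<bar>"
      by blast
    have xin: "\<xi> \<in> {x..y}" using xi tz by auto
    have "\<bar>ln (\<bar>\<Phi> z - \<Phi> t\<bar> / \<bar>z - t\<bar>) - ln \<bar>D t\<bar>\<bar> = \<bar>ln \<bar>D \<xi>\<bar> - ln \<bar>D t\<bar>\<bar>"
      using xi(3) tz by simp
    also have "\<dots> \<le> \<bar>\<bar>D \<xi>\<bar> - \<bar>D t\<bar>\<bar> / \<delta>"
      using m(2)[OF xin] m(2)[OF tz(1)] delta unfolding \<delta>_def by (intro ln_lipschitz) auto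
    also have "\<dots> \<le> \<bar>D \<xi> - D t\<bar> / \<delta>"
      using delta by (intro divide_right_mono) auto
    also have "\<dots> \<le> \<bar>H\<bar> * \<bar>\<xi> - t\<bar> powr \<alpha> / \<delta>"
    proof (intro divide_right_mono)
      have "\<bar>D \<xi> - D t\<bar> \<le> H * \<bar>\<xi> - t\<bar> powr \<alpha>" using H T(2) xin tz by blast
      also have "\<dots> \<le> \<bar>H\<bar> * \<bar>\<xi> - t\<bar> powr \<alpha>" by (intro mult_right_mono) auto
      finally show "\<bar>D \<xi> - D t\<bar> \<le> \<bar>H\<bar> * \<bar>\<xi> - t\<bar> powr \<alpha>" .
    qed (use delta in auto)
    also have "\<dots> \<le> \<bar>H\<bar> * \<bar>z - t\<bar> powr \<alpha> / \<delta>"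
      using xi alpha_pos delta by (intro divide_right_mono mult_left_mono powr_mono2) auto
    finally show "\<bar>ln (\<bar>\<Phi> z - \<Phi> t\<bar> / \<bar>z - t\<bar>) - ln \<bar>D t\<bar>\<bar> \<le> \<bar>H\<bar> / \<delta> * \<bar>z - t\<bar> powr \<alpha>"
      by (simp add: field_simps)
  qed
next
  case False
  then show ?thesis by (intro exI[of _ 0]) auto
qed

subsection \<open>The first partition\<close>

text \<open>
  The possible parameters of endpoints of intervals of the first partition; the boundary is included
  because the first partition of an interval also ends there.
\<close>

definition nodes :: "real set" where
  "nodes = {t \<in> dom1 M. par M t \<in> post_critical M f \<union> bdry M}"

definition basic :: "real \<Rightarrow> real \<Rightarrow> bool" where
  "basic a b \<longleftrightarrow> a < b \<and> a \<in> nodes \<and> b \<in> nodes \<and> (\<forall>t. a < t \<and> t < b \<longrightarrow> t \<notin> nodes)"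

lemma nodes_dom: "t \<in> nodes \<Longrightarrow> t \<in> dom1 M"
  by (simp add: nodes_def)

lemma nodes_shift: "t \<in> nodes \<Longrightarrow> d \<in> deck \<Longrightarrow> t + d \<in> nodes"
  by (simp add: nodes_def dom1_shift par_shift)

lemma nodes_Phi: "t \<in> nodes \<Longrightarrow> \<Phi> t \<in> nodes"
proof -
  assume t: "t \<in> nodes"
  have "f x \<in> bdry M" if "x \<in> bdry M" for x
    using C1_alpha that unfolding C1_alpha_def by blast
  then have "f (par M t) \<in> post_critical M f \<union> bdry M" using t f_post by (auto simp: nodes_def)
  then show ?thesis using t f_par Phi_dom by (auto simp: nodes_def)
qed

lemma finite_nodes: "finite {t \<in> nodes. x \<le> t \<and> t \<le> y}"
proof -
  have "finite (post_critical M f \<union> bdry M)" using post_finite by (auto simp: bdry_def)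
  from finite_vimage_bounded[OF this, of x y] show ?thesis
    by (rule rev_finite_subset) (auto simp: nodes_def)
qed

lemma critical_node: "t \<in> dom1 M \<Longrightarrow> D t = 0 \<Longrightarrow> t \<in> nodes"
  using critical_iff critical_sub_post by (auto simp: nodes_def)

lemma bdry_param: "t \<in> dom1 M \<Longrightarrow> par M t \<in> bdry M \<Longrightarrow> dom1 M = {0..len M} \<and> (t = 0 \<or> t = len M)"
  using par_eq_iff[of t 0] par_eq_iff[of t "len M"] len_pos
  by (auto simp: bdry_def deck_def dom1_def split: if_splits)

lemma basic_dom: "basic a b \<Longrightarrow> a \<le> t \<Longrightarrow> t \<le> b \<Longrightarrow> t \<in> dom1 M"
  unfolding basic_def using nodes_dom dom1_mem by blast

lemma basic_noncritical: "basic a b \<Longrightarrow> a < t \<Longrightarrow> t < b \<Longrightarrow> D t \<noteq> 0"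
  using basic_dom[of a b t] critical_node[of t] by (auto simp: basic_def)

lemma basic_shift:
  assumes "basic a b" "d \<in> deck"
  shows "basic (a + d) (b + d)"
proof -
  have "t \<notin> nodes" if "a + d < t" "t < b + d" for t
  proof
    assume "t \<in> nodes"
    then have "t + - d \<in> nodes" using nodes_shift deck_minus assms(2) by blast
    then show False using assms(1) that unfolding basic_def by (metis add_uminus_conv_diff diff_less_eq less_diff_eq)
  qed
  then show ?thesis using assms nodes_shift by (auto simp: basic_def)
qed

lemma basic_overlap:
  assumes "basic a b" "basic a' b'" "a < s" "s < b" "a' \<le> s" "s \<le> b'"
  shows "a' = a" "b' = b"
proof -
  have "s \<noteq> a'" "s \<noteq> b'" using assms unfolding basic_def by blast+
  then show "a' = a" "b' = b" using assms unfolding basic_def by (smt (verit))+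
qed

lemma basic_right:
  assumes "x \<in> nodes" "y \<in> nodes" "x < y"
  shows "\<exists>b\<le>y. basic x b"
proof -
  define S where "S = {t \<in> nodes. x \<le> t \<and> t \<le> y} - {x}"
  have S: "finite S" "y \<in> S" using finite_nodes assms by (auto simp: S_def)
  define m where "m = Min S"
  have m: "m \<in> S" "m \<le> y" using Min_in[OF S(1)] Min_le[OF S] S(2) by (auto simp: m_def)
  have "t \<notin> nodes" if t: "x < t" "t < m" for t
  proof
    assume "t \<in> nodes"
    then have "t \<in> S" using t m(2) by (simp add: S_def)
    then have "m \<le> t" using Min_le[OF S(1)] by (simp add: m_def)
    then show False using t by simp
  qed
  moreover have "x < m" "m \<in> nodes" using m(1) by (auto simp: S_def)
  ultimately have "basic x m" using assms(1) by (simp add: basic_def)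
  then show ?thesis using m(2) by blast
qed

lemma basic_left:
  assumes "x \<in> nodes" "y \<in> nodes" "x < y"
  shows "\<exists>a\<ge>x. basic a y"
proof -
  define S where "S = {t \<in> nodes. x \<le> t \<and> t \<le> y} - {y}"
  have S: "finite S" "x \<in> S" using finite_nodes assms by (auto simp: S_def)
  define m where "m = Max S"
  have m: "m \<in> S" "x \<le> m" using Max_in[OF S(1)] Max_ge[OF S] S(2) by (auto simp: m_def)
  have "t \<notin> nodes" if t: "m < t" "t < y" for t
  proof
    assume "t \<in> nodes"
    then have "t \<in> S" using t m(2) by (simp add: S_def)
    then have "t \<le> m" using Max_ge[OF S(1)] by (simp add: m_def)
    then show False using t by simp
  qed
  moreover have "m < y" "m \<in> nodes" using m(1) by (auto simp: S_def)
  ultimately have "basic m y" using assms(2) by (simp add: basic_def)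
  then show ?thesis using m(2) by blast
qed

lemma basic_cover:
  assumes "x \<in> nodes" "y \<in> nodes" "x < y" "x \<le> s" "s \<le> y"
  shows "\<exists>a b. basic a b \<and> x \<le> a \<and> b \<le> y \<and> a \<le> s \<and> s \<le> b"
proof (cases "s = y")
  case True
  obtain a where "a \<ge> x" "basic a y" using basic_left[OF assms(1-3)] by blast
  then show ?thesis using True by (intro exI[of _ a] exI[of _ y]) (simp add: basic_def)
next
  case False
  define S where "S = {t \<in> nodes. x \<le> t \<and> t \<le> s}"
  have S: "finite S" "x \<in> S" using finite_nodes assms by (auto simp: S_def)
  define m where "m = Max S"
  have mS: "m \<in> S" using Max_in[OF S(1)] S(2) by (auto simp: m_def)
  then have m: "m \<in> nodes" "x \<le> m" "m \<le> s" by (auto simp: S_def)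
  then obtain b where b: "b \<le> y" "basic m b"
    using basic_right[of m y] assms False by auto
  have "s \<le> b"
  proof (rule ccontr)
    assume "\<not> s \<le> b"
    then have "b \<in> S" using b m by (simp add: basic_def S_def)
    then have "b \<le> m" using Max_ge[OF S(1)] by (simp add: m_def)
    then show False using b by (simp add: basic_def)
  qed
  then show ?thesis using b m by blast
qed

lemma basic_length:
  assumes "basic a b"
  shows "b - a \<le> len M"
proof (cases "is_circle M")
  case True
  have "len M \<in> deck" by (rule len_deck) (rule True)
  then have "a + len M \<in> nodes" using assms nodes_shift by (auto simp: basic_def)
  then show ?thesis using assms len_pos unfolding basic_def by (smt (verit))
next
  case False
  moreover have "a \<in> dom1 M" "b \<in> dom1 M" using assms nodes_dom by (auto simp: basic_def)
  ultimately show ?thesis by (auto simp: dom1_def)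
qed

lemma nodes_around:
  assumes "t \<in> dom1 M"
  shows "\<exists>x\<in>nodes. \<exists>y\<in>nodes. x < y \<and> x \<le> t \<and> t \<le> y"
proof (cases "is_circle M")
  case True
  obtain u where u: "u \<in> dom1 M" "par M u \<in> post_critical M f"
    using post_nonempty post_sub_pts by (auto simp: pts_def)
  obtain d where d: "d \<in> deck" "0 \<le> u - t + d" "u - t + d < len M"
    using circle_reduce[OF True] by blast
  have "len M \<in> deck" by (rule len_deck) (rule True)
  then have "u + d \<in> nodes" "u + (d - len M) \<in> nodes"
    using nodes_shift[of u] u d deck_diff by (auto simp: nodes_def)
  then show ?thesis using d len_pos by (intro bexI[of _ "u + (d - len M)"] bexI[of _ "u + d"]) auto
next
  case False
  then have "0 \<in> nodes" "len M \<in> nodes" using len_pos by (auto simp: nodes_def dom1_def bdry_def)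
  then show ?thesis using assms False len_pos
    by (intro bexI[of _ 0] bexI[of _ "len M"]) (auto simp: dom1_def)
qed

text \<open>
  A component can contain one of its ends, namely a boundary point of \<open>M\<close> that is not
  post-critical; therefore only these inclusions hold.
\<close>

lemma piece_between:
  assumes T: "T \<in> components (gaps (post_critical M f))"
  shows "\<exists>a b. basic a b \<and> {a<..<b} \<subseteq> T \<and> T \<subseteq> {a..b}"
proof -
  have Tsub: "T \<subseteq> gaps (post_critical M f)" "T \<noteq> {}" "is_interval T"
    using T in_components_subset in_components_nonempty in_components_connected is_interval_connected_1
    by blast+
  then obtain t where t: "t \<in> T" by blast
  then have tg: "t \<in> dom1 M" "par M t \<notin> post_critical M f" using Tsub by (auto simp: gaps_def)
  then obtain a b where ab: "basic a b" "a \<le> t" "t \<le> b"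
    using nodes_around basic_cover by meson
  have "{a<..<b} \<union> {t} \<subseteq> gaps (post_critical M f)"
    using ab tg basic_dom[OF ab(1)] by (auto simp: gaps_def basic_def nodes_def)
  moreover have "is_interval ({a<..<b} \<union> {t})"
    unfolding is_interval_1 using ab by auto
  ultimately have "{a<..<b} \<union> {t} \<subseteq> T"
    using T t components_maximal[OF T] is_interval_connected_1 by blast
  moreover have "T \<subseteq> {a..b}"
  proof
    fix v assume v: "v \<in> T"
    have vd: "v \<in> dom1 M" using v Tsub by (auto simp: gaps_def)
    show "v \<in> {a..b}"
    proof (rule ccontr)
      assume "v \<notin> {a..b}"
      then consider "v < a" | "b < v" by force
      then show False
      proof cases
        case 1
        then have "a \<in> T" using mem_is_interval_1_I[OF Tsub(3) v t] ab by auto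
        then have "par M a \<in> bdry M" using ab Tsub by (auto simp: gaps_def basic_def nodes_def)
        then have "dom1 M = {0..len M}" "a = 0 \<or> a = len M"
          using bdry_param ab(1) nodes_dom by (auto simp: basic_def)
        then show False using 1 vd ab(1) nodes_dom[of b] by (auto simp: basic_def)
      next
        case 2
        then have "b \<in> T" using mem_is_interval_1_I[OF Tsub(3) t v] ab by auto
        then have "par M b \<in> bdry M" using ab Tsub by (auto simp: gaps_def basic_def nodes_def)
        then have "dom1 M = {0..len M}" "b = 0 \<or> b = len M"
          using bdry_param ab(1) nodes_dom by (auto simp: basic_def)
        then show False using 2 vd ab(1) nodes_dom[of a] by (auto simp: basic_def)
      qed
    qed
  qed
  ultimately show ?thesis using ab by blast
qed

lemma closure_piece:
  assumes ab: "basic a b" "{a<..<b} \<subseteq> T" "T \<subseteq> {a..b}"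
  shows "closure (par M ` T) = par M ` {a..b}"
proof
  have sub: "{a..b} \<subseteq> dom1 M" using basic_dom[OF ab(1)] by auto
  then have "compact (par M ` {a..b})"
    by (intro compact_continuous_image continuous_on_subset[OF par_continuous]) auto
  then show "closure (par M ` T) \<subseteq> par M ` {a..b}"
    using ab(3) by (intro closure_minimal compact_imp_closed) auto
  have "closure {a<..<b} = {a..b}" using ab(1) by (simp add: basic_def)
  then have "par M ` {a..b} \<subseteq> closure (par M ` {a<..<b})"
    using sub closure_subset
    by (metis (no_types, lifting) closed_closure continuous_on_subset image_closure_subset par_continuous)
  also have "\<dots> \<subseteq> closure (par M ` T)" using ab(2) by (intro closure_mono image_mono)
  finally show "par M ` {a..b} \<subseteq> closure (par M ` T)" .
qed

lemma piece_of_basic: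
  assumes "basic a b"
  shows "\<exists>T\<in>components (gaps (post_critical M f)). {a<..<b} \<subseteq> T \<and> T \<subseteq> {a..b}"
proof -
  have "{a<..<b} \<subseteq> gaps (post_critical M f)"
    using assms basic_dom[OF assms] by (auto simp: gaps_def basic_def nodes_def)
  moreover have "{a<..<b} \<noteq> {}" using assms by (simp add: basic_def)
  ultimately obtain T where T: "T \<in> components (gaps (post_critical M f))" "{a<..<b} \<subseteq> T"
    using exists_component_superset[of "{a<..<b}" "gaps (post_critical M f)"] by (metis connected_Ioo subset_empty)
  obtain a' b' where ab: "basic a' b'" "T \<subseteq> {a'..b'}" using piece_between[OF T(1)] by blast
  have "(a + b) / 2 \<in> {a<..<b}" using assms by (simp add: basic_def)
  then have "(a + b) / 2 \<in> {a'..b'}" using T ab by blast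
  then have "a' = a" "b' = b"
    using basic_overlap[OF assms ab(1), of "(a + b) / 2"] \<open>(a + b) / 2 \<in> {a<..<b}\<close> by auto
  then show ?thesis using T ab by blast
qed

lemma first_partition_eq: "first_partition M f = {par M ` {a..b} | a b. basic a b}"
proof (intro equalityI subsetI)
  fix I assume "I \<in> first_partition M f"
  then obtain T where T: "T \<in> components (gaps (post_critical M f))" "I = closure (par M ` T)"
    using components_pts[OF post_finite] by (auto simp: first_partition_def open_pieces_def)
  then obtain a b where ab: "basic a b" "{a<..<b} \<subseteq> T" "T \<subseteq> {a..b}" using piece_between by blast
  then have "I = par M ` {a..b}" using closure_piece T(2) by simp
  then show "I \<in> {par M ` {a..b} | a b. basic a b}" using ab(1) by blast
next
  fix I assume "I \<in> {par M ` {a..b} | a b. basic a b}"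
  then obtain a b where ab: "basic a b" "I = par M ` {a..b}" by blast
  then obtain T where T: "T \<in> components (gaps (post_critical M f))" "{a<..<b} \<subseteq> T" "T \<subseteq> {a..b}"
    using piece_of_basic by blast
  then have "I = closure (par M ` T)" using closure_piece[OF ab(1)] ab(2) by simp
  then show "I \<in> first_partition M f"
    using T(1) components_pts[OF post_finite]
    by (simp add: first_partition_def open_pieces_def)
qed

text \<open>
  A parameter interval of the first partition is determined by one of its interior points, hence up
  to a translation by the image of that point.
\<close>

lemma basic_image_unique:
  assumes ab: "basic a b" and ab': "basic a' b'" and s: "a < s" "s < b"
    and s': "a' \<le> s'" "s' \<le> b'" and eq: "par M s = par M s'"
  shows "\<exists>d\<in>deck. a' = a + d \<and> b' = b + d \<and> s' = s + d"
proof -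
  have d: "s' - s \<in> deck"
    using par_eq_iff[of s s'] eq basic_dom ab ab' s s' by auto
  then have "basic (a + (s' - s)) (b + (s' - s))" using basic_shift ab by blast
  then have "a' = a + (s' - s)" "b' = b + (s' - s)"
    using basic_overlap[OF _ ab', of "a + (s' - s)" "b + (s' - s)" s'] s s' by auto
  then show ?thesis using d by force
qed

lemma finite_first_partition: "finite (first_partition M f)"
proof -
  let ?N = "{t \<in> nodes. 0 \<le> t \<and> t \<le> 2 * len M}"
  have "first_partition M f \<subseteq> (\<lambda>(a, b). par M ` {a..b}) ` (?N \<times> ?N)"
  proof
    fix I assume "I \<in> first_partition M f"
    then obtain a b where ab: "basic a b" "I = par M ` {a..b}" by (auto simp: first_partition_eq)
    obtain d where d: "d \<in> deck" "a + d \<in> {0..len M}"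
      using reduce[of a] basic_dom[OF ab(1), of a] ab(1) by (auto simp: basic_def)
    have "b + d \<le> 2 * len M" using basic_length[OF ab(1)] d by auto
    moreover have "basic (a + d) (b + d)" using basic_shift ab d by blast
    ultimately have "(a + d, b + d) \<in> ?N \<times> ?N" using d len_pos by (auto simp: basic_def)
    moreover have "par M ` {a + d..b + d} = I"
    proof -
      have "par M ` {a + d..b + d} = par M ` ((\<lambda>x. x + d) ` {a..b})" by simp
      also have "\<dots> = par M ` {a..b}"
        unfolding image_image using par_shift d basic_dom[OF ab(1)] by (intro image_cong) auto
      finally show ?thesis using ab by simp
    qed
    ultimately show "I \<in> (\<lambda>(a, b). par M ` {a..b}) ` (?N \<times> ?N)" 
      by (intro image_eqI[of _ _ "(a + d, b + d)"]) auto
  qed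
  moreover have "finite ((\<lambda>(a, b). par M ` {a..b}) ` (?N \<times> ?N))"
    using finite_nodes[of 0 "2 * len M"] by (intro finite_imageI finite_cartesian_product)
  ultimately show ?thesis by (rule finite_subset)
qed

text \<open>
  Since the map is injective on the open intervals of the first partition, a lift cannot stretch one
  of them over more than a full turn: otherwise two interior points would be sent to parameters at
  distance \<open>len M\<close>.
\<close>

lemma basic_image_length:
  assumes ab: "basic a b"
  shows "\<bar>\<Phi> b - \<Phi> a\<bar> \<le> len M"
proof (rule ccontr)
  assume big: "\<not> \<bar>\<Phi> b - \<Phi> a\<bar> \<le> len M"
  have dom: "{a..b} \<subseteq> dom1 M" using basic_dom[OF ab] by auto
  have circ: "is_circle M"
  proof (rule ccontr)
    assume "\<not> is_circle M"
    moreover have "\<Phi> a \<in> dom1 M" "\<Phi> b \<in> dom1 M" using Phi_dom nodes_dom ab by (simp_all add: basic_def)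
    ultimately show False using big by (auto simp: dom1_def)
  qed
  have lend: "len M \<in> deck" by (rule len_deck) (rule circ)
  define p where "p = min (\<Phi> a) (\<Phi> b)"
  define q where "q = max (\<Phi> a) (\<Phi> b)"
  have pq: "q - p > len M" using big by (auto simp: p_def q_def)
  define y where "y = p + (q - p - len M) / 2"
  have y: "p < y" "y < q" "p < y + len M" "y + len M < q"
    using pq len_pos by (auto simp: y_def field_simps)
  have ivt: "\<exists>u\<in>{a<..<b}. \<Phi> u = v" if "p < v" "v < q" for v
  proof -
    have "v \<in> closed_segment (\<Phi> a) (\<Phi> b)" using that by (auto simp: closed_segment_eq_real_ivl p_def q_def)
    moreover have "continuous_on (closed_segment a b) \<Phi>"
      using ab dom continuous_on_subset[OF Phi_continuous] by (simp add: closed_segment_eq_real_ivl basic_def)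
    ultimately obtain u where "u \<in> closed_segment a b" "\<Phi> u = v"
      using IVT'_closed_segment_real by metis
    moreover have "u \<noteq> a" "u \<noteq> b" using that \<open>\<Phi> u = v\<close> by (auto simp: p_def q_def)
    ultimately show ?thesis using ab by (auto simp: closed_segment_eq_real_ivl basic_def)
  qed
  obtain u where u: "u \<in> {a<..<b}" "\<Phi> u = y" using ivt y by blast
  obtain v where v: "v \<in> {a<..<b}" "\<Phi> v = y + len M" using ivt y by blast
  have uv: "u \<in> dom1 M" "v \<in> dom1 M" using u v dom by auto
  have "f (par M u) = f (par M v)"
    using f_par uv u v par_shift[of y "len M"] lend Phi_dom[OF uv(1)] by simp
  moreover obtain T where T: "T \<in> components (gaps (post_critical M f))" "{a<..<b} \<subseteq> T"
    using piece_of_basic[OF ab] by blast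
  moreover have "inj_on f (par M ` T)"
    using inj_pieces T components_pts[OF post_finite] by (auto simp: open_pieces_def)
  ultimately have "par M u = par M v" using u v by (meson imageI inj_onD subsetD)
  then have "v - u \<in> deck" using par_eq_iff uv by blast
  moreover have "\<bar>v - u\<bar> < len M" using u v basic_length[OF ab] by auto
  ultimately have "v = u" using deck_small by force
  then show False using u v len_pos by auto
qed

text \<open>
  Only the two endpoints of an interval can be mapped to parameters at distance \<open>len M\<close>.
\<close>

lemma basic_fibre:
  assumes ab: "basic a b" and u: "a < u" "u < b" and w: "a \<le> w" "w \<le> b"
    and eq: "\<Phi> w - \<Phi> u \<in> deck"
  shows "w = u"
proof -
  obtain \<sigma> where s: "\<sigma> \<in> {1,-1::real}"
    "\<And>s t. a \<le> s \<Longrightarrow> s < t \<Longrightarrow> t \<le> b \<Longrightarrow> \<sigma> * (\<Phi> t - \<Phi> s) > 0"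
    using Phi_monotone[of a b] ab basic_noncritical[OF ab] nodes_dom unfolding basic_def by blast
  have "\<bar>\<Phi> w - \<Phi> u\<bar> < \<bar>\<Phi> b - \<Phi> a\<bar>"
    using s(1) s(2)[of a u] s(2)[of u b] s(2)[of a w] s(2)[of w b] u w
    by (cases "w = a"; cases "w = b") (auto simp: abs_if)
  then have "\<Phi> w - \<Phi> u = 0" using basic_image_length[OF ab] deck_small[OF eq] by linarith
  then show ?thesis using s(1) s(2)[of u w] s(2)[of w u] u w by (cases "w < u"; cases "u < w") auto
qed

end

section \<open>Lengths up to finite sets\<close>

text \<open>
  When an interval of the first partition is mapped once around the circle, the inverse branch selects
  one of two endpoints.  So the sets of the symbolic description agree with intervals of parameters only
  up to finite sets, which do not change lengths.
\<close>

definition almost_eq :: "'b set \<Rightarrow> 'b set \<Rightarrow> bool" where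
  "almost_eq A B \<longleftrightarrow> finite (A - B) \<and> finite (B - A)"

lemma almost_eq_refl [simp]: "almost_eq A A"
  by (simp add: almost_eq_def)

lemma almost_eq_lborel:
  fixes A B :: "real set"
  assumes "almost_eq A B" "B \<in> sets borel"
  shows "A \<in> sets borel" "measure lborel A = measure lborel B"
proof -
  have fin: "finite (A - B)" "finite (B - A)" using assms by (auto simp: almost_eq_def)
  then have "A - B \<in> sets borel" "B - A \<in> sets borel"
    by (simp_all add: borel_closed finite_imp_closed)
  then have "(B - (B - A)) \<union> (A - B) \<in> sets borel"
    using assms(2) by (meson sets.Diff sets.Un)
  moreover have "(B - (B - A)) \<union> (A - B) = A" by blast
  ultimately show A: "A \<in> sets borel" by simp
  have "(A - B) \<union> (B - A) \<in> null_sets lborel"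
    using fin by (intro finite_imp_null_set_lborel) auto
  then have "AE x in lborel. x \<notin> (A - B) \<union> (B - A)" by (rule AE_not_in)
  then have "AE x in lborel. x \<in> A \<longleftrightarrow> x \<in> B" by eventually_elim blast
  then show "measure lborel A = measure lborel B"
    using A assms(2) by (intro measure_eq_AE) auto
qed

lemma measure_segment: "measure lborel (closed_segment p q) = \<bar>q - p\<bar>" for p q :: real
  by (auto simp: closed_segment_eq_real_ivl)

context manifold_1d
begin

lemma arc_length_almost:
  assumes "almost_eq A (par M ` S)"
    "almost_eq {t \<in> {0..len M}. par M t \<in> par M ` S} T" "T \<in> sets borel"
  shows "arc_length M A = measure lborel T"
proof -
  have "finite ((A - par M ` S) \<union> (par M ` S - A))" using assms(1) by (simp add: almost_eq_def)
  then have fin: "finite {t \<in> dom1 M. 0 \<le> t \<and> t \<le> len M \<and> par M t \<in> (A - par M ` S) \<union> (par M ` S - A)}"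
    by (rule finite_vimage_bounded)
  have "almost_eq {t \<in> {0..len M}. par M t \<in> A} {t \<in> {0..len M}. par M t \<in> par M ` S}"
    unfolding almost_eq_def
    by (intro conjI; rule finite_subset[OF _ fin]) (use fundamental_dom in auto)
  then have "measure lborel {t \<in> {0..len M}. par M t \<in> A} =
      measure lborel {t \<in> {0..len M}. par M t \<in> par M ` S}"
    using almost_eq_lborel(1)[OF assms(2,3)] almost_eq_lborel(2) by blast
  also have "\<dots> = measure lborel T" using almost_eq_lborel(2)[OF assms(2,3)] .
  finally show ?thesis by (simp add: arc_length_def)
qed

lemma arc_length_Icc:
  assumes sub: "{x..y} \<subseteq> dom1 M" and xy: "x \<le> y" "y - x \<le> len M"
    and A: "almost_eq A (par M ` {x..y})"
  shows "arc_length M A = y - x"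
proof (cases "is_circle M")
  case False
  then have inj: "par M s = par M t \<longleftrightarrow> s = t" if "s \<in> dom1 M" "t \<in> dom1 M" for s t
    using par_eq_iff[OF that] by (auto simp: deck_def)
  have dom: "dom1 M = {0..len M}" using False by (simp add: dom1_def)
  have "{t \<in> {0..len M}. par M t \<in> par M ` {x..y}} = {x..y}"
    using sub inj unfolding dom by (auto simp: image_iff)
  then have "almost_eq {t \<in> {0..len M}. par M t \<in> par M ` {x..y}} {x..y}" by simp
  from arc_length_almost[OF A this] show ?thesis using xy by simp
next
  case True
  then have dom: "dom1 M = UNIV" by (simp add: dom1_def)
  obtain d where d: "d \<in> deck" "0 \<le> x + d" "x + d < len M" using circle_reduce[OF True] by blast
  define x' where "x' = x + d"
  define y' where "y' = y + d"
  have x': "0 \<le> x'" "x' < len M" "x' \<le> y'" "y' - x' \<le> len M" "y' - x' = y - x"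
    using d xy by (auto simp: x'_def y'_def)
  have "par M ` {x'..y'} = par M ` ((\<lambda>s. s + d) ` {x..y})" by (simp add: x'_def y'_def)
  also have "\<dots> = par M ` {x..y}"
    unfolding image_image using par_shift d dom by (intro image_cong) auto
  finally have A': "almost_eq A (par M ` {x'..y'})" using A by simp
  let ?S = "{t \<in> {0..len M}. par M t \<in> par M ` {x'..y'}}"
  have lend: "len M \<in> deck" by (rule len_deck) (rule True)
  \<comment> \<open>a translate of the parameter interval meets the fundamental domain in at most two pieces\<close>
  have S: "t \<in> {x'..y'} \<or> t + len M \<in> {x'..y'}" if t: "t \<in> ?S" "t \<noteq> len M" for t
  proof -
    obtain s where s: "s \<in> {x'..y'}" "par M t = par M s" using t by auto
    then have st: "s - t \<in> deck" using par_eq_iff[of t s] dom by auto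
    have range: "- len M < s - t" "s - t < 2 * len M" using s(1) t x' by auto
    show ?thesis
    proof (cases "s - t < len M")
      case True
      then have "s - t = 0" using deck_small[OF st] range by auto
      then show ?thesis using s by simp
    next
      case False
      have "s - t - len M = 0"
        using deck_small[OF deck_diff[OF st lend]] range False by auto
      then have "s = t + len M" by simp
      then show ?thesis using s by simp
    qed
  qed
  have S': "t \<in> ?S" if "t \<in> {0..len M}" "t \<in> {x'..y'} \<or> t + len M \<in> {x'..y'}" for t
  proof -
    have "par M (t + len M) = par M t" using par_shift lend dom by simp
    then have "par M t \<in> par M ` {x'..y'}" using that(2) by (metis imageI)
    then show ?thesis using that(1) by simp
  qed
  show ?thesis
  proof (cases "y' < len M")
    case True
    have "?S - {x'..y'} \<subseteq> {0, len M}"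
    proof
      fix t assume t: "t \<in> ?S - {x'..y'}"
      show "t \<in> {0, len M}"
      proof (cases "t = len M")
        case False
        then have "t + len M \<le> y'" using S[of t] t by auto
        then show ?thesis using t True by auto
      qed simp
    qed
    moreover have "{x'..y'} - ?S = {}"
    proof -
      have "t \<in> ?S" if "t \<in> {x'..y'}" for t using S'[of t] that x' True by auto
      then show ?thesis by blast
    qed
    ultimately have "almost_eq ?S {x'..y'}"
      unfolding almost_eq_def by (metis finite.emptyI finite_insert finite_subset)
    from arc_length_almost[OF A' this] show ?thesis using x' by simp
  next
    case False
    let ?T = "{x'<..len M} \<union> {0..y' - len M}"
    have "?S - ?T \<subseteq> {x', len M}"
    proof
      fix t assume t: "t \<in> ?S - ?T"
      show "t \<in> {x', len M}" using S[of t] t by (cases "t = len M") auto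
    qed
    moreover have "?T - ?S = {}"
    proof -
      have "t \<in> ?S" if t: "t \<in> ?T" for t
        by (rule S') (use t x' False in auto)
      then show ?thesis by blast
    qed
    ultimately have "almost_eq ?S ?T"
      unfolding almost_eq_def by (metis finite.emptyI finite_insert finite_subset)
    from arc_length_almost[OF A' this] have "arc_length M A = measure lborel ?T" by simp
    also have "\<dots> = measure lborel {x'<..len M} + measure lborel {0..y' - len M}"
      using x' by (intro measure_Union) (auto simp: emeasure_lborel_Icc_eq)
    also have "\<dots> = y - x" using x' False by simp
    finally show ?thesis .
  qed
qed

end

section \<open>Words and pulled-back intervals\<close>

context geometrically_finite_map
begin

definition rep :: "'a set \<Rightarrow> real \<times> real" where
  "rep I = (SOME p. basic (fst p) (snd p) \<and> I = par M ` {fst p..snd p})"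

definition lo :: "'a set \<Rightarrow> real" where "lo I = fst (rep I)"
definition hi :: "'a set \<Rightarrow> real" where "hi I = snd (rep I)"
definition base :: "'a set \<Rightarrow> real set" where "base I = {lo I..hi I}"

lemma rep:
  assumes "I \<in> first_partition M f"
  shows "basic (lo I) (hi I)" "I = par M ` base I"
proof -
  have "\<exists>p. basic (fst p) (snd p) \<and> I = par M ` {fst p..snd p}"
    using assms by (auto simp: first_partition_eq)
  then have "basic (fst (rep I)) (snd (rep I)) \<and> I = par M ` {fst (rep I)..snd (rep I)}"
    unfolding rep_def by (rule someI_ex)
  then show "basic (lo I) (hi I)" "I = par M ` base I"
    by (auto simp: lo_def hi_def base_def)
qed

lemma base_dom: "I \<in> first_partition M f \<Longrightarrow> base I \<subseteq> dom1 M"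
  using basic_dom[OF rep(1)] by (auto simp: base_def)

lemma lo_less_hi: "I \<in> first_partition M f \<Longrightarrow> lo I < hi I"
  using rep(1) by (simp add: basic_def)

text \<open>
  The translation \<open>d\<close> moves the image of the chosen parameter interval of \<open>I\<close> over that of \<open>J\<close>, so that
  \<open>\<Phi> s + d\<close> is a lift of the branch of the map over \<open>J\<close>.
\<close>

definition edge :: "'a set \<Rightarrow> real \<Rightarrow> 'a set \<Rightarrow> bool" where
  "edge I d J \<longleftrightarrow> I \<in> first_partition M f \<and> J \<in> first_partition M f \<and> d \<in> deck \<and>
     base J \<subseteq> (\<lambda>s. \<Phi> s + d) ` base I"

lemma f_image: "I \<in> first_partition M f \<Longrightarrow> d \<in> deck \<Longrightarrow> f ` I = par M ` (\<lambda>s. \<Phi> s + d) ` base I"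
proof -
  assume I: "I \<in> first_partition M f" and d: "d \<in> deck"
  have "f ` I = f ` par M ` base I" using rep(2)[OF I] by simp
  also have "\<dots> = par M ` (\<lambda>s. \<Phi> s + d) ` base I"
    unfolding image_image
  proof (intro image_cong refl)
    fix s assume "s \<in> base I"
    then have "s \<in> dom1 M" using base_dom[OF I] by blast
    then show "f (par M s) = par M (\<Phi> s + d)" using f_par par_shift[OF Phi_dom d] by simp
  qed
  finally show ?thesis .
qed

lemma edge_image: "edge I d J \<Longrightarrow> J \<subseteq> f ` I"
proof -
  assume e: "edge I d J"
  then have "par M ` base J \<subseteq> par M ` (\<lambda>s. \<Phi> s + d) ` base I"
    unfolding edge_def by (intro image_mono) blast
  then show ?thesis using f_image[of I d] rep(2)[of J] e unfolding edge_def by simp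
qed

lemma branch_monotone:
  assumes "I \<in> first_partition M f"
  shows "\<exists>\<sigma>\<in>{1,-1::real}. \<forall>s\<in>base I. \<forall>t\<in>base I. s < t \<longrightarrow> \<sigma> * (\<Phi> t - \<Phi> s) > 0"
proof -
  have ab: "basic (lo I) (hi I)" by (rule rep(1)[OF assms])
  then have "lo I \<in> dom1 M" "hi I \<in> dom1 M" using nodes_dom by (auto simp: basic_def)
  then obtain \<sigma> where "\<sigma> \<in> {1,-1::real}"
    "\<And>s t. lo I \<le> s \<and> s < t \<and> t \<le> hi I \<Longrightarrow> \<sigma> * (\<Phi> t - \<Phi> s) > 0"
    using Phi_monotone[of "lo I" "hi I"] basic_noncritical[OF ab] by blast
  then show ?thesis by (intro bexI[of _ \<sigma>]) (auto simp: base_def)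
qed

lemma branch_inj: "I \<in> first_partition M f \<Longrightarrow> s \<in> base I \<Longrightarrow> t \<in> base I \<Longrightarrow> \<Phi> s = \<Phi> t \<Longrightarrow> s = t"
proof (rule ccontr)
  assume I: "I \<in> first_partition M f" and st: "s \<in> base I" "t \<in> base I" "\<Phi> s = \<Phi> t" "s \<noteq> t"
  obtain \<sigma> where "\<forall>s\<in>base I. \<forall>t\<in>base I. s < t \<longrightarrow> \<sigma> * (\<Phi> t - \<Phi> s) > (0::real)"
    using branch_monotone[OF I] by blast
  then show False using st by (cases "s < t") force+
qed

text \<open>
  A branch is strictly monotone, so that it pulls segments back to segments.
\<close>

lemma branch_preimage:
  assumes I: "I \<in> first_partition M f" and p: "p \<in> base I" and q: "q \<in> base I"
  shows "{s \<in> base I. \<Phi> s + d \<in> closed_segment (\<Phi> p + d) (\<Phi> q + d)} = closed_segment p q"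
proof -
  obtain \<sigma> where s: "\<sigma> \<in> {1,-1::real}" "\<forall>s\<in>base I. \<forall>t\<in>base I. s < t \<longrightarrow> \<sigma> * (\<Phi> t - \<Phi> s) > 0"
    using branch_monotone[OF I] by blast
  have le: "s \<le> t \<longleftrightarrow> \<sigma> * \<Phi> s \<le> \<sigma> * \<Phi> t" if "s \<in> base I" "t \<in> base I" for s t
  proof (cases s t rule: linorder_cases)
    case less
    then have "\<sigma> * (\<Phi> t - \<Phi> s) > 0" using s(2) that by blast
    then show ?thesis using less by (simp add: algebra_simps)
  next
    case greater
    then have "\<sigma> * (\<Phi> s - \<Phi> t) > 0" using s(2) that by blast
    then show ?thesis using greater by (simp add: algebra_simps)
  qed simp
  have conv: "s \<in> base I" if "s \<in> closed_segment p q" for s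
    using that p q by (auto simp: base_def closed_segment_eq_real_ivl split: if_splits)
  have "\<Phi> s + d \<in> closed_segment (\<Phi> p + d) (\<Phi> q + d) \<longleftrightarrow> s \<in> closed_segment p q" if "s \<in> base I" for s
    using s(1) le[OF p that] le[OF that p] le[OF q that] le[OF that q] le[OF p q] le[OF q p]
    by (auto simp: closed_segment_eq_real_ivl)
  then show ?thesis using conv by blast
qed

text \<open>
  The parameters of the interval of the word \<open>e i, ..., e (i + n)\<close>.  The indices are integers because
  itineraries with an infinite past are needed.
\<close>

primrec pullback :: "(int \<Rightarrow> 'a set) \<Rightarrow> (int \<Rightarrow> real) \<Rightarrow> nat \<Rightarrow> int \<Rightarrow> real set" where
  "pullback e d 0 i = base (e i)"
| "pullback e d (Suc n) i = {s \<in> base (e i). \<Phi> s + d i \<in> pullback e d n (i + 1)}"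

definition chain :: "(int \<Rightarrow> 'a set) \<Rightarrow> (int \<Rightarrow> real) \<Rightarrow> bool" where
  "chain e d \<longleftrightarrow> (\<forall>i. edge (e i) (d i) (e (i + 1)))"

lemma chain_partition: "chain e d \<Longrightarrow> e i \<in> first_partition M f"
  by (auto simp: chain_def edge_def)

lemma chain_deck: "chain e d \<Longrightarrow> d i \<in> deck"
  by (auto simp: chain_def edge_def)

lemma chain_base: "chain e d \<Longrightarrow> base (e (i + 1)) \<subseteq> (\<lambda>s. \<Phi> s + d i) ` base (e i)"
  by (auto simp: chain_def edge_def)

lemma pullback_base: "pullback e d n i \<subseteq> base (e i)"
  by (cases n) auto

lemma pullback_dom: "chain e d \<Longrightarrow> pullback e d n i \<subseteq> dom1 M"
  using pullback_base base_dom chain_partition by blast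

lemma pullback_step:
  assumes c: "chain e d" and t: "t \<in> base (e i)"
    and seg: "pullback e d n (i + 1) = closed_segment (\<Phi> t + d i) w" "w \<noteq> \<Phi> t + d i"
  shows "\<exists>z. z \<noteq> t \<and> z \<in> base (e i) \<and> \<Phi> z + d i = w \<and> pullback e d (Suc n) i = closed_segment t z"
proof -
  have "w \<in> pullback e d n (i + 1)" using seg by simp
  then obtain z where z: "z \<in> base (e i)" "w = \<Phi> z + d i"
    using chain_base[OF c, of i] pullback_base[of e d n "i + 1"] by blast
  have "pullback e d (Suc n) i = closed_segment t z"
    using branch_preimage[OF chain_partition[OF c] t z(1), of "d i"] seg z(2) by simp
  moreover have "z \<noteq> t" using z(2) seg(2) by auto
  ultimately show ?thesis using z by (intro exI[of _ z]) simp
qed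

lemma pullback_segment:
  assumes c: "chain e d"
  shows "\<exists>p q. p \<noteq> q \<and> pullback e d n i = closed_segment p q"
proof (induction n arbitrary: i)
  case 0
  have "lo (e i) < hi (e i)" using lo_less_hi chain_partition[OF c] by blast
  then show ?case
    by (intro exI[of _ "lo (e i)"] exI[of _ "hi (e i)"])
       (auto simp: base_def closed_segment_eq_real_ivl)
next
  case (Suc n)
  then obtain p q where pq: "p \<noteq> q" "pullback e d n (i + 1) = closed_segment p q" by blast
  then have "p \<in> pullback e d n (i + 1)" by simp
  then obtain t where "t \<in> base (e i)" "p = \<Phi> t + d i"
    using chain_base[OF c, of i] pullback_base[of e d n "i + 1"] by blast
  then show ?case using pullback_step[OF c, of t i n q] pq by metis
qed

lemma pullback_mono: "pullback e d (Suc n) i \<subseteq> pullback e d n i"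
proof (induction n arbitrary: i)
  case (Suc n)
  show ?case using Suc.IH[of "i + 1"] by (subst (1 2) pullback.simps(2)) blast
qed (simp add: subset_iff)

lemma pullback_antimono: "m \<le> n \<Longrightarrow> pullback e d n i \<subseteq> pullback e d m i"
  using lift_Suc_antimono_le[of "\<lambda>n. pullback e d n i"] pullback_mono by blast

lemma pullback_cong:
  assumes "\<And>j. i \<le> j \<Longrightarrow> j \<le> i + int n \<Longrightarrow> e j = e' j"
    "\<And>j. i \<le> j \<Longrightarrow> j < i + int n \<Longrightarrow> d j = d' j"
  shows "pullback e d n i = pullback e' d' n i"
  using assms
proof (induction n arbitrary: i)
  case (Suc n)
  have "pullback e d n (i + 1) = pullback e' d' n (i + 1)"
    by (rule Suc.IH) (use Suc.prems in auto)
  then show ?case using Suc.prems(1)[of i] Suc.prems(2)[of i] by simp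
qed simp

lemma pullback_shift: "pullback (\<lambda>j. e (j + k)) (\<lambda>j. d (j + k)) n i = pullback e d n (i + k)"
  by (induction n arbitrary: i) (simp_all add: algebra_simps)

definition orbit :: "(int \<Rightarrow> 'a set) \<Rightarrow> (int \<Rightarrow> real) \<Rightarrow> (int \<Rightarrow> real) \<Rightarrow> bool" where
  "orbit e d t \<longleftrightarrow> (\<forall>i. t i \<in> base (e i) \<and> \<Phi> (t i) + d i = t (i + 1))"

text \<open>
  Monotone branches pull endpoints back to endpoints; this is how intervals of words become one-sided
  neighbourhoods of the points of an orbit.
\<close>

lemma pullback_touch:
  assumes c: "chain e d" and o: "orbit e d t" and "t (i + int n) \<in> {lo (e (i + int n)), hi (e (i + int n))}"
  shows "\<exists>z. z \<noteq> t i \<and> pullback e d n i = closed_segment (t i) z"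
  using assms(3)
proof (induction n arbitrary: i)
  case 0
  have "lo (e i) < hi (e i)" using lo_less_hi chain_partition[OF c] by blast
  then show ?case
    using 0 by (intro exI[of _ "if t i = lo (e i) then hi (e i) else lo (e i)"])
       (auto simp: base_def closed_segment_eq_real_ivl)
next
  case (Suc n)
  have "i + int (Suc n) = i + 1 + int n" by simp
  then obtain w where w: "w \<noteq> t (i + 1)" "pullback e d n (i + 1) = closed_segment (t (i + 1)) w"
    using Suc.IH[of "i + 1"] Suc.prems by metis
  then show ?case using pullback_step[OF c, of "t i" i n w] o by (metis orbit_def)
qed

primrec block :: "(int \<Rightarrow> 'a set) \<Rightarrow> nat \<Rightarrow> int \<Rightarrow> 'a set signed list" where
  "block e 0 i = [symbol_of M f (e i)]"
| "block e (Suc n) i = symbol_of M f (e i) # block e n (i + 1)"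

lemma ivl_symbol [simp]: "ivl (symbol_of M f I) = I"
  by (simp add: symbol_of_def)

lemma length_block [simp]: "length (block e n i) = Suc n"
  by (induction n arbitrary: i) auto

lemma hd_block [simp]: "hd (block e n i) = symbol_of M f (e i)"
  by (cases n) auto

lemma block_nonempty [simp]: "block e n i \<noteq> []"
  by (cases n) auto

lemma suitable_single: "I \<in> first_partition M f \<Longrightarrow> suitable M f [symbol_of M f I]"
  by (simp add: suitable_def symbols_def)

lemma suitable_Cons:
  assumes "suitable M f w" "I \<in> first_partition M f" "ivl (hd w) \<subseteq> f ` I"
  shows "suitable M f (symbol_of M f I # w)"
proof -
  have "ivl ((symbol_of M f I # w) ! Suc k) \<subseteq> f ` ivl ((symbol_of M f I # w) ! k)"
    if "Suc k < length (symbol_of M f I # w)" for k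
    using that assms by (cases k) (auto simp: suitable_def hd_conv_nth)
  then show ?thesis using assms by (auto simp: suitable_def symbols_def)
qed

lemma suitable_block: "chain e d \<Longrightarrow> suitable M f (block e n i)"
proof (induction n arbitrary: i)
  case 0
  then show ?case by (simp add: suitable_single chain_partition)
next
  case (Suc n)
  have "e (i + 1) \<subseteq> f ` e i" using Suc.prems edge_image unfolding chain_def by blast
  then show ?case using Suc by (auto intro!: suitable_Cons simp: chain_partition)
qed

lemma word_interval_Cons:
  "w \<noteq> [] \<Longrightarrow> word_interval f (s # w) = branch_inverse f (ivl s) ` word_interval f w"
  by (simp add: word_interval_def word_inverse_def image_image)

lemma word_interval_single: "word_interval f [s] = branch_inverse f (ivl s) ` f ` ivl s"
  by (simp add: word_interval_def word_inverse_def image_image)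

text \<open>
  By \<open>basic_fibre\<close>, the choice made by the inverse branch is forced except at the images of the
  endpoints.
\<close>

lemma branch_inverse_interior:
  assumes I: "I \<in> first_partition M f" and u: "lo I < u" "u < hi I"
  shows "branch_inverse f I (par M (\<Phi> u)) = par M u"
proof -
  have ub: "u \<in> base I" using u by (simp add: base_def)
  then have ud: "u \<in> dom1 M" using base_dom[OF I] by blast
  have "par M (\<Phi> u) \<in> f ` I" using f_image[OF I deck_zero] ub by auto
  then have "inv_into I f (par M (\<Phi> u)) \<in> I" "f (inv_into I f (par M (\<Phi> u))) = par M (\<Phi> u)"
    by (rule inv_into_into, rule f_inv_into_f)
  then obtain w where w: "w \<in> base I" "inv_into I f (par M (\<Phi> u)) = par M w" "f (par M w) = par M (\<Phi> u)"
    using rep(2)[OF I] by (metis imageE)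
  have wd: "w \<in> dom1 M" using w base_dom[OF I] by blast
  have "par M (\<Phi> u) = par M (\<Phi> w)" using w f_par wd by simp
  then have "\<Phi> w - \<Phi> u \<in> deck" using par_eq_iff Phi_dom ud wd by blast
  then have "w = u" using basic_fibre[OF rep(1)[OF I] u] w(1) by (simp add: base_def)
  then show ?thesis using w by (simp add: branch_inverse_def)
qed

lemma branch_inverse_almost:
  assumes I: "I \<in> first_partition M f" and d: "d \<in> deck"
    and S: "S \<subseteq> (\<lambda>s. \<Phi> s + d) ` base I" and A: "almost_eq A (par M ` S)"
  shows "almost_eq (branch_inverse f I ` A) (par M ` {s \<in> base I. \<Phi> s + d \<in> S})"
proof -
  let ?g = "branch_inverse f I" and ?S' = "{s \<in> base I. \<Phi> s + d \<in> S}"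
  have par: "par M (\<Phi> s + d) = par M (\<Phi> s)" if "s \<in> base I" for s
    using that base_dom[OF I] Phi_dom par_shift d by blast
  have interior: "s = lo I \<or> s = hi I \<or> ?g (par M (\<Phi> s + d)) = par M s" if "s \<in> base I" for s
  proof (cases "s = lo I \<or> s = hi I")
    case False
    then have "lo I < s" "s < hi I" using that by (auto simp: base_def)
    then show ?thesis using branch_inverse_interior[OF I, of s] par[OF that] by simp
  qed blast
  have "?g ` A - par M ` ?S' \<subseteq> ?g ` (A - par M ` S) \<union> ?g ` (\<lambda>s. par M (\<Phi> s + d)) ` {lo I, hi I}"
  proof
    fix x assume x: "x \<in> ?g ` A - par M ` ?S'"
    then obtain y where y: "y \<in> A" "x = ?g y" by blast
    show "x \<in> ?g ` (A - par M ` S) \<union> ?g ` (\<lambda>s. par M (\<Phi> s + d)) ` {lo I, hi I}"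
    proof (cases "y \<in> par M ` S")
      case True
      then obtain s where s: "s \<in> base I" "\<Phi> s + d \<in> S" "y = par M (\<Phi> s + d)" using S by blast
      then have "x \<noteq> par M s" using x by blast
      then have "s \<in> {lo I, hi I}" using interior[OF s(1)] y s by auto
      then show ?thesis using y s by blast
    qed (use y in blast)
  qed
  moreover have "finite (?g ` (A - par M ` S) \<union> ?g ` (\<lambda>s. par M (\<Phi> s + d)) ` {lo I, hi I})"
    using A by (simp add: almost_eq_def)
  ultimately have 1: "finite (?g ` A - par M ` ?S')" by (rule finite_subset)
  have "par M ` ?S' - ?g ` A \<subseteq> par M ` {lo I, hi I} \<union> ?g ` (par M ` S - A)"
  proof
    fix x assume x: "x \<in> par M ` ?S' - ?g ` A"
    then obtain s where s: "s \<in> base I" "\<Phi> s + d \<in> S" "x = par M s" by blast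
    show "x \<in> par M ` {lo I, hi I} \<union> ?g ` (par M ` S - A)"
    proof (cases "s = lo I \<or> s = hi I")
      case False
      then have g: "x = ?g (par M (\<Phi> s + d))" using interior[OF s(1)] s by auto
      then have "par M (\<Phi> s + d) \<notin> A" using x by blast
      then show ?thesis using g s by blast
    qed (use s in blast)
  qed
  moreover have "finite (par M ` {lo I, hi I} \<union> ?g ` (par M ` S - A))"
    using A by (simp add: almost_eq_def)
  ultimately have 2: "finite (par M ` ?S' - ?g ` A)" by (rule finite_subset)
  show ?thesis using 1 2 by (simp add: almost_eq_def)
qed

text \<open>
  Each letter of a word adds at most finitely many points to the difference, again those coming from the
  endpoints.
\<close>

lemma word_interval_pullback:
  assumes c: "chain e d"
  shows "almost_eq (word_interval f (block e n i)) (par M ` pullback e d n i)"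
proof (induction n arbitrary: i)
  case 0
  have I: "e i \<in> first_partition M f" using chain_partition[OF c] .
  have "almost_eq (f ` e i) (par M ` (\<lambda>s. \<Phi> s + 0) ` base (e i))"
    unfolding f_image[OF I deck_zero] by simp
  from branch_inverse_almost[OF I deck_zero order_refl this]
  have "almost_eq (branch_inverse f (e i) ` f ` e i)
     (par M ` {s \<in> base (e i). \<Phi> s + 0 \<in> (\<lambda>s. \<Phi> s + 0) ` base (e i)})" .
  moreover have "{s \<in> base (e i). \<Phi> s + 0 \<in> (\<lambda>s. \<Phi> s + 0) ` base (e i)} = base (e i)" by blast
  ultimately show ?case by (simp add: word_interval_single)
next
  case (Suc n)
  have "pullback e d n (i + 1) \<subseteq> (\<lambda>s. \<Phi> s + d i) ` base (e i)"
    using chain_base[OF c] pullback_base by blast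
  from branch_inverse_almost[OF chain_partition[OF c] chain_deck[OF c] this Suc.IH]
  show ?case by (simp add: word_interval_Cons)
qed

lemma arc_length_pullback:
  assumes c: "chain e d"
  shows "arc_length M (word_interval f (block e n i)) = measure lborel (pullback e d n i)"
proof -
  obtain p q where pq: "pullback e d n i = closed_segment p q" using pullback_segment[OF c] by blast
  define x where "x = min p q"
  define y where "y = max p q"
  have xy: "pullback e d n i = {x..y}" "x \<le> y"
    using pq by (auto simp: x_def y_def closed_segment_eq_real_ivl)
  have "{x..y} \<subseteq> {lo (e i)..hi (e i)}" using pullback_base[of e d n i] xy by (simp add: base_def)
  then have "y - x \<le> len M"
    using basic_length[OF rep(1)[OF chain_partition[OF c, of i]]] xy(2) by auto
  then have "arc_length M (word_interval f (block e n i)) = y - x"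
    using arc_length_Icc[of x y] pullback_dom[OF c, of n i] word_interval_pullback[OF c, of n i] xy by auto
  then show ?thesis using xy by simp
qed

lemma word_length_decay:
  assumes "suitable M f w" "length w = Suc n"
  shows "arc_length M (word_interval f w) \<le> K * \<mu> ^ Suc n"
proof -
  have "finite (symbols M f)" using finite_first_partition by (simp add: symbols_def)
  then have "finite {w. set w \<subseteq> symbols M f \<and> length w = Suc n}" by (rule finite_lists_length_eq)
  then have "finite {w. suitable M f w \<and> length w = Suc n}"
    by (rule rev_finite_subset) (auto simp: suitable_def)
  then have "finite (arc_length M ` eta M f (Suc n))" by simp
  moreover have "arc_length M (word_interval f w) \<in> arc_length M ` eta M f (Suc n)"
    using assms by auto
  ultimately have "arc_length M (word_interval f w) \<le> max_length M f (Suc n)"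
    unfolding max_length_def by (rule Max_ge)
  then show ?thesis using decay[of "Suc n"] by linarith
qed

lemma pullback_decay:
  assumes "chain e d"
  shows "measure lborel (pullback e d n i) \<le> K * \<mu> ^ Suc n"
  using word_length_decay[OF suitable_block[OF assms, of n i] length_block]
    arc_length_pullback[OF assms] by simp

end

section \<open>A critical point with an infinite past\<close>

lemma geometric_null:
  fixes r :: real
  assumes "0 < r" "r < 1"
  shows "(\<lambda>n. C * r ^ n) \<longlonglongrightarrow> 0"
  using assms LIMSEQ_power_zero[of r] by (intro tendsto_mult_right_zero) auto

lemma geometric_null_shift:
  fixes r :: real
  assumes "0 < r" "r < 1"
  shows "(\<lambda>n. C * r ^ nat (int n - j)) \<longlonglongrightarrow> 0"
proof -
  have "filterlim (\<lambda>n. nat (int n - j)) sequentially sequentially"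
    unfolding filterlim_at_top eventually_sequentially
  proof (intro allI exI impI)
    fix Z n :: nat assume "nat (int Z + j) \<le> n"
    then show "Z \<le> nat (int n - j)" by linarith
  qed
  from filterlim_compose[OF geometric_null[OF assms] this] show ?thesis .
qed

lemma eventually_periodic_orbit:
  assumes "finite S" "\<And>x. x \<in> S \<Longrightarrow> g x \<in> S" "x \<in> S"
  shows "\<exists>N p. p > 0 \<and> (\<forall>m\<ge>N. (g ^^ (m + p)) x = (g ^^ m) x)"
proof -
  have "(g ^^ n) x \<in> S" for n using assms(2,3) by (induction n) auto
  then have "finite (range (\<lambda>n. (g ^^ n) x))" using assms(1) by (metis finite_subset image_subsetI)
  then have "\<not> inj (\<lambda>n. (g ^^ n) x)" using finite_imageD infinite_UNIV_nat by blast
  then obtain a b where "a \<noteq> b" "(g ^^ a) x = (g ^^ b) x" unfolding inj_on_def by auto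
  then obtain N p where Np: "p > 0" "(g ^^ (N + p)) x = (g ^^ N) x"
    by (metis less_imp_add_positive linorder_neqE_nat)
  have "(g ^^ (m + p)) x = (g ^^ m) x" if "m \<ge> N" for m
  proof -
    define k where "k = m - N"
    have k: "m = k + N" "m + p = k + (N + p)" using that by (simp_all add: k_def)
    show ?thesis unfolding k(2) unfolding k(1) funpow_add comp_apply
      using Np(2) by (simp add: funpow_add)
  qed
  then show ?thesis using Np by blast
qed

context geometrically_finite_map
begin

text \<open>
  The lift is continuous and the parametrization is an open map.
\<close>

lemma f_continuous: "continuous_on (pts M) f"
proof -
  have comp: "continuous_on (dom1 M) (\<lambda>s. par M (\<Phi> s))"
    using Phi_dom by (intro continuous_on_compose2[OF par_continuous Phi_continuous]) auto
  have "openin (top_of_set (pts M)) (pts M \<inter> f -` U)" if "open U" for U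
  proof -
    let ?V = "dom1 M \<inter> (\<lambda>s. par M (\<Phi> s)) -` U"
    have "openin (top_of_set (dom1 M)) ?V"
      using comp that continuous_openin_preimage_gen by blast
    then have "openin (top_of_set (pts M)) (par M ` ?V)" by (rule par_open_map)
    moreover have "par M ` ?V = pts M \<inter> f -` U" using f_par by (auto simp: pts_def)
    ultimately show ?thesis by simp
  qed
  then show ?thesis by (simp add: continuous_on_open_gen[of f "pts M" UNIV] continuous_on_open_invariant openin_open)
     (metis (no_types, lifting) Int_commute openin_open)
qed

definition next_to :: "'a set \<Rightarrow> 'a set \<Rightarrow> bool" where
  "next_to I J \<longleftrightarrow> (\<exists>d. edge I d J)"

lemma lift_position:
  assumes "basic a b" "par M ` {a..b} = J" "J \<in> first_partition M f"
  shows "\<exists>d\<in>deck. lo J = a + d \<and> hi J = b + d"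
proof -
  have m: "a < (a + b) / 2" "(a + b) / 2 < b" using assms(1) by (auto simp: basic_def)
  then have "par M ((a + b) / 2) \<in> par M ` base J" using assms(2) rep(2)[OF assms(3)] by force
  then obtain s where "s \<in> base J" "par M ((a + b) / 2) = par M s" by blast
  then show ?thesis
    using basic_image_unique[OF assms(1) rep(1)[OF assms(3)] m, of s] by (auto simp: base_def)
qed

text \<open>
  Every lift of an interval of the first partition inside an image becomes the chosen one after a
  translation.
\<close>

lemma edge_of_basic:
  assumes I: "I \<in> first_partition M f" and ab: "basic a b" and sub: "{a..b} \<subseteq> \<Phi> ` base I"
  shows "\<exists>J d. edge I d J \<and> lo J = a + d \<and> hi J = b + d \<and> J = par M ` {a..b}"
proof -
  let ?J = "par M ` {a..b}"
  have J: "?J \<in> first_partition M f" using ab by (auto simp: first_partition_eq)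
  then obtain d where d: "d \<in> deck" "lo ?J = a + d" "hi ?J = b + d"
    using lift_position[OF ab refl] by blast
  have "base ?J = (\<lambda>x. x + d) ` {a..b}" using d by (simp add: base_def)
  also have "\<dots> \<subseteq> (\<lambda>x. x + d) ` \<Phi> ` base I" using sub by (rule image_mono)
  finally have "base ?J \<subseteq> (\<lambda>s. \<Phi> s + d) ` base I" by (simp add: image_image)
  then have "edge I d ?J" using I J d(1) by (simp add: edge_def)
  then show ?thesis using d by blast
qed

lemma base_image:
  assumes I: "I \<in> first_partition M f"
  shows "\<Phi> ` base I = closed_segment (\<Phi> (lo I)) (\<Phi> (hi I))"
proof -
  have lh: "lo I \<in> base I" "hi I \<in> base I" "base I = closed_segment (lo I) (hi I)"
    using lo_less_hi[OF I] by (auto simp: base_def closed_segment_eq_real_ivl)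
  have "{s \<in> base I. \<Phi> s + 0 \<in> closed_segment (\<Phi> (lo I) + 0) (\<Phi> (hi I) + 0)} = base I"
    using branch_preimage[OF I lh(1,2), of 0] lh(3) by simp
  then have "\<Phi> ` base I \<subseteq> closed_segment (\<Phi> (lo I)) (\<Phi> (hi I))" by auto
  moreover have "closed_segment (\<Phi> (lo I)) (\<Phi> (hi I)) \<subseteq> \<Phi> ` base I"
  proof
    fix y assume "y \<in> closed_segment (\<Phi> (lo I)) (\<Phi> (hi I))"
    moreover have "continuous_on (closed_segment (lo I) (hi I)) \<Phi>"
      using continuous_on_subset[OF Phi_continuous base_dom[OF I]] lh(3) by simp
    ultimately show "y \<in> \<Phi> ` base I" using IVT'_closed_segment_real lh(3) by (metis imageI)
  qed
  ultimately show ?thesis by blast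
qed

lemma image_endpoints:
  assumes I: "I \<in> first_partition M f"
  shows "\<Phi> (lo I) \<in> nodes" "\<Phi> (hi I) \<in> nodes" "\<Phi> (lo I) \<noteq> \<Phi> (hi I)"
  using rep(1)[OF I] nodes_Phi branch_inj[OF I, of "lo I" "hi I"] by (auto simp: basic_def base_def)

text \<open>
  The Markov property: the image of an interval of the first partition ends at nodes, because nodes
  are mapped to nodes, and is therefore filled by intervals of the first partition.
\<close>

lemma image_cover:
  assumes I: "I \<in> first_partition M f" and y: "y \<in> \<Phi> ` base I"
  shows "\<exists>J d. edge I d J \<and> y + d \<in> base J"
proof -
  define p where "p = min (\<Phi> (lo I)) (\<Phi> (hi I))"
  define q where "q = max (\<Phi> (lo I)) (\<Phi> (hi I))"
  have pq: "p \<in> nodes" "q \<in> nodes" "p < q" "\<Phi> ` base I = {p..q}"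
    using image_endpoints[OF I] base_image[OF I]
    by (auto simp: p_def q_def closed_segment_eq_real_ivl min_def max_def)
  then obtain a b where ab: "basic a b" "p \<le> a" "b \<le> q" "a \<le> y" "y \<le> b"
    using basic_cover[of p q y] y by auto
  then have "{a..b} \<subseteq> \<Phi> ` base I" using pq by auto
  then obtain J d where "edge I d J" "lo J = a + d" "hi J = b + d"
    using edge_of_basic[OF I ab(1)] by blast
  then show ?thesis using ab by (intro exI[of _ J] exI[of _ d]) (simp add: base_def)
qed

lemma f_image_Union: "I \<in> first_partition M f \<Longrightarrow> f ` I = \<Union> {J. next_to I J}"
proof
  assume I: "I \<in> first_partition M f"
  show "\<Union> {J. next_to I J} \<subseteq> f ` I" using edge_image unfolding next_to_def by blast
  show "f ` I \<subseteq> \<Union> {J. next_to I J}"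
  proof
    fix x assume "x \<in> f ` I"
    then obtain s where s: "s \<in> base I" "x = par M (\<Phi> s)" using f_image[OF I deck_zero] by auto
    then obtain J d where J: "edge I d J" "\<Phi> s + d \<in> base J" using image_cover[OF I] by blast
    have "s \<in> dom1 M" using s base_dom[OF I] by blast
    then have "x = par M (\<Phi> s + d)" using s J par_shift Phi_dom by (simp add: edge_def)
    then have "x \<in> J" using J rep(2)[of J] by (auto simp: edge_def)
    then show "x \<in> \<Union> {J. next_to I J}" using J by (auto simp: next_to_def)
  qed
qed

lemma next_exists: "I \<in> first_partition M f \<Longrightarrow> \<exists>J. next_to I J"
  using image_cover[of I "\<Phi> (lo I)"] lo_less_hi[of I] by (force simp: next_to_def base_def)

lemma next_partition: "next_to I J \<Longrightarrow> I \<in> first_partition M f \<and> J \<in> first_partition M f"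
  unfolding next_to_def edge_def by blast

lemma partition_cover: "\<Union> (first_partition M f) = pts M"
proof
  show "\<Union> (first_partition M f) \<subseteq> pts M"
    using basic_dom par_in_pts by (fastforce simp: first_partition_eq)
  show "pts M \<subseteq> \<Union> (first_partition M f)"
  proof
    fix x assume "x \<in> pts M"
    then obtain t where t: "t \<in> dom1 M" "x = par M t" by (auto simp: pts_def)
    then obtain a b where ab: "basic a b" "a \<le> t" "t \<le> b" using nodes_around basic_cover by meson
    then have "par M ` {a..b} \<in> first_partition M f" unfolding first_partition_eq by blast
    moreover have "x \<in> par M ` {a..b}" using ab t(2) by simp
    ultimately show "x \<in> \<Union> (first_partition M f)" by blast
  qed
qed

text \<open>
  The intervals at the end of a path of \<open>n\<close> edges.  Their union is the \<open>n\<close>-th image of \<open>M\<close>, hence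
  connected; once the sequence is constant, each of them has an infinite past.
\<close>

primrec reached :: "nat \<Rightarrow> 'a set set" where
  "reached 0 = first_partition M f"
| "reached (Suc n) = {J. \<exists>I\<in>reached n. next_to I J}"

lemma reached_decreasing: "reached (Suc n) \<subseteq> reached n"
  by (induction n) (use next_partition in auto)

lemma reached_partition: "reached n \<subseteq> first_partition M f"
  by (cases n) (use next_partition in auto)

lemma reached_image: "f ` \<Union> (reached n) = \<Union> (reached (Suc n))"
proof -
  have "f ` \<Union> (reached n) = (\<Union>I\<in>reached n. f ` I)" by blast
  also have "\<dots> = (\<Union>I\<in>reached n. \<Union> {J. next_to I J})"
    using reached_partition f_image_Union by (metis (no_types, lifting) SUP_cong subsetD)
  also have "\<dots> = \<Union> (reached (Suc n))" by auto
  finally show ?thesis .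
qed

lemma reached_nonempty: "reached n \<noteq> {}"
proof (induction n)
  case 0
  have "pts M \<noteq> {}" using critical_exists by (auto simp: critical_points_def)
  then show ?case using partition_cover by auto
next
  case (Suc n)
  then obtain I where "I \<in> reached n" by blast
  then show ?case using next_exists[of I] reached_partition by auto
qed

lemma reached_sub_pts: "\<Union> (reached n) \<subseteq> pts M"
  using reached_partition partition_cover by blast

lemma reached_connected: "connected (\<Union> (reached n))"
proof (induction n)
  case 0
  show ?case unfolding reached.simps(1) partition_cover by (rule pts_connected)
next
  case (Suc n)
  have "continuous_on (\<Union> (reached n)) f"
    using continuous_on_subset[OF f_continuous reached_sub_pts] .
  from connected_continuous_image[OF this Suc] show ?case unfolding reached_image .
qed

lemma reached_stable: "\<exists>N. reached (Suc N) = reached N"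
proof (rule ccontr)
  assume "\<nexists>N. reached (Suc N) = reached N"
  then have less: "card (reached (Suc n)) < card (reached n)" for n
    using reached_decreasing[of n] reached_partition[of n] finite_first_partition
    by (meson finite_subset psubset_card_mono psubsetI)
  have "card (reached n) + n \<le> card (reached 0)" for n
  proof (induction n)
    case (Suc n)
    then show ?case using less[of n] by simp
  qed simp
  from this[of "Suc (card (reached 0))"] show False by simp
qed

text \<open>
  A full turn of parameters meets every point of a circle, in particular a critical one.
\<close>

lemma par_inj_gap:
  assumes T: "T \<in> components (gaps (critical_points M f))"
  shows "inj_on (par M) T"
proof (rule linorder_inj_onI')
  have Tsub: "T \<subseteq> gaps (critical_points M f)" "is_interval T"
    using T in_components_subset in_components_connected is_interval_connected_1 by blast+
  fix s t assume st: "s \<in> T" "t \<in> T" "s < t"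
  show "par M s \<noteq> par M t"
  proof
    assume "par M s = par M t"
    moreover have dom: "s \<in> dom1 M" "t \<in> dom1 M" using st Tsub by (auto simp: gaps_def)
    ultimately have d: "t - s \<in> deck" using par_eq_iff by blast
    have big: "len M \<le> t - s" using deck_small[OF d] st by force
    have circ: "is_circle M" using d st by (auto simp: deck_def split: if_splits)
    obtain c where c: "c \<in> dom1 M" "par M c \<in> critical_points M f"
      using critical_exists by (auto simp: critical_points_def pts_def)
    obtain e where e: "e \<in> deck" "0 \<le> c - s + e" "c - s + e < len M"
      using circle_reduce[OF circ] by blast
    have "s \<le> c + e" "c + e \<le> t" using e big by auto
    then have "c + e \<in> T" using mem_is_interval_1_I[OF Tsub(2) st(1,2)] by auto
    moreover have "par M (c + e) \<in> critical_points M f" using par_shift[OF c(1) e(1)] c by simp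
    ultimately show False using Tsub by (auto simp: gaps_def)
  qed
qed

text \<open>
  A connected set without critical points lies in a single arc between critical points; if it is
  invariant, then so does its image.  The parametrization is injective on these arcs, and the lift is
  injective over the first one.
\<close>

lemma inj_on_invariant:
  assumes Y: "connected Y" "Y \<subseteq> pts M" "f ` Y \<subseteq> Y" "Y \<inter> critical_points M f = {}"
  shows "inj_on f Y"
proof (cases "Y = {}")
  case False
  let ?G = "gaps (critical_points M f)"
  have "Y \<subseteq> pts M - critical_points M f" using Y by blast
  then obtain C where C: "C \<in> components (pts M - critical_points M f)" "Y \<subseteq> C"
    using exists_component_superset[of Y "pts M - critical_points M f"] Y(1) False by blast
  then obtain T where T: "T \<in> components ?G" "C = par M ` T"
    using components_pts[OF critical_finite] by blast
  have Tsub: "T \<subseteq> dom1 M" using in_components_subset[OF T(1)] by (auto simp: gaps_def)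
  have "\<exists>g. homeomorphism T C (par M) g"
  proof (rule homeomorphism_injective_open_map[of T "par M" C])
    show "continuous_on T (par M)" using par_continuous Tsub continuous_on_subset by blast
    show "par M ` T = C" using T by simp
    show "inj_on (par M) T" using par_inj_gap[OF T(1)] .
    show "openin (top_of_set C) (par M ` U)" if "openin (top_of_set T) U" for U
      using par_open_map_subset[OF gap_component_open[OF critical_finite T(1)] that] T(2) by simp
  qed blast
  then obtain g where g: "homeomorphism T C (par M) g" by blast
  define Z where "Z = g ` Y"
  have gC: "g ` C = T" "continuous_on C g" "\<And>y. y \<in> C \<Longrightarrow> par M (g y) = y"
    using g by (simp_all add: homeomorphism_def)
  have ZT: "Z \<subseteq> T" using gC(1) C(2) by (auto simp: Z_def)
  have "par M ` Z = (\<lambda>y. y) ` Y"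
    unfolding Z_def image_image using gC(3) C(2) by (intro image_cong) auto
  then have parZ: "par M ` Z = Y" by simp
  have "connected Z"
    unfolding Z_def by (intro connected_continuous_image continuous_on_subset[OF gC(2)] C(2) Y(1))
  then have conPhi: "connected (\<Phi> ` Z)"
    using ZT Tsub by (intro connected_continuous_image continuous_on_subset[OF Phi_continuous]) auto
  have subPhi: "\<Phi> ` Z \<subseteq> ?G"
  proof
    fix y assume "y \<in> \<Phi> ` Z"
    then obtain s where s: "s \<in> Z" "y = \<Phi> s" by blast
    then have sd: "s \<in> dom1 M" using ZT Tsub by blast
    have "f (par M s) \<in> Y" using s(1) parZ Y(3) by blast
    then have "par M y \<in> Y" using s(2) sd f_par by simp
    then show "y \<in> ?G" using s Phi_dom[OF sd] Y(4) by (auto simp: gaps_def)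
  qed
  have "\<Phi> ` Z \<noteq> {}" using parZ False by auto
  then obtain T' where T': "T' \<in> components ?G" "\<Phi> ` Z \<subseteq> T'"
    using exists_component_superset[OF subPhi _ conPhi] subPhi by blast
  have inj: "inj_on \<Phi> T"
  proof (rule Phi_inj_on)
    show "is_interval T" using T(1) in_components_connected is_interval_connected_1 by blast
    show "D s \<noteq> 0" if "s \<in> T" for s
      using that in_components_subset[OF T(1)] critical_iff by (auto simp: gaps_def)
  qed (rule Tsub)
  show ?thesis
  proof (rule inj_onI)
    fix x y assume xy: "x \<in> Y" "y \<in> Y" "f x = f y"
    then obtain s t where st: "s \<in> Z" "t \<in> Z" "x = par M s" "y = par M t" using parZ by blast
    then have "s \<in> dom1 M" "t \<in> dom1 M" using ZT Tsub by blast+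
    then have "par M (\<Phi> s) = par M (\<Phi> t)" using xy st f_par by simp
    then have "\<Phi> s = \<Phi> t" using inj_onD[OF par_inj_gap[OF T'(1)]] T'(2) st by blast
    then have "s = t" using inj_onD[OF inj] ZT st by blast
    then show "x = y" using st by simp
  qed
qed simp

lemma partition_arc_length: "I \<in> first_partition M f \<Longrightarrow> arc_length M I = hi I - lo I"
  using arc_length_Icc[of "lo I" "hi I" I] base_dom[of I] lo_less_hi[of I] rep[of I]
    basic_length[of "lo I" "hi I"] by (simp add: base_def)

lemma partition_overlap:
  assumes IJ: "I \<in> first_partition M f" "J \<in> first_partition M f" and inf: "infinite (I \<inter> J)"
  shows "I = J"
proof (rule ccontr)
  assume ne: "I \<noteq> J"
  have "I \<inter> J \<subseteq> {par M (lo I), par M (hi I)}"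
  proof
    fix x assume "x \<in> I \<inter> J"
    then obtain s t where st: "s \<in> base I" "t \<in> base J" "x = par M s" "x = par M t"
      using rep(2) IJ by blast
    show "x \<in> {par M (lo I), par M (hi I)}"
    proof (rule ccontr)
      assume "x \<notin> {par M (lo I), par M (hi I)}"
      then have "lo I < s" "s < hi I" using st by (auto simp: base_def less_le)
      then obtain d where d: "d \<in> deck" "lo J = lo I + d" "hi J = hi I + d"
        using basic_image_unique[OF rep(1)[OF IJ(1)] rep(1)[OF IJ(2)], of s t] st
        by (auto simp: base_def)
      have "J = par M ` ((\<lambda>x. x + d) ` base I)" using d rep(2)[OF IJ(2)] by (simp add: base_def)
      also have "\<dots> = par M ` base I"
        unfolding image_image using par_shift d(1) base_dom[OF IJ(1)] by (intro image_cong) auto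
      finally show False using ne rep(2)[OF IJ(1)] by simp
    qed
  qed
  then show False using inf finite_subset by blast
qed

lemma partition_infinite: "I \<in> first_partition M f \<Longrightarrow> infinite I"
proof
  assume I: "I \<in> first_partition M f" and "finite I"
  then have "finite {t \<in> dom1 M. lo I \<le> t \<and> t \<le> hi I \<and> par M t \<in> I}"
    by (intro finite_vimage_bounded)
  moreover have "base I \<subseteq> {t \<in> dom1 M. lo I \<le> t \<and> t \<le> hi I \<and> par M t \<in> I}"
    using base_dom[OF I] rep(2)[OF I] by (auto simp: base_def)
  ultimately have "finite {lo I..hi I}" unfolding base_def by (rule rev_finite_subset)
  then show False using lo_less_hi[OF I] by (simp add: infinite_Icc)
qed

text \<open>
  Without a critical point in the eventual image, the map would be a bijection of it that permutes the
  intervals of the first partition inside it, and these would have words of every length for which the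
  interval does not shrink.
\<close>

lemma eventual_image_critical:
  assumes stable: "reached (Suc N) = reached N"
  shows "\<Union> (reached N) \<inter> critical_points M f \<noteq> {}"
proof
  assume none: "\<Union> (reached N) \<inter> critical_points M f = {}"
  let ?R = "reached N" and ?Y = "\<Union> (reached N)"
  have fp: "I \<in> first_partition M f" if "I \<in> ?R" for I using that reached_partition by blast
  have inv: "f ` ?Y = ?Y" using reached_image[of N] stable by simp
  have inj: "inj_on f ?Y"
    using inj_on_invariant reached_connected reached_sub_pts inv none by simp
  have succ: "J \<in> ?R" if "I \<in> ?R" "next_to I J" for I J
  proof -
    have "J \<in> reached (Suc N)" using that by auto
    then show ?thesis unfolding stable .
  qed
  have unique: "I = I'" if I: "I \<in> ?R" "I' \<in> ?R" "next_to I J" "next_to I' J" for I I' J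
  proof -
    have J: "J \<subseteq> f ` I" "J \<subseteq> f ` I'" "J \<in> first_partition M f"
      using I edge_image next_partition unfolding next_to_def by blast+
    have "J \<subseteq> f ` (I \<inter> I')"
    proof
      fix y assume "y \<in> J"
      then obtain x x' where "x \<in> I" "x' \<in> I'" "y = f x" "y = f x'" using J by blast
      moreover have "x = x'" using inj_onD[OF inj, of x x'] I calculation by auto
      ultimately show "y \<in> f ` (I \<inter> I')" by blast
    qed
    then have "infinite (f ` (I \<inter> I'))" using partition_infinite[OF J(3)] finite_subset by blast
    then show ?thesis using partition_overlap[OF fp fp] I by blast
  qed
  define nx where "nx I = (SOME J. next_to I J)" for I
  have nx: "next_to I (nx I)" if "I \<in> ?R" for I
    unfolding nx_def using next_exists[OF fp[OF that]] by (rule someI_ex)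
  have "inj_on nx ?R"
  proof (rule inj_onI)
    fix I I' assume "I \<in> ?R" "I' \<in> ?R" "nx I = nx I'"
    then show "I = I'" using unique[of I I' "nx I"] nx by metis
  qed
  moreover have "nx ` ?R \<subseteq> ?R" using nx succ by blast
  moreover have "finite ?R" using reached_partition finite_first_partition finite_subset by blast
  ultimately have surj: "nx ` ?R = ?R" using endo_inj_surj by blast
  have only: "J = nx I" if I: "I \<in> ?R" "next_to I J" for I J
  proof -
    have "J \<in> nx ` ?R" using succ[OF I] surj by simp
    then obtain I' where I': "I' \<in> ?R" "J = nx I'" by blast
    then have "I = I'" using unique[OF I(1) I'(1) I(2)] nx[OF I'(1)] by simp
    then show ?thesis using I' by simp
  qed
  have img: "f ` I = nx I" if "I \<in> ?R" for I
  proof -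
    have "{J. next_to I J} = {nx I}" using only[OF that] nx[OF that] by blast
    then show ?thesis using f_image_Union[OF fp[OF that]] by simp
  qed
  have pull: "branch_inverse f I ` f ` I = I" if "I \<in> ?R" for I
  proof -
    have "inj_on f I" using inj that by (meson Union_upper inj_on_subset)
    then show ?thesis by (auto simp: branch_inverse_def image_iff)
  qed
  have word: "\<exists>w. suitable M f w \<and> length w = Suc n \<and> ivl (hd w) = I \<and> word_interval f w = I"
    if "I \<in> ?R" for I n
    using that
  proof (induction n arbitrary: I)
    case 0
    then show ?case
      using suitable_single[OF fp] pull
      by (intro exI[of _ "[symbol_of M f I]"]) (simp add: word_interval_single)
  next
    case (Suc n)
    then have "nx I \<in> ?R" using succ nx by blast
    then obtain w where w: "suitable M f w" "length w = Suc n" "ivl (hd w) = nx I" "word_interval f w = nx I"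
      using Suc.IH by blast
    have "suitable M f (symbol_of M f I # w)"
      using suitable_Cons[OF w(1) fp] Suc.prems w(3) img by simp
    moreover have "word_interval f (symbol_of M f I # w) = I"
      using w(2,4) word_interval_Cons[of w "symbol_of M f I"] img[OF Suc.prems] pull[OF Suc.prems]
      by (cases w) simp_all
    ultimately show ?case using w(2) by (intro exI[of _ "symbol_of M f I # w"]) simp
  qed
  obtain I where I: "I \<in> ?R" using reached_nonempty by blast
  have "arc_length M I \<le> K * \<mu> ^ Suc n" for n
    using word[OF I, of n] word_length_decay by metis
  moreover have "(\<lambda>n. K * \<mu> ^ Suc n) \<longlonglongrightarrow> 0"
    by (rule LIMSEQ_Suc[OF geometric_null[OF mu_pos mu_less_1]])
  ultimately have "arc_length M I \<le> 0" by (intro LIMSEQ_le_const) auto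
  then show False using partition_arc_length lo_less_hi fp[OF I] by fastforce
qed

end

section \<open>Scale ratios along an orbit\<close>

lemma geometric_cauchy:
  fixes x :: "nat \<Rightarrow> real"
  assumes r: "0 < r" "r < 1" and step: "\<And>m. \<bar>x (Suc m) - x m\<bar> \<le> B * r ^ m"
  shows "\<exists>X. x \<longlonglongrightarrow> X \<and> \<bar>x 0 - X\<bar> \<le> B / (1 - r)"
proof -
  have geo: "(\<lambda>m. B * r ^ m) sums (B * (1 / (1 - r)))"
    using r by (intro sums_mult geometric_sums) auto
  then have sumg: "summable (\<lambda>m. B * r ^ m)" by (rule sums_summable)
  have suma: "summable (\<lambda>m. \<bar>x (Suc m) - x m\<bar>)"
    by (rule summable_comparison_test'[OF sumg, of 0]) (use step in auto)
  then have sumd: "summable (\<lambda>m. x (Suc m) - x m)" by (rule summable_rabs_cancel)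
  define S where "S = (\<Sum>m. x (Suc m) - x m)"
  have "(\<lambda>n. \<Sum>m<n. x (Suc m) - x m) \<longlonglongrightarrow> S"
    unfolding S_def using sumd by (rule summable_LIMSEQ)
  then have "(\<lambda>n. x n - x 0) \<longlonglongrightarrow> S" by (simp add: sum_lessThan_telescope)
  then have "(\<lambda>n. (x n - x 0) + x 0) \<longlonglongrightarrow> S + x 0" by (intro tendsto_intros)
  then have "x \<longlonglongrightarrow> S + x 0" by simp
  moreover have "\<bar>S\<bar> \<le> B / (1 - r)"
  proof -
    have "\<bar>S\<bar> \<le> (\<Sum>m. \<bar>x (Suc m) - x m\<bar>)" unfolding S_def using suma by (rule summable_rabs)
    also have "\<dots> \<le> (\<Sum>m. B * r ^ m)" using step suma sumg by (intro suminf_le) auto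
    also have "\<dots> = B / (1 - r)" using sums_unique[OF geo] by simp
    finally show ?thesis .
  qed
  ultimately show ?thesis by (intro exI[of _ "S + x 0"]) auto
qed

context geometrically_finite_map
begin

text \<open>
  Noncritical points fit in with exponent one.  At a critical point this exponent is impossible,
  because the derivative is continuous and vanishes there.
\<close>

lemma derivative_power_law:
  assumes t: "t \<in> dom1 M" and \<sigma>: "\<sigma> \<in> {1, -1}" and u0: "u0 > 0"
    and dom: "\<And>u. 0 \<le> u \<Longrightarrow> u \<le> u0 \<Longrightarrow> t + \<sigma> * u \<in> dom1 M"
  shows "\<exists>\<gamma> A. \<gamma> \<ge> 1 \<and> (D t = 0 \<longrightarrow> \<gamma> > 1) \<and> A \<noteq> 0 \<and>
    ((\<lambda>u. D (t + \<sigma> * u) / u powr (\<gamma> - 1)) \<longlongrightarrow> A) (at_right 0)"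
proof -
  have "continuous_on {0..u0} (\<lambda>u. D (t + \<sigma> * u))"
    by (rule continuous_on_compose2[OF D_continuous]) (auto intro!: continuous_intros dom)
  from this[unfolded continuous_on_def, rule_format, of 0]
  have "((\<lambda>u. D (t + \<sigma> * u)) \<longlongrightarrow> D (t + \<sigma> * 0)) (at 0 within {0..u0})"
    using u0 by simp
  then have lim: "((\<lambda>u. D (t + \<sigma> * u)) \<longlongrightarrow> D t) (at_right 0)"
    using at_within_Icc_at_right[OF u0] by simp
  have pos: "\<forall>\<^sub>F u in at_right 0. 0 < u \<and> u < (u0::real)"
    using eventually_at_right_real[OF u0] by eventually_elim auto
  have powr0: "\<forall>\<^sub>F u in at_right (0::real). D (t + \<sigma> * u) / u powr (1 - 1) = D (t + \<sigma> * u)"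
    using pos by eventually_elim simp
  show ?thesis
  proof (cases "D t = 0")
    case False
    have "((\<lambda>u. D (t + \<sigma> * u) / u powr (1 - 1)) \<longlongrightarrow> D t) (at_right 0)"
      unfolding tendsto_cong[OF powr0] by (rule lim)
    then show ?thesis using False by (intro exI[of _ 1] exI[of _ "D t"]) simp
  next
    case True
    then have "par M t \<in> critical_points M f" using critical_iff t by blast
    from C1_alpha[unfolded C1_alpha_def, THEN conjunct2, THEN conjunct2, THEN conjunct2,
        THEN conjunct2, rule_format, OF this]
    obtain \<gamma> where "power_law_critical M f \<gamma> (par M t)" by (elim exE conjE)
    then obtain t' A' B' where t': "t' \<in> dom1 M" "par M t' = par M t" and g: "\<gamma> \<ge> 1"
      and A': "A' \<noteq> 0" "(power_quotient M f \<gamma> t' \<longlongrightarrow> A') (at t' within {s \<in> dom1 M. s > t'})"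
      and B': "B' \<noteq> 0" "(power_quotient M f \<gamma> t' \<longlongrightarrow> B') (at t' within {s \<in> dom1 M. s < t'})"
      unfolding power_law_critical_def by blast
    define d where "d = t' - t"
    have d: "d \<in> deck" "t' = t + d" using par_eq_iff[OF t t'(1)] t'(2) by (auto simp: d_def)
    define W where "W = (if \<sigma> = 1 then {s \<in> dom1 M. s > t'} else {s \<in> dom1 M. s < t'})"
    define A where "A = (if \<sigma> = 1 then A' else B')"
    have A: "A \<noteq> 0" "(power_quotient M f \<gamma> t' \<longlongrightarrow> A) (at t' within W)"
      using A' B' by (auto simp: A_def W_def)
    have shift: "t' + \<sigma> * u = t + \<sigma> * u + d" for u using d by simp
    have "filterlim (\<lambda>u. t' + \<sigma> * u) (at t' within W) (at_right 0)"
      unfolding filterlim_at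
    proof
      have "((\<lambda>u. t' + \<sigma> * u) \<longlongrightarrow> t' + \<sigma> * 0) (at_right 0)" by (intro tendsto_intros)
      then show "((\<lambda>u. t' + \<sigma> * u) \<longlongrightarrow> t') (at_right 0)" by simp
      show "\<forall>\<^sub>F u in at_right 0. t' + \<sigma> * u \<in> W \<and> t' + \<sigma> * u \<noteq> t'"
        using pos
      proof eventually_elim
        case (elim u)
        have "t' + \<sigma> * u \<in> dom1 M" unfolding shift by (rule dom1_shift[OF dom d(1)]) (use elim in auto)
        then show ?case using elim \<sigma> by (auto simp: W_def)
      qed
    qed
    from filterlim_compose[OF A(2) this]
    have "((\<lambda>u. power_quotient M f \<gamma> t' (t' + \<sigma> * u)) \<longlongrightarrow> A) (at_right 0)" .
    moreover have "\<forall>\<^sub>F u in at_right 0. power_quotient M f \<gamma> t' (t' + \<sigma> * u) = D (t + \<sigma> * u) / u powr (\<gamma> - 1)"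
      using pos
    proof eventually_elim
      case (elim u)
      have "D (t' + \<sigma> * u) = D (t + \<sigma> * u)"
        unfolding shift by (rule D_shift[OF dom d(1)]) (use elim in auto)
      moreover have "\<bar>t' + \<sigma> * u - t'\<bar> = u" using \<sigma> elim by auto
      ultimately show ?case by (simp add: power_quotient_def D_def)
    qed
    ultimately have L: "((\<lambda>u. D (t + \<sigma> * u) / u powr (\<gamma> - 1)) \<longlongrightarrow> A) (at_right 0)"
      by (rule Lim_transform_eventually)
    have "\<gamma> \<noteq> 1"
    proof
      assume "\<gamma> = 1"
      then have "((\<lambda>u. D (t + \<sigma> * u) / u powr (1 - 1)) \<longlongrightarrow> A) (at_right 0)" using L by simp
      then have "((\<lambda>u. D (t + \<sigma> * u)) \<longlongrightarrow> A) (at_right 0)" unfolding tendsto_cong[OF powr0] .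
      from tendsto_unique[OF _ this lim] show False using A(1) True by simp
    qed
    then show ?thesis using g A(1) L by (intro exI[of _ \<gamma>] exI[of _ A]) simp
  qed
qed

text \<open>
  The derivative is asymptotic to a power of the distance; l'Hospital's rule integrates this.
\<close>

lemma displacement_power_law:
  assumes t: "t \<in> dom1 M" and \<sigma>: "\<sigma> \<in> {1, -1}" and u0: "u0 > 0"
    and dom: "\<And>u. 0 \<le> u \<Longrightarrow> u \<le> u0 \<Longrightarrow> t + \<sigma> * u \<in> dom1 M"
  shows "\<exists>\<gamma> L. \<gamma> \<ge> 1 \<and> (D t = 0 \<longrightarrow> \<gamma> > 1) \<and>
    ((\<lambda>u. ln \<bar>\<Phi> (t + \<sigma> * u) - \<Phi> t\<bar> - \<gamma> * ln u) \<longlongrightarrow> L) (at_right 0)"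
proof -
  obtain \<gamma> A where g: "\<gamma> \<ge> 1" "D t = 0 \<longrightarrow> \<gamma> > 1" "A \<noteq> 0"
    and lim: "((\<lambda>u. D (t + \<sigma> * u) / u powr (\<gamma> - 1)) \<longlongrightarrow> A) (at_right 0)"
    using derivative_power_law[OF assms] by blast
  define h where "h u = \<Phi> (t + \<sigma> * u) - \<Phi> t" for u
  have pos: "\<forall>\<^sub>F u in at_right 0. 0 < u \<and> u < (u0::real)"
    using eventually_at_right_real[OF u0] by eventually_elim auto
  have "continuous_on {0..u0} h"
    unfolding h_def
    by (intro continuous_intros continuous_on_compose2[OF Phi_continuous]) (auto intro!: dom)
  from this[unfolded continuous_on_def, rule_format, of 0]
  have "(h \<longlongrightarrow> h 0) (at 0 within {0..u0})" using u0 by simp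
  then have h0: "(h \<longlongrightarrow> 0) (at_right 0)"
    using at_within_Icc_at_right[OF u0] by (simp add: h_def)
  have "\<forall>\<^sub>F u in at_right (0::real). 0 \<le> u" using pos by eventually_elim simp
  then have "((\<lambda>u. u powr \<gamma>) \<longlongrightarrow> 0 powr \<gamma>) (at_right (0::real))"
    using g(1) by (intro tendsto_powr2 tendsto_intros) auto
  then have g0: "((\<lambda>u. u powr \<gamma>) \<longlongrightarrow> 0) (at_right (0::real))" by simp
  have dh: "\<forall>\<^sub>F u in at_right 0. (h has_real_derivative \<sigma> * D (t + \<sigma> * u)) (at u)"
    using pos
  proof eventually_elim
    case (elim u)
    define x where "x = t + \<sigma> * u"
    define a where "a = min t (t + \<sigma> * u0)"
    define b where "b = max t (t + \<sigma> * u0)"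
    have ab: "a \<in> dom1 M" "b \<in> dom1 M" using t dom[of u0] u0 by (auto simp: a_def b_def min_def max_def)
    have x: "x \<in> {a<..<b}" using \<sigma> elim by (auto simp: x_def a_def b_def)
    have sub: "{a<..<b} \<subseteq> dom1 M" using dom1_Icc[OF ab] by auto
    have "(\<Phi> has_real_derivative D x) (at x within {a<..<b})"
      unfolding D_def using Phi_deriv[of x] x sub DERIV_subset by blast
    then have "(\<Phi> has_real_derivative D x) (at x)"
      using x at_within_open[of x "{a<..<b}"] by simp
    then have "((\<lambda>u. \<Phi> (t + \<sigma> * u)) has_real_derivative D x * \<sigma>) (at u)"
      unfolding x_def by (rule DERIV_chain2) (auto intro!: derivative_eq_intros)
    then have "((\<lambda>u. \<Phi> (t + \<sigma> * u) - \<Phi> t) has_real_derivative D x * \<sigma> - 0) (at u)"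
      by (intro DERIV_diff DERIV_const)
    then show ?case by (simp add: h_def[abs_def] x_def mult.commute)
  qed
  have dg: "\<forall>\<^sub>F u in at_right (0::real). ((\<lambda>u. u powr \<gamma>) has_real_derivative \<gamma> * u powr (\<gamma> - 1)) (at u)"
    using pos by eventually_elim (rule has_real_derivative_powr, simp)
  have "((\<lambda>u. (\<sigma> / \<gamma>) * (D (t + \<sigma> * u) / u powr (\<gamma> - 1))) \<longlongrightarrow> (\<sigma> / \<gamma>) * A) (at_right 0)"
    by (intro tendsto_intros lim)
  then have quot: "((\<lambda>u. (\<sigma> * D (t + \<sigma> * u)) / (\<gamma> * u powr (\<gamma> - 1))) \<longlongrightarrow> \<sigma> / \<gamma> * A) (at_right 0)"
    by simp
  have nz: "\<forall>\<^sub>F u in at_right (0::real). u powr \<gamma> \<noteq> 0"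
    "\<forall>\<^sub>F u in at_right (0::real). \<gamma> * u powr (\<gamma> - 1) \<noteq> 0"
    using pos g(1) by (auto elim!: eventually_mono)
  from lhopital_right_0[OF h0 g0 nz dh dg quot]
  have hq: "((\<lambda>u. h u / u powr \<gamma>) \<longlongrightarrow> \<sigma> / \<gamma> * A) (at_right 0)" .
  have L0: "\<sigma> / \<gamma> * A \<noteq> 0" using \<sigma> g by auto
  have "((\<lambda>u. ln \<bar>h u / u powr \<gamma>\<bar>) \<longlongrightarrow> ln \<bar>\<sigma> / \<gamma> * A\<bar>) (at_right 0)"
    using L0 by (intro tendsto_intros hq) auto
  moreover have "\<forall>\<^sub>F u in at_right 0. ln \<bar>h u / u powr \<gamma>\<bar> = ln \<bar>\<Phi> (t + \<sigma> * u) - \<Phi> t\<bar> - \<gamma> * ln u"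
    using pos tendsto_imp_eventually_ne[OF hq L0]
  proof eventually_elim
    case (elim u)
    then have "\<bar>h u\<bar> > 0" by auto
    then have "ln (\<bar>h u\<bar> / u powr \<gamma>) = ln \<bar>h u\<bar> - ln (u powr \<gamma>)" using elim by (intro ln_divide_pos) auto
    then show ?case using elim by (simp add: h_def abs_divide ln_powr)
  qed
  ultimately have "((\<lambda>u. ln \<bar>\<Phi> (t + \<sigma> * u) - \<Phi> t\<bar> - \<gamma> * ln u) \<longlongrightarrow> ln \<bar>\<sigma> / \<gamma> * A\<bar>) (at_right 0)"
    by (rule Lim_transform_eventually)
  then show ?thesis using g by blast
qed

definition ell :: "(int \<Rightarrow> 'a set) \<Rightarrow> (int \<Rightarrow> real) \<Rightarrow> int \<Rightarrow> int \<Rightarrow> real" where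
  "ell e d i k = measure lborel (pullback e d (nat (k - i)) i)"

text \<open>
  The logarithm of the absolute value of the scale at the word \<open>e i, ..., e (k + 1)\<close>.
\<close>

definition log_ratio :: "(int \<Rightarrow> 'a set) \<Rightarrow> (int \<Rightarrow> real) \<Rightarrow> int \<Rightarrow> int \<Rightarrow> real" where
  "log_ratio e d i k = ln (ell e d i (k + 1)) - ln (ell e d i k)"

definition endpoint :: "(int \<Rightarrow> 'a set) \<Rightarrow> (int \<Rightarrow> real) \<Rightarrow> int \<Rightarrow> bool" where
  "endpoint e t k \<longleftrightarrow> t k \<in> {lo (e k), hi (e k)}"

lemma ell_pos:
  assumes "chain e d"
  shows "ell e d i k > 0"
proof -
  obtain p q where "p \<noteq> q" "pullback e d (nat (k - i)) i = closed_segment p q"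
    using pullback_segment[OF assms] by blast
  then show ?thesis by (simp add: ell_def measure_segment)
qed

lemma ell_decay:
  assumes "chain e d"
  shows "ell e d i k \<le> K * \<mu> ^ nat (k - i)"
proof -
  have "ell e d i k \<le> K * \<mu> ^ Suc (nat (k - i))"
    unfolding ell_def by (rule pullback_decay[OF assms])
  also have "\<dots> \<le> K * \<mu> ^ nat (k - i)"
    using K_pos mu_pos mu_less_1 by (intro mult_left_mono power_decreasing) auto
  finally show ?thesis .
qed

text \<open>
  If the orbit reaches an endpoint at time \<open>k\<close>, then the intervals of the words ending at time \<open>k\<close> are
  one-sided neighbourhoods of the points of the orbit, and their lengths are carried to each other by
  the displacement of the lift.
\<close>

lemma ell_step:
  assumes c: "chain e d" and o: "orbit e d t" and k: "endpoint e t k" "k \<ge> i + 1"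
  shows "\<exists>z. z \<noteq> t i \<and> pullback e d (nat (k - i)) i = closed_segment (t i) z \<and>
    ell e d i k = \<bar>z - t i\<bar> \<and> ell e d (i + 1) k = \<bar>\<Phi> z - \<Phi> (t i)\<bar>"
proof -
  define n where "n = nat (k - (i + 1))"
  have n: "nat (k - i) = Suc n" "i + 1 + int n = k" using k(2) by (auto simp: n_def)
  have ti: "t i \<in> base (e i)" "\<Phi> (t i) + d i = t (i + 1)" using o by (auto simp: orbit_def)
  obtain w where w: "w \<noteq> t (i + 1)" "pullback e d n (i + 1) = closed_segment (t (i + 1)) w"
    using pullback_touch[OF c o, of "i + 1" n] k(1) n(2) by (auto simp: endpoint_def)
  obtain z where z: "z \<noteq> t i" "\<Phi> z + d i = w" "pullback e d (Suc n) i = closed_segment (t i) z"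
    using pullback_step[OF c ti(1), of n w] w ti(2) by auto
  have "ell e d (i + 1) k = \<bar>w - t (i + 1)\<bar>"
    unfolding ell_def n_def[symmetric] w(2) by (rule measure_segment)
  also have "\<dots> = \<bar>\<Phi> z - \<Phi> (t i)\<bar>" using z(2) ti(2) by auto
  finally have "ell e d (i + 1) k = \<bar>\<Phi> z - \<Phi> (t i)\<bar>" .
  moreover have "ell e d i k = \<bar>z - t i\<bar>" unfolding ell_def n(1) z(3) by (rule measure_segment)
  ultimately show ?thesis using z n(1) by auto
qed

lemma ell_tendsto_0:
  assumes "chain e d"
  shows "(\<lambda>n. ell e d i (int n)) \<longlonglongrightarrow> 0"
proof (rule tendsto_sandwich[of "\<lambda>_. 0"])
  show "\<forall>\<^sub>F n in sequentially. 0 \<le> ell e d i (int n)"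
    using ell_pos[OF assms] by (simp add: less_imp_le)
  show "\<forall>\<^sub>F n in sequentially. ell e d i (int n) \<le> K * \<mu> ^ nat (int n - i)"
    using ell_decay[OF assms] by simp
  show "(\<lambda>n. K * \<mu> ^ nat (int n - i)) \<longlonglongrightarrow> 0"
    by (rule geometric_null_shift[OF mu_pos mu_less_1])
qed simp

text \<open>
  The two intervals in a scale are neighbourhoods of \<open>t i\<close> on one and the same side, and they shrink
  to this point as the words get longer.  There the displacement is asymptotic to a power of the
  distance, so that its exponent multiplies the logarithm of the scale in the limit.
\<close>

lemma log_ratio_step:
  assumes c: "chain e d" and o: "orbit e d t" and ep: "\<And>k. k \<ge> 0 \<Longrightarrow> endpoint e t k"
  shows "\<exists>\<gamma>\<ge>1. (D (t i) = 0 \<longrightarrow> \<gamma> > 1) \<and>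
    (\<lambda>n. log_ratio e d (i + 1) (int n) - \<gamma> * log_ratio e d i (int n)) \<longlonglongrightarrow> 0"
proof -
  define n0 where "n0 = nat (max 0 (i + 1))"
  define P where "P n z \<longleftrightarrow> z \<noteq> t i \<and> pullback e d (nat (int n - i)) i = closed_segment (t i) z \<and>
    ell e d i (int n) = \<bar>z - t i\<bar> \<and> ell e d (i + 1) (int n) = \<bar>\<Phi> z - \<Phi> (t i)\<bar>" for n z
  have "\<exists>z. P n z" if "n \<ge> n0" for n
    unfolding P_def by (rule ell_step[OF c o]) (use ep that in \<open>auto simp: n0_def\<close>)
  then obtain z where z: "\<And>n. n \<ge> n0 \<Longrightarrow> P n (z n)" by metis
  define \<sigma> where "\<sigma> = (if z n0 > t i then 1 else - 1 :: real)"
  have \<sigma>: "\<sigma> \<in> {1, -1}" by (simp add: \<sigma>_def)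
  define u0 where "u0 = ell e d i (int n0)"
  have u0: "u0 > 0" using ell_pos[OF c] by (simp add: u0_def)
  have z0: "z n0 \<noteq> t i" "pullback e d (nat (int n0 - i)) i = closed_segment (t i) (z n0)"
    "u0 = \<bar>z n0 - t i\<bar>" using z[of n0] by (auto simp: P_def u0_def)
  have ti: "t i \<in> dom1 M" using o base_dom[OF chain_partition[OF c]] by (auto simp: orbit_def)
  have dom: "t i + \<sigma> * u \<in> dom1 M" if "0 \<le> u" "u \<le> u0" for u
  proof -
    have "t i + \<sigma> * u \<in> closed_segment (t i) (z n0)"
      using that z0(3) by (auto simp: closed_segment_eq_real_ivl \<sigma>_def)
    then show ?thesis using pullback_dom[OF c] z0(2) by blast
  qed
  obtain \<gamma> L where g: "\<gamma> \<ge> 1" "D (t i) = 0 \<longrightarrow> \<gamma> > 1"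
    and L: "((\<lambda>u. ln \<bar>\<Phi> (t i + \<sigma> * u) - \<Phi> (t i)\<bar> - \<gamma> * ln u) \<longlongrightarrow> L) (at_right 0)"
    using displacement_power_law[OF ti \<sigma> u0 dom] by blast
  have zn: "z n = t i + \<sigma> * ell e d i (int n)" if n: "n \<ge> n0" for n
  proof -
    have "z n \<in> pullback e d (nat (int n - i)) i" using z[OF n] by (simp add: P_def)
    moreover have "nat (int n0 - i) \<le> nat (int n - i)" using n by simp
    ultimately have "z n \<in> closed_segment (t i) (z n0)"
      using pullback_antimono z0(2) by blast
    moreover have "ell e d i (int n) = \<bar>z n - t i\<bar>" using z[OF n] by (simp add: P_def)
    ultimately show ?thesis using z0(1) by (auto simp: closed_segment_eq_real_ivl \<sigma>_def split: if_splits)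
  qed
  have "filterlim (\<lambda>n. ell e d i (int n)) (at_right 0) sequentially"
    unfolding filterlim_at using ell_tendsto_0[OF c] ell_pos[OF c]
    by (auto intro!: always_eventually simp: less_imp_neq[symmetric])
  from filterlim_compose[OF L this]
  have lim: "(\<lambda>n. ln \<bar>\<Phi> (t i + \<sigma> * ell e d i (int n)) - \<Phi> (t i)\<bar> - \<gamma> * ln (ell e d i (int n))) \<longlonglongrightarrow> L" .
  define a where "a n = ln (ell e d (i + 1) (int n)) - \<gamma> * ln (ell e d i (int n))" for n
  have "\<forall>\<^sub>F n in sequentially. ln \<bar>\<Phi> (t i + \<sigma> * ell e d i (int n)) - \<Phi> (t i)\<bar> -
      \<gamma> * ln (ell e d i (int n)) = a n"
    using eventually_ge_at_top[of n0]
  proof eventually_elim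
    case (elim n)
    then show ?case using z[OF elim] zn[OF elim] by (simp add: P_def a_def)
  qed
  with lim have a: "a \<longlonglongrightarrow> L" by (rule Lim_transform_eventually)
  then have "(\<lambda>n. a (Suc n) - a n) \<longlonglongrightarrow> L - L" by (intro tendsto_diff LIMSEQ_Suc)
  moreover have "a (Suc n) - a n = log_ratio e d (i + 1) (int n) - \<gamma> * log_ratio e d i (int n)" for n
    by (simp add: a_def log_ratio_def algebra_simps)
  ultimately show ?thesis using g by (intro exI[of _ \<gamma>]) simp
qed

lemma log_ratio_steps:
  assumes c: "chain e d" and o: "orbit e d t" and ep: "\<And>k. k \<ge> 0 \<Longrightarrow> endpoint e t k"
  shows "\<exists>\<Gamma>\<ge>1. ((\<exists>m<n. D (t (i + int m)) = 0) \<longrightarrow> \<Gamma> > 1) \<and>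
    (\<lambda>k. log_ratio e d (i + int n) (int k) - \<Gamma> * log_ratio e d i (int k)) \<longlonglongrightarrow> 0"
proof (induction n)
  case 0
  show ?case by (intro exI[of _ 1]) simp
next
  case (Suc n)
  then obtain G where G: "G \<ge> 1" "(\<exists>m<n. D (t (i + int m)) = 0) \<longrightarrow> G > 1"
    "(\<lambda>k. log_ratio e d (i + int n) (int k) - G * log_ratio e d i (int k)) \<longlonglongrightarrow> 0" by blast
  obtain g where g: "g \<ge> 1" "D (t (i + int n)) = 0 \<longrightarrow> g > 1"
    "(\<lambda>k. log_ratio e d (i + int n + 1) (int k) - g * log_ratio e d (i + int n) (int k)) \<longlonglongrightarrow> 0"
    using log_ratio_step[OF assms, of "i + int n"] by blast
  have "(\<lambda>k. (log_ratio e d (i + int n + 1) (int k) - g * log_ratio e d (i + int n) (int k)) +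
      g * (log_ratio e d (i + int n) (int k) - G * log_ratio e d i (int k))) \<longlonglongrightarrow> 0 + g * 0"
    by (intro tendsto_intros G g)
  then have "(\<lambda>k. log_ratio e d (i + int (Suc n)) (int k) - (g * G) * log_ratio e d i (int k)) \<longlonglongrightarrow> 0"
    by (simp add: algebra_simps)
  moreover have "g * G \<ge> 1" using g(1) G(1) mult_mono[of 1 g 1 G] by simp
  moreover have "g * G > 1" if "\<exists>m<Suc n. D (t (i + int m)) = 0"
  proof -
    have "g > 1 \<or> G > 1" using that g(2) G(2) by (auto simp: less_Suc_eq)
    then show ?thesis
    proof
      assume "g > 1"
      then have "1 < g * 1" by simp
      also have "\<dots> \<le> g * G" using g(1) G(1) by (intro mult_left_mono) auto
      finally show ?thesis .
    next
      assume "G > 1"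
      then have "1 < 1 * G" by simp
      also have "\<dots> \<le> g * G" using g(1) G(1) by (intro mult_right_mono) auto
      finally show ?thesis .
    qed
  qed
  ultimately show ?case by (intro exI[of _ "g * G"]) blast
qed

subsection \<open>Periodic itineraries\<close>

definition periodic :: "int \<Rightarrow> (int \<Rightarrow> 'a set) \<Rightarrow> (int \<Rightarrow> real) \<Rightarrow> bool" where
  "periodic p e d \<longleftrightarrow> p > 0 \<and> (\<forall>i. e (i + p) = e i \<and> d (i + p) = d i)"

lemma periodic_pullback:
  assumes "periodic p e d"
  shows "pullback e d n (i + p) = pullback e d n i"
  using pullback_shift[of e p d n i] assms by (simp add: periodic_def)

lemma periodic_pullback_mod:
  assumes "periodic p e d"
  shows "pullback e d n i = pullback e d n (i mod p)"
proof -
  have up: "pullback e d n (i + int m * p) = pullback e d n i" for m i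
  proof (induction m)
    case (Suc m)
    have "i + int (Suc m) * p = (i + int m * p) + p" by (simp add: algebra_simps)
    then show ?case by (simp only: periodic_pullback[OF assms] Suc)
  qed simp
  have i: "i = i mod p + (i div p) * p" by simp
  show ?thesis
  proof (cases "i div p \<ge> 0")
    case True
    then show ?thesis using up[of "i mod p" "nat (i div p)"] i by simp
  next
    case False
    then have "i mod p = i + int (nat (- (i div p))) * p" using i by (simp add: algebra_simps)
    then show ?thesis using up[of i "nat (- (i div p))"] by simp
  qed
qed

text \<open>
  The intervals along a periodic itinerary shrink to a periodic orbit, which contains no critical
  points; so short ones contain none either.
\<close>

lemma periodic_noncritical_at:
  assumes c: "chain e d" and p: "periodic p e d"
  shows "\<exists>n. \<forall>s\<in>pullback e d n i. D s \<noteq> 0"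
proof (rule ccontr)
  assume neg: "\<nexists>n. \<forall>s\<in>pullback e d n i. D s \<noteq> 0"
  let ?S = "{s \<in> base (e i). D s = 0}"
  have I: "e i \<in> first_partition M f" using chain_partition[OF c] .
  have "?S \<subseteq> {t \<in> nodes. lo (e i) \<le> t \<and> t \<le> hi (e i)}"
    using critical_node base_dom[OF I] by (auto simp: base_def)
  then have finS: "finite ?S" using finite_nodes finite_subset by blast
  have "\<exists>\<tau>\<in>?S. \<forall>n. \<tau> \<in> pullback e d n i"
  proof (rule ccontr)
    assume "\<not> (\<exists>\<tau>\<in>?S. \<forall>n. \<tau> \<in> pullback e d n i)"
    then have "\<forall>\<tau>\<in>?S. \<exists>n. \<tau> \<notin> pullback e d n i" by blast
    then obtain N where N: "\<And>\<tau>. \<tau> \<in> ?S \<Longrightarrow> \<tau> \<notin> pullback e d (N \<tau>) i" by metis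
    define m where "m = Max (insert 0 (N ` ?S))"
    obtain \<tau> where \<tau>: "\<tau> \<in> pullback e d m i" "D \<tau> = 0" using neg by blast
    then have S: "\<tau> \<in> ?S" using pullback_base by blast
    then have "N \<tau> \<le> m" unfolding m_def using finS by (intro Max_ge) auto
    then show False using N[OF S] \<tau>(1) pullback_antimono by blast
  qed
  then obtain \<tau> where \<tau>: "D \<tau> = 0" "\<And>n. \<tau> \<in> pullback e d n i" by blast
  define it where "it = rec_nat \<tau> (\<lambda>m s. \<Phi> s + d (i + int m))"
  have it0: "it 0 = \<tau>" and itS: "it (Suc m) = \<Phi> (it m) + d (i + int m)" for m
    by (simp_all add: it_def)
  have mem: "it m \<in> pullback e d n (i + int m)" for m n
  proof (induction m arbitrary: n)
    case (Suc m)
    have "it m \<in> pullback e d (Suc n) (i + int m)" by (rule Suc)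
    then have "\<Phi> (it m) + d (i + int m) \<in> pullback e d n (i + int m + 1)" by simp
    then show ?case by (simp add: itS algebra_simps)
  qed (simp add: it0 \<tau>)
  have par: "par M (it m) = (f ^^ m) (par M \<tau>)" for m
  proof (induction m)
    case (Suc m)
    have dom: "it m \<in> dom1 M" using mem pullback_dom[OF c] by blast
    have "par M (it (Suc m)) = par M (\<Phi> (it m))"
      unfolding itS by (rule par_shift[OF Phi_dom[OF dom] chain_deck[OF c]])
    also have "\<dots> = f (par M (it m))" using f_par[OF dom] by simp
    finally show ?case using Suc by simp
  qed (simp add: it0)
  define q where "q = nat p"
  have q: "q \<ge> 1" "int q = p" using p by (auto simp: q_def periodic_def)
  have close: "\<bar>it q - \<tau>\<bar> \<le> K * \<mu> ^ Suc n" for n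
  proof -
    have "it q \<in> pullback e d n i" using mem[of q n] q periodic_pullback[OF p] by simp
    moreover obtain x y where xy: "pullback e d n i = closed_segment x y" using pullback_segment[OF c] by blast
    ultimately have "\<bar>it q - \<tau>\<bar> \<le> \<bar>y - x\<bar>"
      using \<tau>(2)[of n] by (auto simp: closed_segment_eq_real_ivl split: if_splits)
    also have "\<dots> \<le> K * \<mu> ^ Suc n" using pullback_decay[OF c, of n i] xy measure_segment[of x y] by simp
    finally show ?thesis .
  qed
  have "(\<lambda>n. K * \<mu> ^ Suc n) \<longlonglongrightarrow> 0"
    by (rule LIMSEQ_Suc[OF geometric_null[OF mu_pos mu_less_1]])
  then have "\<bar>it q - \<tau>\<bar> \<le> 0" using close by (intro LIMSEQ_le_const) auto
  then have "(f ^^ q) (par M \<tau>) = par M \<tau>" using par[of q] by simp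
  moreover have "\<tau> \<in> dom1 M" using \<tau>(2)[of 0] pullback_dom[OF c] by blast
  then have "par M \<tau> \<in> critical_points M f" using \<tau>(1) critical_iff by blast
  ultimately show False using no_cycle q(1) by blast
qed

text \<open>
  On one period the distortion bound holds with finitely many constants.
\<close>

lemma periodic_distortion:
  assumes c: "chain e d" and p: "periodic p e d"
  shows "\<exists>n C. C \<ge> 0 \<and> (\<forall>i. \<forall>t\<in>pullback e d n i. \<forall>z\<in>pullback e d n i. t \<noteq> z \<longrightarrow>
    \<bar>ln (\<bar>\<Phi> z - \<Phi> t\<bar> / \<bar>z - t\<bar>) - ln \<bar>D t\<bar>\<bar> \<le> C * \<bar>z - t\<bar> powr \<alpha>)"
proof -
  obtain N where N: "\<And>i. \<forall>s\<in>pullback e d (N i) i. D s \<noteq> 0"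
    using periodic_noncritical_at[OF c p] by metis
  define n where "n = Max (N ` {0..<p})"
  have pp: "p > 0" using p by (simp add: periodic_def)
  have "\<exists>C\<ge>0. \<forall>t\<in>pullback e d n i. \<forall>z\<in>pullback e d n i. t \<noteq> z \<longrightarrow>
    \<bar>ln (\<bar>\<Phi> z - \<Phi> t\<bar> / \<bar>z - t\<bar>) - ln \<bar>D t\<bar>\<bar> \<le> C * \<bar>z - t\<bar> powr \<alpha>" if "i \<in> {0..<p}" for i
  proof -
    have "N i \<le> n" unfolding n_def using that by (intro Max_ge) auto
    then have nc: "D s \<noteq> 0" if "s \<in> pullback e d n i" for s
      using N[of i] that pullback_antimono by blast
    obtain a b where ab: "pullback e d n i = closed_segment a b" using pullback_segment[OF c] by blast
    define x where "x = min a b"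
    define y where "y = max a b"
    have xy: "pullback e d n i = {x..y}"
      using ab by (auto simp: x_def y_def closed_segment_eq_real_ivl)
    have "x \<in> {x..y}" "y \<in> {x..y}" by (auto simp: x_def y_def)
    then have "x \<in> dom1 M" "y \<in> dom1 M" using pullback_dom[OF c, of n i] xy by blast+
    from distortion[OF this] nc show ?thesis unfolding xy by blast
  qed
  then obtain C where C: "\<And>i. i \<in> {0..<p} \<Longrightarrow> C i \<ge> 0"
    "\<And>i t z. i \<in> {0..<p} \<Longrightarrow> t \<in> pullback e d n i \<Longrightarrow> z \<in> pullback e d n i \<Longrightarrow> t \<noteq> z \<Longrightarrow>
      \<bar>ln (\<bar>\<Phi> z - \<Phi> t\<bar> / \<bar>z - t\<bar>) - ln \<bar>D t\<bar>\<bar> \<le> C i * \<bar>z - t\<bar> powr \<alpha>"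
    by metis
  define B where "B = (\<Sum>i\<in>{0..<p}. C i)"
  have CB: "C i \<le> B" if "i \<in> {0..<p}" for i
    unfolding B_def using that C(1) by (intro member_le_sum) auto
  have "\<bar>ln (\<bar>\<Phi> z - \<Phi> t\<bar> / \<bar>z - t\<bar>) - ln \<bar>D t\<bar>\<bar> \<le> B * \<bar>z - t\<bar> powr \<alpha>"
    if tz: "t \<in> pullback e d n i" "z \<in> pullback e d n i" "t \<noteq> z" for i t z
  proof -
    have im: "i mod p \<in> {0..<p}" using pp by simp
    have "\<bar>ln (\<bar>\<Phi> z - \<Phi> t\<bar> / \<bar>z - t\<bar>) - ln \<bar>D t\<bar>\<bar> \<le> C (i mod p) * \<bar>z - t\<bar> powr \<alpha>"
      using C(2)[OF im] tz periodic_pullback_mod[OF p, of n i] by blast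
    also have "\<dots> \<le> B * \<bar>z - t\<bar> powr \<alpha>" using CB[OF im] by (intro mult_right_mono) auto
    finally show ?thesis .
  qed
  moreover have "B \<ge> 0" unfolding B_def using C(1) by (intro sum_nonneg) auto
  ultimately show ?thesis by blast
qed

text \<open>
  If the past follows a periodic itinerary, then each step back changes the logarithm of the scale by
  at most a constant times the power \<open>\<alpha>\<close> of the length of an interval, and these lengths decay
  geometrically.  So the scales converge, and the distance to the limit is small for long words.
\<close>

lemma log_ratio_limit:
  assumes c0: "chain e0 d0" and p: "periodic p e0 d0"
  shows "\<exists>n C. \<forall>e d t j k. chain e d \<longrightarrow> orbit e d t \<longrightarrow> (\<forall>i\<le>j + int n. e i = e0 i \<and> d i = d0 i) \<longrightarrow>
    endpoint e t k \<longrightarrow> endpoint e t (k + 1) \<longrightarrow> k > j + int n \<longrightarrow>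
    (\<exists>X. (\<lambda>m. log_ratio e d (j - int m) k) \<longlonglongrightarrow> X \<and>
      \<bar>log_ratio e d j k - X\<bar> \<le> C * (\<mu> powr \<alpha>) ^ nat (k - j))"
proof -
  obtain n C where C: "C \<ge> 0" "\<And>i t z. t \<in> pullback e0 d0 n i \<Longrightarrow> z \<in> pullback e0 d0 n i \<Longrightarrow> t \<noteq> z \<Longrightarrow>
    \<bar>ln (\<bar>\<Phi> z - \<Phi> t\<bar> / \<bar>z - t\<bar>) - ln \<bar>D t\<bar>\<bar> \<le> C * \<bar>z - t\<bar> powr \<alpha>"
    using periodic_distortion[OF c0 p] by metis
  define r where "r = \<mu> powr \<alpha>"
  have r: "0 < r" "r < 1" using mu_pos mu_less_1 alpha_pos using powr_less_mono2[of \<alpha> \<mu> 1] by (auto simp: r_def)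
  define B where "B = 2 * C * K powr \<alpha>"
  show ?thesis
  proof (rule exI[of _ n], rule exI[of _ "B / (1 - r)"], intro allI impI)
    fix e d t j k
    assume c: "chain e d" and o: "orbit e d t" and agree: "\<forall>i\<le>j + int n. e i = e0 i \<and> d i = d0 i"
      and ep: "endpoint e t k" "endpoint e t (k + 1)" and k: "k > j + int n"
    have bound: "\<bar>ln (ell e d (i + 1) l) - ln (ell e d i l) - ln \<bar>D (t i)\<bar>\<bar> \<le> C * (K powr \<alpha> * r ^ nat (k - i))"
      if i: "i \<le> j" and l: "l = k \<or> l = k + 1" for i l
    proof -
      have el: "endpoint e t l" "l \<ge> i + 1" "l \<ge> k" using l ep k i by auto
      obtain z where z: "z \<noteq> t i" "pullback e d (nat (l - i)) i = closed_segment (t i) z"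
        "ell e d i l = \<bar>z - t i\<bar>" "ell e d (i + 1) l = \<bar>\<Phi> z - \<Phi> (t i)\<bar>"
        using ell_step[OF c o el(1,2)] by blast
      have "n \<le> nat (l - i)" using el k i by linarith
      then have "closed_segment (t i) z \<subseteq> pullback e d n i" using pullback_antimono z(2) by metis
      moreover have "pullback e d n i = pullback e0 d0 n i"
        by (rule pullback_cong) (use agree i in auto)
      ultimately have mem: "t i \<in> pullback e0 d0 n i" "z \<in> pullback e0 d0 n i" by auto
      have pos: "ell e d (i + 1) l > 0" "ell e d i l > 0" using ell_pos[OF c] by auto
      have "ln (ell e d (i + 1) l) - ln (ell e d i l) = ln (\<bar>\<Phi> z - \<Phi> (t i)\<bar> / \<bar>z - t i\<bar>)"
        using pos unfolding z(3,4) by (simp add: ln_div)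
      then have "\<bar>ln (ell e d (i + 1) l) - ln (ell e d i l) - ln \<bar>D (t i)\<bar>\<bar> \<le> C * \<bar>z - t i\<bar> powr \<alpha>"
        using C(2)[OF mem] z(1) by auto
      also have "\<dots> \<le> C * (K * \<mu> ^ nat (k - i)) powr \<alpha>"
      proof (intro mult_left_mono powr_mono2)
        have "\<bar>z - t i\<bar> \<le> K * \<mu> ^ nat (l - i)" using ell_decay[OF c, of i l] z(3) by simp
        also have "\<dots> \<le> K * \<mu> ^ nat (k - i)"
          using K_pos mu_pos mu_less_1 el(3) by (intro mult_left_mono power_decreasing) auto
        finally show "\<bar>z - t i\<bar> \<le> K * \<mu> ^ nat (k - i)" .
      qed (use alpha_pos C(1) in auto)
      also have "\<dots> = C * (K powr \<alpha> * r ^ nat (k - i))"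
        using K_pos mu_pos
        by (simp add: powr_mult r_def powr_realpow[symmetric] powr_powr mult.commute)
      finally show ?thesis .
    qed
    have step: "\<bar>log_ratio e d (i + 1) k - log_ratio e d i k\<bar> \<le> B * r ^ nat (k - i)" if i: "i \<le> j" for i
      using bound[OF i, of k] bound[OF i, of "k + 1"] unfolding log_ratio_def B_def by (simp add: algebra_simps) 
    define x where "x m = log_ratio e d (j - int m) k" for m
    have "\<bar>x (Suc m) - x m\<bar> \<le> (B * r ^ nat (k - j)) * r ^ m" for m
    proof -
      have "\<bar>x (Suc m) - x m\<bar> \<le> B * r ^ nat (k - (j - int (Suc m)))"
        using step[of "j - int (Suc m)"] by (simp add: x_def abs_minus_commute algebra_simps)
      also have "\<dots> \<le> B * r ^ (nat (k - j) + m)"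
        using r C(1) k by (intro mult_left_mono power_decreasing) (auto simp: B_def)
      finally show ?thesis by (simp add: power_add mult.assoc)
    qed
    from geometric_cauchy[OF r this]
    obtain X where "x \<longlonglongrightarrow> X" "\<bar>x 0 - X\<bar> \<le> B * r ^ nat (k - j) / (1 - r)" by blast
    then show "\<exists>X. (\<lambda>m. log_ratio e d (j - int m) k) \<longlonglongrightarrow> X \<and>
      \<bar>log_ratio e d j k - X\<bar> \<le> B / (1 - r) * (\<mu> powr \<alpha>) ^ nat (k - j)"
      by (intro exI[of _ X]) (simp add: x_def[abs_def] r_def)
  qed
qed

subsection \<open>The scaling function at a left-infinite sequence\<close>

text \<open>
  The left-infinite sequence that is read off an itinerary backwards from time \<open>k\<close>.
\<close>

definition past :: "(int \<Rightarrow> 'a set) \<Rightarrow> int \<Rightarrow> nat \<Rightarrow> 'a set signed" where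
  "past e k j = symbol_of M f (e (k - int j))"

lemma dual_block_0: "dual_block (past e k) 0 n = block e n (k - int n)"
proof (induction n)
  case 0
  then show ?case by (simp add: dual_block_def past_def)
next
  case (Suc n)
  have "dual_block (past e k) 0 (Suc n) = past e k (Suc n) # dual_block (past e k) 0 n"
    by (simp add: dual_block_def)
  moreover have "block e (Suc n) (k - int (Suc n)) = past e k (Suc n) # block e n (k - int n)"
    by (simp add: past_def)
  ultimately show ?case using Suc by simp
qed

lemma block_snoc: "block e (Suc n) i = block e n i @ [symbol_of M f (e (i + int (Suc n)))]"
proof (induction n arbitrary: i)
  case (Suc n)
  have "i + 1 + int (Suc n) = i + int (Suc (Suc n))" by simp
  then show ?case using Suc.IH[of "i + 1"] by (metis append_Cons block.simps(2))
qed simp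

lemma dual_block_1: "dual_block (past e k) 1 (Suc n) = block e n (k - int (Suc n))"
proof -
  have "dual_block (past e k) 0 (Suc n) = dual_block (past e k) 1 (Suc n) @ [past e k 0]"
    by (simp add: dual_block_def upt_conv_Cons del: upt_Suc)
  moreover have "block e (Suc n) (k - int (Suc n)) = block e n (k - int (Suc n)) @ [past e k 0]"
    unfolding block_snoc by (simp add: past_def)
  ultimately show ?thesis using dual_block_0[of e k "Suc n"] by simp
qed

lemma past_dual_space: "chain e d \<Longrightarrow> past e k \<in> dual_space M f"
  by (simp add: dual_space_def dual_block_0 suitable_block)

lemma word_sign_snoc: "word_sign (v @ [s]) = word_sign v * (if is_Minus s then -1 else 1)"
  by (simp add: word_sign_def)

lemma signed_scale_past:
  assumes c: "chain e d"
  shows "signed_scale M f (past e (k + 1)) (Suc n) =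
    (if is_Minus (past e (k + 1) 0) then -1 else 1) * exp (log_ratio e d (k - int n) k)"
proof -
  let ?i = "k - int n"
  define w where "w = block e (Suc n) ?i"
  define v where "v = block e n ?i"
  have wv: "dual_block (past e (k + 1)) 0 (Suc n) = w" "dual_block (past e (k + 1)) 1 (Suc n) = v"
    using dual_block_0[of e "k + 1" "Suc n"] dual_block_1[of e "k + 1" n] by (simp_all add: w_def v_def)
  have sign: "word_sign w = word_sign v * (if is_Minus (past e (k + 1) 0) then -1 else 1)"
    unfolding w_def v_def block_snoc word_sign_snoc by (simp add: past_def algebra_simps)
  have nz: "word_sign v \<noteq> 0" by (simp add: word_sign_def)
  have lw: "arc_length M (word_interval f w) = ell e d ?i (k + 1)"
  proof -
    have "nat (k + 1 - ?i) = Suc n" by simp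
    then show ?thesis unfolding w_def arc_length_pullback[OF c] ell_def by simp
  qed
  have lv: "arc_length M (word_interval f v) = ell e d ?i k"
    unfolding v_def arc_length_pullback[OF c] ell_def by simp
  have "exp (log_ratio e d ?i k) = ell e d ?i (k + 1) / ell e d ?i k"
    using ell_pos[OF c] by (simp add: log_ratio_def exp_diff)
  then show ?thesis
    unfolding signed_scale_def Let_def wv lw lv sign using nz by simp
qed

text \<open>
  The sign of the scale depends on the rightmost symbol only; so it does not affect convergence.
\<close>

lemma scaling_function_past:
  assumes c: "chain e d" and X: "(\<lambda>m. log_ratio e d (j - int m) k) \<longlonglongrightarrow> X" and k: "j \<le> k"
  shows "scaling_function M f (past e (k + 1)) = exp X"
proof -
  define s where "s = (if is_Minus (past e (k + 1) 0) then -1 else 1 :: real)"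
  have "(\<lambda>m. s * exp (log_ratio e d (j - int m) k)) \<longlonglongrightarrow> s * exp X"
    by (intro tendsto_intros X)
  moreover have "signed_scale M f (past e (k + 1)) (m + Suc (nat (k - j))) =
      s * exp (log_ratio e d (j - int m) k)" for m
  proof -
    have eq: "k - int (m + nat (k - j)) = j - int m" using k by simp
    show ?thesis using signed_scale_past[OF c, of k "m + nat (k - j)"]
      unfolding eq s_def add_Suc_right .
  qed
  ultimately have "(\<lambda>m. signed_scale M f (past e (k + 1)) (m + Suc (nat (k - j)))) \<longlonglongrightarrow> s * exp X"
    by simp
  then have "signed_scale M f (past e (k + 1)) \<longlonglongrightarrow> s * exp X" by (rule LIMSEQ_offset)
  then have "signed_scaling_function M f (past e (k + 1)) = s * exp X"
    unfolding signed_scaling_function_def by (rule limI)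
  then show ?thesis by (simp add: scaling_function_def abs_mult s_def)
qed

end

section \<open>Discontinuity\<close>

lemma int_periodic_multiple:
  fixes x :: "int \<Rightarrow> 'b"
  assumes "\<And>i. i \<ge> m \<Longrightarrow> x (i + p) = x i" "p > 0" "i \<ge> m"
  shows "x (i + int n * p) = x i"
proof (induction n)
  case (Suc n)
  have "i + int n * p \<ge> m" using assms(2,3) by (simp add: add_increasing2)
  then have "x (i + int n * p + p) = x (i + int n * p)" by (rule assms(1))
  moreover have "i + int (Suc n) * p = i + int n * p + p" by (simp add: algebra_simps)
  ultimately show ?case by (simp only: Suc)
qed simp

text \<open>
  The last clause transfers relations between neighbouring entries, such as being joined by an edge, to
  the periodic sequence.
\<close>

lemma periodic_extension:
  fixes x :: "int \<Rightarrow> 'b"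
  assumes per: "\<And>i. i \<ge> m \<Longrightarrow> x (i + p) = x i" and p: "p > 0"
  shows "\<exists>y. (\<forall>i. y (i + p) = y i) \<and> (\<forall>i\<ge>m. y i = x i) \<and>
    (\<forall>i. \<exists>j\<ge>m. y i = x j \<and> y (i + 1) = x (j + 1))"
proof -
  define y where "y i = x (m + (i - m) mod p)" for i
  have yper: "y (i + p) = y i" for i
  proof -
    have "(i + p - m) mod p = (i - m) mod p"
      by (metis add_diff_eq diff_add_eq mod_add_self2)
    then show ?thesis by (simp add: y_def)
  qed
  have agree: "y i = x i" if "i \<ge> m" for i
  proof -
    have "i = m + (i - m) mod p + int (nat ((i - m) div p)) * p"
      using that p by (simp add: pos_imp_zdiv_nonneg_iff)
    then show ?thesis
      using int_periodic_multiple[of m x p "m + (i - m) mod p" "nat ((i - m) div p)"] per p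
      by (simp add: y_def)
  qed
  have "\<exists>j\<ge>m. y i = x j \<and> y (i + 1) = x (j + 1)" for i
  proof -
    define n where "n = nat \<bar>i - m\<bar>"
    have "int n * 1 \<le> int n * p" using p by (intro mult_left_mono) auto
    then have j: "i + int n * p \<ge> m" "i + 1 + int n * p \<ge> m" unfolding n_def by linarith+
    have mult: "y (l + int n * p) = y l" for l
      using int_periodic_multiple[of l y p l n] yper p by simp
    have "y i = x (i + int n * p)" using mult[of i] agree[OF j(1)] by simp
    moreover have "y (i + 1) = x (i + int n * p + 1)"
      using mult[of "i + 1"] agree[OF j(2)] by (simp add: algebra_simps)
    ultimately show ?thesis using j(1) by blast
  qed
  then show ?thesis using yper agree by blast
qed

lemma periodic_extension_left:
  fixes x :: "int \<Rightarrow> 'b"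
  assumes per: "\<And>i. i \<le> m \<Longrightarrow> x (i - p) = x i" and p: "p > 0"
  shows "\<exists>y. (\<forall>i. y (i + p) = y i) \<and> (\<forall>i\<le>m. y i = x i) \<and>
    (\<forall>i. \<exists>j. y i = x j \<and> y (i + 1) = x (j + 1))"
proof -
  have "(\<lambda>i. x (- i)) (i + p) = (\<lambda>i. x (- i)) i" if "i \<ge> - m" for i
    using per[of "- i"] that by simp
  from periodic_extension[of "- m" "\<lambda>i. x (- i)", OF this p]
  obtain y where y: "\<And>i. y (i + p) = y i" "\<And>i. i \<ge> - m \<Longrightarrow> y i = x (- i)"
    "\<And>i. \<exists>j. y i = x (- j) \<and> y (i + 1) = x (- (j + 1))"
    by blast
  have "y (- (i + p)) = y (- i)" for i using y(1)[of "- (i + p)"] by simp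
  moreover have "y (- i) = x i" if "i \<le> m" for i using y(2)[of "- i"] that by simp
  moreover have "\<exists>j. y (- i) = x j \<and> y (- (i + 1)) = x (j + 1)" for i
  proof -
    obtain j where "y (- (i + 1)) = x (- j)" "y (- (i + 1) + 1) = x (- (j + 1))"
      using y(3)[of "- (i + 1)"] by blast
    then show ?thesis by (intro exI[of _ "- (j + 1)"]) simp
  qed
  ultimately show ?thesis by (intro exI[of _ "\<lambda>i. y (- i)"]) blast
qed

lemma tendsto_residues:
  fixes x :: "nat \<Rightarrow> real"
  assumes p: "p > 0" and lim: "\<And>m. m \<ge> k0 \<Longrightarrow> (\<lambda>n. x (m + p * n)) \<longlonglongrightarrow> 0"
  shows "x \<longlonglongrightarrow> 0"
proof (rule LIMSEQ_I)
  fix \<epsilon> :: real assume "\<epsilon> > 0"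
  then have "\<exists>N. \<forall>n\<ge>N. norm (x (m + p * n) - 0) < \<epsilon>" if "m \<ge> k0" for m
    using LIMSEQ_D[OF lim[OF that]] by blast
  then obtain N where N: "\<And>m n. m \<ge> k0 \<Longrightarrow> n \<ge> N m \<Longrightarrow> norm (x (m + p * n) - 0) < \<epsilon>" by metis
  define L where "L = Max (N ` {k0..<k0 + p})"
  show "\<exists>no. \<forall>n\<ge>no. norm (x n - 0) < \<epsilon>"
  proof (intro exI[of _ "k0 + p * L"] allI impI)
    fix n assume n: "k0 + p * L \<le> n"
    define m where "m = k0 + (n - k0) mod p"
    define q where "q = (n - k0) div p"
    have nm: "n = m + p * q" using n by (simp add: m_def q_def)
    have m: "m \<ge> k0" "m \<in> {k0..<k0 + p}" using p by (auto simp: m_def)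
    have "p * L \<le> n - k0" using n by simp
    then have "L \<le> q" using p by (metis div_le_mono nonzero_mult_div_cancel_left not_gr_zero q_def)
    moreover have "N m \<le> L" unfolding L_def using m(2) by (intro Max_ge) auto
    ultimately show "norm (x n - 0) < \<epsilon>" using N[OF m(1), of q] nm by simp
  qed
qed

text \<open>Ratios that tend to one eventually exceed \<open>sqrt \<mu>\<close>, which bounds the decay from below.\<close>

lemma subexponential_contradiction:
  fixes l :: "nat \<Rightarrow> real"
  assumes pos: "\<And>k. l k > 0" and dec: "\<And>k. l k \<le> C * \<mu> ^ k" and mu: "0 < \<mu>" "\<mu> < 1" "C > 0"
    and lim: "(\<lambda>k. ln (l (Suc k)) - ln (l k)) \<longlonglongrightarrow> 0"
  shows False
proof -
  define \<epsilon> where "\<epsilon> = - ln \<mu> / 2"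
  have eps: "\<epsilon> > 0" "ln \<mu> = - 2 * \<epsilon>" using mu by (simp_all add: \<epsilon>_def)
  obtain N where N: "\<And>k. k \<ge> N \<Longrightarrow> norm (ln (l (Suc k)) - ln (l k) - 0) < \<epsilon>"
    using LIMSEQ_D[OF lim eps(1)] by blast
  have low: "ln (l (N + n)) \<ge> ln (l N) - \<epsilon> * real n" for n
  proof (induction n)
    case (Suc n)
    then show ?case using N[of "N + n"] by (simp add: algebra_simps)
  qed simp
  have up: "ln (l k) \<le> ln C - 2 * \<epsilon> * real k" for k
  proof -
    have "ln (l k) \<le> ln (C * \<mu> ^ k)" using pos dec mu by (subst ln_le_cancel_iff) auto
    also have "\<dots> = ln C + real k * ln \<mu>" using mu by (simp add: ln_mult_pos ln_realpow)
    finally show ?thesis unfolding eps(2) by (simp add: algebra_simps)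
  qed
  obtain n :: nat where n: "(ln C - ln (l N)) / \<epsilon> < real n" using reals_Archimedean2 by blast
  have "ln (l N) - \<epsilon> * real n \<le> ln C - 2 * \<epsilon> * real (N + n)" using low[of n] up[of "N + n"] by linarith
  also have "\<dots> \<le> ln C - 2 * \<epsilon> * real n" using eps by simp
  finally have "\<epsilon> * real n \<le> ln C - ln (l N)" by (simp add: algebra_simps)
  moreover have "ln C - ln (l N) < \<epsilon> * real n" using n eps(1) by (simp add: field_simps)
  ultimately show False by simp
qed

context geometrically_finite_map
begin

text \<open>
  Finite intersections of cylinders around a point are cylinders.
\<close>

lemma open_contains_cylinder:
  assumes "openin (dual_topology M f) U" "a \<in> U"
  shows "\<exists>n. \<forall>b\<in>dual_space M f. (\<forall>k<n. b k = a k) \<longrightarrow> b \<in> U"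
proof -
  have "generate_topology_on {{b \<in> dual_space M f. \<forall>k<n. b k = a k} | a n. a \<in> dual_space M f} U"
    using assms(1) by (simp add: dual_topology_def openin_topology_generated_by_iff)
  then show ?thesis using assms(2)
  proof (induction U rule: generate_topology_on.induct)
    case Empty
    then show ?case by simp
  next
    case (Int A B)
    then obtain m n where "\<forall>b\<in>dual_space M f. (\<forall>k<m. b k = a k) \<longrightarrow> b \<in> A"
      "\<forall>b\<in>dual_space M f. (\<forall>k<n. b k = a k) \<longrightarrow> b \<in> B" by blast
    then show ?case by (intro exI[of _ "max m n"]) auto
  next
    case (UN S)
    then obtain A n where "A \<in> S" "\<forall>b\<in>dual_space M f. (\<forall>k<n. b k = a k) \<longrightarrow> b \<in> A" by blast
    then show ?case by blast
  next
    case (Basis s)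
    then obtain c n where "s = {b \<in> dual_space M f. \<forall>k<n. b k = c k}" by blast
    then show ?case using Basis by (intro exI[of _ n]) auto
  qed
qed

lemma dual_space_topspace: "topspace (dual_topology M f) = dual_space M f"
  by (auto simp: dual_topology_def topology_generated_by_topspace)

lemma scaling_function_limit:
  assumes cont: "continuous_map (dual_topology M f) euclideanreal (scaling_function M f)"
    and a: "a \<in> dual_space M f" and b: "\<And>n. b n \<in> dual_space M f"
    and conv: "\<And>k. \<forall>\<^sub>F n in sequentially. \<forall>j<k. b n j = a j"
  shows "(\<lambda>n. scaling_function M f (b n)) \<longlonglongrightarrow> scaling_function M f a"
proof -
  have "limitin (dual_topology M f) b a sequentially"
    unfolding limitin_def
  proof (intro conjI allI impI)
    show "a \<in> topspace (dual_topology M f)" using a dual_space_topspace by simp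
    fix U assume "openin (dual_topology M f) U \<and> a \<in> U"
    then obtain k where k: "\<And>b. b \<in> dual_space M f \<Longrightarrow> (\<forall>j<k. b j = a j) \<Longrightarrow> b \<in> U"
      using open_contains_cylinder by metis
    show "\<forall>\<^sub>F n in sequentially. b n \<in> U"
      using conv[of k] by eventually_elim (use k b in blast)
  qed
  from continuous_map_limit[OF cont this] show ?thesis by (simp add: o_def)
qed

text \<open>
  One-sided neighbourhoods of endpoints of the partition are mapped to such neighbourhoods.
\<close>

lemma germ_step:
  assumes I: "I \<in> first_partition M f" and t: "t \<in> {lo I, hi I}"
  shows "\<exists>J d. edge I d J \<and> \<Phi> t + d \<in> {lo J, hi J}"
proof -
  define w where "w = (if t = lo I then \<Phi> (hi I) else \<Phi> (lo I))"
  have w: "\<Phi> t \<in> nodes" "w \<in> nodes" "\<Phi> t \<noteq> w" "\<Phi> ` base I = closed_segment (\<Phi> t) w"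
    using image_endpoints[OF I] base_image[OF I] t by (auto simp: w_def closed_segment_commute)
  show ?thesis
  proof (cases "\<Phi> t < w")
    case True
    then obtain b where b: "b \<le> w" "basic (\<Phi> t) b" using basic_right[OF w(1,2)] by blast
    then have "{\<Phi> t..b} \<subseteq> \<Phi> ` base I" using True w(4) by (auto simp: closed_segment_eq_real_ivl)
    then obtain J d where "edge I d J" "lo J = \<Phi> t + d" using edge_of_basic[OF I b(2)] by blast
    then show ?thesis by (intro exI[of _ J] exI[of _ d]) simp
  next
    case False
    then have "w < \<Phi> t" using w(3) by simp
    then obtain b where b: "b \<ge> w" "basic b (\<Phi> t)" using basic_left[OF w(2,1)] by blast
    then have "{b..\<Phi> t} \<subseteq> \<Phi> ` base I" using False w(4) by (auto simp: closed_segment_eq_real_ivl)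
    then obtain J d where "edge I d J" "hi J = \<Phi> t + d" using edge_of_basic[OF I b(2)] by blast
    then show ?thesis by (intro exI[of _ J] exI[of _ d]) simp
  qed
qed

text \<open>
  A critical orbit with its two-sided itinerary: in the future it stays in the finite set of
  endpoints, the past is chosen by a fixed rule on the finite set of intervals, so that both ends
  are eventually periodic.
\<close>

lemma critical_orbit:
  "\<exists>e d t. chain e d \<and> orbit e d t \<and> (\<forall>k\<ge>0. endpoint e t k) \<and> D (t 0) = 0 \<and>
    (\<exists>m p. p > 0 \<and> (\<forall>i\<ge>m. e (i + p) = e i \<and> d (i + p) = d i \<and> t (i + p) = t i)) \<and>
    (\<exists>m p. p > 0 \<and> (\<forall>i\<le>m. e (i - p) = e i \<and> d (i - p) = d i))"
proof -
  obtain N where stable: "reached (Suc N) = reached N" using reached_stable by blast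
  define R where "R = reached N"
  have Rfp: "R \<subseteq> first_partition M f" using reached_partition by (simp add: R_def)
  obtain x I0 where x: "x \<in> I0" "I0 \<in> R" "x \<in> critical_points M f"
    using eventual_image_critical[OF stable] by (auto simp: R_def)
  have I0: "I0 \<in> first_partition M f" using x Rfp by blast
  obtain t0 where t0: "t0 \<in> base I0" "x = par M t0" using x(1) rep(2)[OF I0] by blast
  have t0d: "t0 \<in> dom1 M" using t0 base_dom[OF I0] by blast
  have crit: "D t0 = 0" using critical_iff[OF t0d] x t0 by simp
  then have "t0 \<in> nodes" using critical_node t0d by blast
  then have t0e: "t0 \<in> {lo I0, hi I0}"
    using rep(1)[OF I0] t0(1) unfolding basic_def base_def by (cases t0 "lo I0" rule: linorder_cases) force+
  \<comment> \<open>in the future the orbit runs through pairs of an interval and one of its endpoints\<close>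
  define G where "G = {g. fst g \<in> first_partition M f \<and> snd g \<in> {lo (fst g), hi (fst g)}}"
  have "G \<subseteq> (\<lambda>I. (I, lo I)) ` first_partition M f \<union> (\<lambda>I. (I, hi I)) ` first_partition M f"
    by (force simp: G_def image_iff)
  then have finG: "finite G" using finite_first_partition finite_subset by blast
  have "\<exists>J d. edge (fst g) d J \<and> \<Phi> (snd g) + d \<in> {lo J, hi J}" if "g \<in> G" for g
    using germ_step that by (simp add: G_def)
  then obtain jn dn where jn: "\<And>g. g \<in> G \<Longrightarrow> edge (fst g) (dn g) (jn g)"
    "\<And>g. g \<in> G \<Longrightarrow> \<Phi> (snd g) + dn g \<in> {lo (jn g), hi (jn g)}" by metis
  define st where "st g = (jn g, \<Phi> (snd g) + dn g)" for g
  have stG: "st g \<in> G" if "g \<in> G" for g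
    using jn[OF that] by (simp add: st_def G_def edge_def)
  define g where "g n = (st ^^ n) (I0, t0)" for n
  have g0: "(I0, t0) \<in> G" using I0 t0e by (simp add: G_def)
  have gG: "g n \<in> G" for n unfolding g_def by (induction n) (use g0 stG in auto)
  have gS: "g (Suc n) = st (g n)" for n by (simp add: g_def)
  obtain m2 p2 where p2: "p2 > 0" "\<And>m. m \<ge> m2 \<Longrightarrow> g (m + p2) = g m"
    using eventually_periodic_orbit[OF finG, of st "(I0, t0)"] stG g0 unfolding g_def by blast
  \<comment> \<open>the past follows a predecessor function on the set of intervals with infinite past\<close>
  have "\<exists>I d. I \<in> R \<and> edge I d J" if "J \<in> R" for J
  proof -
    have "J \<in> reached (Suc N)" using that stable by (simp add: R_def)
    then show ?thesis by (auto simp: R_def next_to_def)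
  qed
  then obtain pr dp where pr: "\<And>J. J \<in> R \<Longrightarrow> pr J \<in> R" "\<And>J. J \<in> R \<Longrightarrow> edge (pr J) (dp J) J"
    by metis
  define b where "b n = (pr ^^ n) I0" for n
  have bR: "b n \<in> R" for n unfolding b_def by (induction n) (use x pr in auto)
  have b0: "b 0 = I0" and bS: "b (Suc n) = pr (b n)" for n by (simp_all add: b_def)
  have "finite R" using Rfp finite_first_partition finite_subset by blast
  then obtain m1 p1 where p1: "p1 > 0" "\<And>m. m \<ge> m1 \<Longrightarrow> b (m + p1) = b m"
    using eventually_periodic_orbit[of R pr I0] pr(1) x(2) unfolding b_def by blast
  define tb where "tb = rec_nat t0 (\<lambda>n s. SOME u. u \<in> base (b (Suc n)) \<and> \<Phi> u + dp (b n) = s)"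
  have tb0: "tb 0 = t0" and tbS: "tb (Suc n) = (SOME u. u \<in> base (b (Suc n)) \<and> \<Phi> u + dp (b n) = tb n)" for n
    by (simp_all add: tb_def)
  have edge_b: "edge (b (Suc n)) (dp (b n)) (b n)" for n using pr(2)[OF bR] bS by simp
  have tb_ex: "\<exists>u. u \<in> base (b (Suc n)) \<and> \<Phi> u + dp (b n) = tb n" if "tb n \<in> base (b n)" for n
    using edge_b[of n] that unfolding edge_def by force
  have tb_base: "tb n \<in> base (b n)" for n
  proof (induction n)
    case (Suc n)
    show ?case using someI_ex[OF tb_ex[OF Suc]] by (simp add: tbS)
  qed (simp add: tb0 b0 t0)
  have tb_step: "\<Phi> (tb (Suc n)) + dp (b n) = tb n" for n
    using someI_ex[OF tb_ex[OF tb_base]] by (simp add: tbS)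
  define e where "e i = (if i \<ge> 0 then fst (g (nat i)) else b (nat (- i)))" for i
  define d where "d i = (if i \<ge> 0 then dn (g (nat i)) else dp (b (nat (- i - 1))))" for i
  define t where "t i = (if i \<ge> 0 then snd (g (nat i)) else tb (nat (- i)))" for i
  have g00: "g 0 = (I0, t0)" by (simp add: g_def)
  have e_neg: "e i = b (nat (- i))" "t i = tb (nat (- i))" if "i \<le> 0" for i
    using that g00 b0 tb0 by (auto simp: e_def t_def)
  have link: "edge (e i) (d i) (e (i + 1)) \<and> t i \<in> base (e i) \<and> \<Phi> (t i) + d i = t (i + 1)" for i
  proof (cases "i \<ge> 0")
    case True
    then have n: "nat (i + 1) = Suc (nat i)" by simp
    have "snd (g (nat i)) \<in> base (fst (g (nat i)))"
      using gG[of "nat i"] lo_less_hi[of "fst (g (nat i))"] by (auto simp: G_def base_def)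
    then show ?thesis
      using True jn(1)[OF gG[of "nat i"]] by (simp add: e_def d_def t_def n gS st_def)
  next
    case False
    define n where "n = nat (- i - 1)"
    have n: "nat (- i) = Suc n" "nat (- (i + 1)) = n" using False by (auto simp: n_def)
    have "e i = b (Suc n)" "e (i + 1) = b n" "t i = tb (Suc n)" "t (i + 1) = tb n"
      using False e_neg[of i] e_neg[of "i + 1"] n by auto
    moreover have "d i = dp (b n)" using False by (simp add: d_def n_def)
    ultimately show ?thesis using edge_b tb_base tb_step by simp
  qed
  have "endpoint e t k" if "k \<ge> 0" for k
    using that gG[of "nat k"] by (auto simp: endpoint_def e_def t_def G_def)
  moreover have "D (t 0) = 0" using crit g00 by (simp add: t_def)
  moreover have "\<exists>m p. p > 0 \<and> (\<forall>i\<ge>m. e (i + p) = e i \<and> d (i + p) = d i \<and> t (i + p) = t i)"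
  proof (rule exI[of _ "int m2"], rule exI[of _ "int p2"], intro conjI allI impI)
    fix i assume i: "i \<ge> int m2"
    then have "nat (i + int p2) = nat i + p2" by simp
    then have "g (nat (i + int p2)) = g (nat i)" using p2(2)[of "nat i"] i by simp
    then show "e (i + int p2) = e i" "d (i + int p2) = d i" "t (i + int p2) = t i"
      using i by (simp_all add: e_def d_def t_def)
  qed (use p2 in simp)
  moreover have "\<exists>m p. p > 0 \<and> (\<forall>i\<le>m. e (i - p) = e i \<and> d (i - p) = d i)"
  proof (rule exI[of _ "- int m1 - 1"], rule exI[of _ "int p1"], intro conjI allI impI)
    fix i assume i: "i \<le> - int m1 - 1"
    have "nat (- (i - int p1)) = nat (- i) + p1" "nat (- (i - int p1) - 1) = nat (- i - 1) + p1"
      using i by auto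
    then have "b (nat (- (i - int p1))) = b (nat (- i))"
      "b (nat (- (i - int p1) - 1)) = b (nat (- i - 1))"
      using p1(2)[of "nat (- i)"] p1(2)[of "nat (- i - 1)"] i by auto
    then show "e (i - int p1) = e i" "d (i - int p1) = d i"
      using i by (simp_all add: e_def d_def)
  qed (use p1 in simp)
  moreover have "chain e d" using link by (simp add: chain_def)
  moreover have "orbit e d t" using link by (simp add: orbit_def)
  ultimately show ?thesis by blast
qed

text \<open>
  The sequences read off the critical itinerary from late times \<open>k\<close> agree on long final blocks with
  those of the periodic itinerary of its future, on which the scaling function has periodic values
  \<open>exp (L k)\<close>.  On the critical itinerary its values \<open>exp (V k)\<close> are governed by scales near the past
  end \<open>j1\<close>, and between \<open>j1\<close> and the future lies the critical point, which multiplies the logarithms by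
  \<open>\<Gamma> > 1\<close>.  Continuity forces \<open>V k\<close> and \<open>L k\<close> to agree in the limit; so all these logarithms tend to
  zero, which contradicts the exponential decay.
\<close>

theorem scaling_function_discontinuous:
  "\<not> continuous_map (dual_topology M f) euclideanreal (scaling_function M f)"
proof
  assume cont: "continuous_map (dual_topology M f) euclideanreal (scaling_function M f)"
  obtain e d t ma p mb p1 where c: "chain e d" and o: "orbit e d t"
    and ep: "\<And>k. k \<ge> 0 \<Longrightarrow> endpoint e t k" and crit: "D (t 0) = 0"
    and pa: "p > 0" "\<And>i. i \<ge> ma \<Longrightarrow> e (i + p) = e i \<and> d (i + p) = d i \<and> t (i + p) = t i"
    and pb: "p1 > 0" "\<And>i. i \<le> mb \<Longrightarrow> e (i - p1) = e i \<and> d (i - p1) = d i"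
    using critical_orbit by metis
  \<comment> \<open>at least one, so that the step through the critical point at time zero lies before \<open>m2\<close>\<close>
  define m2 where "m2 = max ma 1"
  have "(\<lambda>i. (e i, d i, t i)) (i + p) = (\<lambda>i. (e i, d i, t i)) i" if "i \<ge> m2" for i
    using pa(2)[of i] that by (simp add: m2_def)
  from periodic_extension[of m2 "\<lambda>i. (e i, d i, t i)", OF this pa(1)]
  obtain y where y: "\<And>i. y (i + p) = y i" "\<And>i. i \<ge> m2 \<Longrightarrow> y i = (e i, d i, t i)"
    "\<And>i. \<exists>j\<ge>m2. y i = (e j, d j, t j) \<and> y (i + 1) = (e (j + 1), d (j + 1), t (j + 1))" by blast
  define e' where "e' i = fst (y i)" for i
  define d' where "d' i = fst (snd (y i))" for i
  define t' where "t' i = snd (snd (y i))" for i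
  have link': "\<exists>j\<ge>m2. e' i = e j \<and> d' i = d j \<and> t' i = t j \<and> e' (i + 1) = e (j + 1) \<and> t' (i + 1) = t (j + 1)" for i
    using y(3)[of i] by (auto simp: e'_def d'_def t'_def)
  have c': "chain e' d'" unfolding chain_def
  proof
    fix i
    obtain j where "e' i = e j" "d' i = d j" "e' (i + 1) = e (j + 1)" using link'[of i] by blast
    then show "edge (e' i) (d' i) (e' (i + 1))" using c by (simp add: chain_def)
  qed
  have o': "orbit e' d' t'" unfolding orbit_def
  proof
    fix i
    obtain j where "e' i = e j" "d' i = d j" "t' i = t j" "t' (i + 1) = t (j + 1)" using link'[of i] by blast
    then show "t' i \<in> base (e' i) \<and> \<Phi> (t' i) + d' i = t' (i + 1)" using o by (simp add: orbit_def)
  qed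
  have ep': "endpoint e' t' k" for k
  proof -
    obtain j where "j \<ge> m2" "e' k = e j" "t' k = t j" using link'[of k] by blast
    then show ?thesis using ep[of j] by (simp add: endpoint_def m2_def)
  qed
  have per': "periodic p e' d'" using pa(1) y(1) by (simp add: periodic_def e'_def d'_def)
  have agree': "e' i = e i \<and> d' i = d i" if "i \<ge> m2" for i using y(2)[OF that] by (simp add: e'_def d'_def)
  have "(\<lambda>i. (e i, d i)) (i - p1) = (\<lambda>i. (e i, d i)) i" if "i \<le> mb" for i
    using pb(2)[OF that] by simp
  from periodic_extension_left[of mb "\<lambda>i. (e i, d i)", OF this pb(1)]
  obtain y0 where y0: "\<And>i. y0 (i + p1) = y0 i" "\<And>i. i \<le> mb \<Longrightarrow> y0 i = (e i, d i)"
    "\<And>i. \<exists>j. y0 i = (e j, d j) \<and> y0 (i + 1) = (e (j + 1), d (j + 1))" by blast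
  define e0 where "e0 i = fst (y0 i)" for i
  define d0 where "d0 i = snd (y0 i)" for i
  have c0: "chain e0 d0" unfolding chain_def
  proof
    fix i
    obtain j where "y0 i = (e j, d j)" "y0 (i + 1) = (e (j + 1), d (j + 1))" using y0(3)[of i] by blast
    then show "edge (e0 i) (d0 i) (e0 (i + 1))" using c by (simp add: chain_def e0_def d0_def)
  qed
  have per0: "periodic p1 e0 d0" using pb(1) y0(1) by (simp add: periodic_def e0_def d0_def)
  have agree0: "e i = e0 i \<and> d i = d0 i" if "i \<le> mb" for i using y0(2)[OF that] by (simp add: e0_def d0_def)
  define r where "r = \<mu> powr \<alpha>"
  have r: "0 < r" "r < 1" using mu_pos mu_less_1 alpha_pos powr_less_mono2[of \<alpha> \<mu> 1] by (auto simp: r_def)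
  obtain n' C' where lim': "\<And>j k. k > j + int n' \<Longrightarrow>
      \<exists>X. (\<lambda>m. log_ratio e' d' (j - int m) k) \<longlonglongrightarrow> X \<and> \<bar>log_ratio e' d' j k - X\<bar> \<le> C' * r ^ nat (k - j)"
    using log_ratio_limit[OF c' per'] c' o' ep' unfolding r_def by metis
  obtain n0 C0 where lim0: "\<And>j k. j + int n0 \<le> mb \<Longrightarrow> k \<ge> 0 \<Longrightarrow> k > j + int n0 \<Longrightarrow>
      \<exists>X. (\<lambda>m. log_ratio e d (j - int m) k) \<longlonglongrightarrow> X \<and> \<bar>log_ratio e d j k - X\<bar> \<le> C0 * r ^ nat (k - j)"
  proof -
    obtain n C where nC: "\<And>e d t j k. chain e d \<Longrightarrow> orbit e d t \<Longrightarrow> (\<forall>i\<le>j + int n. e i = e0 i \<and> d i = d0 i) \<Longrightarrow>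
      endpoint e t k \<Longrightarrow> endpoint e t (k + 1) \<Longrightarrow> k > j + int n \<Longrightarrow>
      \<exists>X. (\<lambda>m. log_ratio e d (j - int m) k) \<longlonglongrightarrow> X \<and> \<bar>log_ratio e d j k - X\<bar> \<le> C * r ^ nat (k - j)"
      using log_ratio_limit[OF c0 per0] unfolding r_def by blast
    show ?thesis
    proof (rule that)
      fix j k assume jk: "j + int n \<le> mb" "k \<ge> 0" "k > j + int n"
      show "\<exists>X. (\<lambda>m. log_ratio e d (j - int m) k) \<longlonglongrightarrow> X \<and> \<bar>log_ratio e d j k - X\<bar> \<le> C * r ^ nat (k - j)"
        by (rule nC[OF c o]) (use jk agree0 ep in auto)
    qed
  qed
  define j1 where "j1 = min 0 (mb - int n0)"
  define k0 where "k0 = nat (max (m2 + int n' + 1) (int n0 + 1))"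
  have j1: "j1 \<le> 0" "j1 + int n0 \<le> mb" by (auto simp: j1_def)
  have k0: "int k > m2 + int n'" "int k > j1 + int n0" "int k \<ge> m2" "int k \<ge> j1" if "k \<ge> k0" for k
    using that by (auto simp: k0_def j1_def)
  obtain L where L: "\<And>k. k \<ge> k0 \<Longrightarrow> (\<lambda>m. log_ratio e' d' (m2 - int m) (int k)) \<longlonglongrightarrow> L k"
    "\<And>k. k \<ge> k0 \<Longrightarrow> \<bar>log_ratio e' d' m2 (int k) - L k\<bar> \<le> C' * r ^ nat (int k - m2)"
    using lim'[OF k0(1)] by metis
  obtain V where V: "\<And>k. k \<ge> k0 \<Longrightarrow> (\<lambda>m. log_ratio e d (j1 - int m) (int k)) \<longlonglongrightarrow> V k"
    "\<And>k. k \<ge> k0 \<Longrightarrow> \<bar>log_ratio e d j1 (int k) - V k\<bar> \<le> C0 * r ^ nat (int k - j1)"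
    using lim0[OF j1(2) _ k0(2)] by (metis of_nat_0_le_iff)
  have scale_a: "scaling_function M f (past e' (int k + 1)) = exp (L k)" if "k \<ge> k0" for k
    using scaling_function_past[OF c' L(1)[OF that] k0(3)[OF that]] .
  have scale_b: "scaling_function M f (past e (int k + 1)) = exp (V k)" if "k \<ge> k0" for k
    using scaling_function_past[OF c V(1)[OF that] k0(4)[OF that]] .
  define q where "q = nat p"
  have q: "q > 0" "int q = p" using pa(1) by (auto simp: q_def)
  have e'_mult: "e' (i + p * int n) = e' i" for i n
    using int_periodic_multiple[of i e' p i n] per' by (simp add: periodic_def mult.commute)
  have past': "past e' (int (m + q * n) + 1) = past e' (int m + 1)" for m n
  proof
    fix j
    have "int (m + q * n) + 1 - int j = int m + 1 - int j + p * int n" using q(2) by simp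
    then show "past e' (int (m + q * n) + 1) j = past e' (int m + 1) j"
      unfolding past_def by (simp only: e'_mult)
  qed
  \<comment> \<open>continuity at the finitely many sequences \<open>past e' (int m + 1)\<close>, one residue class of \<open>k\<close> each\<close>
  have "(\<lambda>k. V k - L k) \<longlonglongrightarrow> 0"
  proof (rule tendsto_residues[OF q(1)])
    fix m assume m: "m \<ge> k0"
    have "(\<lambda>n. scaling_function M f (past e (int (m + q * n) + 1))) \<longlonglongrightarrow>
        scaling_function M f (past e' (int m + 1))"
    proof (rule scaling_function_limit[OF cont past_dual_space[OF c'] past_dual_space[OF c]])
      fix k
      show "\<forall>\<^sub>F n in sequentially. \<forall>j<k. past e (int (m + q * n) + 1) j = past e' (int m + 1) j"
        using eventually_ge_at_top[of "nat (m2 + int k)"]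
      proof eventually_elim
        case (elim n)
        have "n \<le> q * n" using q(1) by simp
        then have "int (m + q * n) + 1 - int j \<ge> m2" if "j < k" for j using elim that by linarith
        then have "past e (int (m + q * n) + 1) j = past e' (int (m + q * n) + 1) j" if "j < k" for j
          using agree' that by (simp add: past_def)
        then show ?case unfolding past' by blast
      qed
    qed
    moreover have "scaling_function M f (past e (int (m + q * n) + 1)) = exp (V (m + q * n))" for n
      by (rule scale_b) (use m in simp)
    ultimately have "(\<lambda>n. exp (V (m + q * n))) \<longlonglongrightarrow> exp (L m)"
      unfolding scale_a[OF m] by simp
    then have "(\<lambda>n. ln (exp (V (m + q * n)))) \<longlonglongrightarrow> ln (exp (L m))" by (intro tendsto_ln) auto
    then have "(\<lambda>n. V (m + q * n) - L m) \<longlonglongrightarrow> L m - L m" by (intro tendsto_intros) simp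
    moreover have "L (m + q * n) = L m" for n
    proof -
      have "exp (L (m + q * n)) = exp (L m)"
        using scale_a[of "m + q * n"] scale_a[of m] past'[of m n] m by simp
      then show ?thesis by simp
    qed
    ultimately show "(\<lambda>n. V (m + q * n) - L (m + q * n)) \<longlonglongrightarrow> 0" by simp
  qed
  moreover have small: "(\<lambda>k. F k) \<longlonglongrightarrow> 0"
    if "\<And>k. k \<ge> k0 \<Longrightarrow> \<bar>F k\<bar> \<le> C * r ^ nat (int k - j)" for F :: "nat \<Rightarrow> real" and C j
  proof (rule Lim_null_comparison)
    show "\<forall>\<^sub>F k in sequentially. norm (F k) \<le> C * r ^ nat (int k - j)"
      using eventually_ge_at_top[of k0] by eventually_elim (use that in simp)
    show "(\<lambda>k. C * r ^ nat (int k - j)) \<longlonglongrightarrow> 0" by (rule geometric_null_shift[OF r])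
  qed
  have "log_ratio e' d' m2 (int k) = log_ratio e d m2 (int k)" if "k \<ge> k0" for k
  proof -
    have "ell e' d' m2 l = ell e d m2 l" for l
      unfolding ell_def by (rule arg_cong[OF pullback_cong]) (use agree' in auto)
    then show ?thesis by (simp add: log_ratio_def)
  qed
  then have "(\<lambda>k. log_ratio e d m2 (int k) - L k) \<longlonglongrightarrow> 0"
    using L(2) by (intro small[of _ C' m2]) simp
  moreover have "(\<lambda>k. log_ratio e d j1 (int k) - V k) \<longlonglongrightarrow> 0"
    using V(2) by (intro small[of _ C0 j1]) simp
  moreover obtain \<Gamma> where G: "(\<exists>m<nat (m2 - j1). D (t (j1 + int m)) = 0) \<longrightarrow> \<Gamma> > 1"
    "(\<lambda>k. log_ratio e d (j1 + int (nat (m2 - j1))) (int k) - \<Gamma> * log_ratio e d j1 (int k)) \<longlonglongrightarrow> 0"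
    using log_ratio_steps[OF c o ep] by metis
  have "j1 + int (nat (m2 - j1)) = m2" using j1(1) unfolding m2_def by linarith
  then have G2: "(\<lambda>k. log_ratio e d m2 (int k) - \<Gamma> * log_ratio e d j1 (int k)) \<longlonglongrightarrow> 0"
    using G(2) by simp
  have "\<exists>m<nat (m2 - j1). D (t (j1 + int m)) = 0"
    using j1(1) crit by (intro exI[of _ "nat (- j1)"]) (auto simp: m2_def)
  then have G1: "\<Gamma> > 1" using G(1) by blast
  have "(\<lambda>k. (log_ratio e d m2 (int k) - L k) - (V k - L k) - (log_ratio e d j1 (int k) - V k)
      - (log_ratio e d m2 (int k) - \<Gamma> * log_ratio e d j1 (int k))) \<longlonglongrightarrow> 0 - 0 - 0 - 0"
    by (intro tendsto_diff G2 calculation)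
  then have "(\<lambda>k. (\<Gamma> - 1) * log_ratio e d j1 (int k)) \<longlonglongrightarrow> 0" by (simp add: algebra_simps)
  then have "(\<lambda>k. (1 / (\<Gamma> - 1)) * ((\<Gamma> - 1) * log_ratio e d j1 (int k))) \<longlonglongrightarrow> (1 / (\<Gamma> - 1)) * 0"
    by (intro tendsto_mult tendsto_const)
  then have zero: "(\<lambda>k. log_ratio e d j1 (int k)) \<longlonglongrightarrow> 0" using G1 by simp
  show False
  proof (rule subexponential_contradiction)
    show "ell e d j1 (int k) > 0" for k using ell_pos[OF c] .
    show "ell e d j1 (int k) \<le> K * \<mu> ^ k" for k
    proof -
      have "ell e d j1 (int k) \<le> K * \<mu> ^ nat (int k - j1)" by (rule ell_decay[OF c])
      also have "\<dots> \<le> K * \<mu> ^ k"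
        using K_pos mu_pos mu_less_1 j1(1) by (intro mult_left_mono power_decreasing) auto
      finally show ?thesis .
    qed
    show "(\<lambda>k. ln (ell e d j1 (int (Suc k))) - ln (ell e d j1 (int k))) \<longlonglongrightarrow> 0"
      using zero by (simp add: log_ratio_def add.commute)
  qed (use mu_pos mu_less_1 K_pos in auto)
qed

end

theorem corollaryA1:
  fixes M :: "'a::t2_space manifold1" and f :: "'a \<Rightarrow> 'a"
  assumes "riemannian_manifold1 M"
    and "geometrically_finite M f"
  shows "\<not> continuous_map (dual_topology M f) euclideanreal (scaling_function M f)"
proof -
  interpret manifold_1d M using assms(1) by unfold_locales
  obtain \<alpha> where alpha: "0 < \<alpha>" "C1_alpha_geometrically_finite M \<alpha> f"
    using assms(2) by (auto simp: geometrically_finite_def)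
  have gf: "C1_alpha M \<alpha> f" "post_critical M f \<noteq> {}" "finite (post_critical M f)"
    "\<forall>c\<in>critical_points M f. \<forall>n\<ge>1. (f ^^ n) c \<noteq> c" "\<forall>C\<in>open_pieces M f. inj_on f C"
    using alpha(2) unfolding C1_alpha_geometrically_finite_def by blast+
  obtain K \<mu> where K: "K > 0" "0 < \<mu>" "\<mu> < 1" "\<forall>n. max_length M f n \<le> K * \<mu> ^ n"
    using alpha(2) unfolding C1_alpha_geometrically_finite_def by blast
  have "C1_self_map M f" using gf(1) by (simp add: C1_alpha_def)
  then obtain \<Phi> where Phi: "lifts f \<Phi>"
    "\<forall>t\<in>dom1 M. (\<Phi> has_real_derivative deriv1 M f (par M t)) (at t within dom1 M)"
    using lift_exists by blast
  interpret geometrically_finite_map M f \<alpha> K \<mu> \<Phi>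
    by unfold_locales (use alpha(1) gf K Phi in auto)
  show ?thesis by (rule scaling_function_discontinuous)
qed

end
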